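(* Let $\mathfrak M,\mathfrak N$ be separable Hilbert spaces and let $\Theta\in\mathbf S(\mathfrak M,\mathfrak N)$ be purely contractive, i.e. $\|\Theta(0)f\|<\|f\|$ for all $f\in\mathfrak M\setminus\{0\}$. If $\{\Gamma_n\}_{n\ge0}$ are the Schur parameters of $\Theta$, then the characteristic functions of the completely non-unitary contractions given by the truncated block operator CMV matrices $\mathcal T_0(\{\Gamma_n^*\}_{n\ge0})$ and $\widetilde{\mathcal T}_0(\{\Gamma_n^*\}_{n\ge0})$ coincide with $\Theta$.
   Context: A contraction is completely non-unitary if it has no nontrivial reducing subspace on which it acts as a unitary operator. The (Sz.-Nagy--Foias) characteristic function of a contraction $A$ in $\mathfrak H$ is $\Phi_A(\lambda)=(-A+\lambda D_{A^*}(I_{\mathfrak H}-\lambda A^* )^{-1}D_A)\!\upharpoonright\mathfrak D_A\in\mathbf S(\mathfrak D_A,\mathfrak D_{A^*})$, $\lambda\in\mathbb D$. Functions $\Theta\in\mathbf S(\mathfrak M,\mathfrak N)$ and $\Omega\in\mathbf S(\mathfrak K,\mathfrak L)$ coincide if there are unitary operators $V:\mathfrak N\to\mathfrak L$ and $U:\mathfrak K\to\mathfrak M$ with $V\Theta(\lambda)U=\Omega(\lambda)$ for all $\lambda\in\mathbb D=\{|\lambda|<1\}$. $\mathbf L(\mathfrak H_1,\mathfrak H_2)$ denotes the bounded linear operators from the complex Hilbert space $\mathfrak H_1$ to $\mathfrak H_2$. For a contraction $T\in\mathbf L(\mathfrak H_1,\mathfrak H_2)$: $D_T=(I-T^*T)^{1/2}$,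 $D_{T^*}=(I-TT^* )^{1/2}$, $\mathfrak D_T=\overline{\mathrm{ran}}\,D_T$, $\mathfrak D_{T^*}=\overline{\mathrm{ran}}\,D_{T^*}$ (either may be $\{0\}$). The elementary rotation of $T$ is the unitary operator $$\mathbf J_T=\begin{bmatrix}T&D_{T^*}\\ D_T&-T^*\end{bmatrix}:\mathfrak H_1\oplus\mathfrak D_{T^*}\to\mathfrak H_2\oplus\mathfrak D_T ,$$ with rows/columns belonging to zero spaces omitted: it is the row $[T\ \ I_{\mathfrak D_{T^*}}]$ if $T$ is isometric, the column $\begin{bmatrix}T\\ D_T\end{bmatrix}$ if $T$ is co-isometric, and $T$ if $T$ is unitary. Schur class and Schur parameters. $\mathbf S(\mathfrak M,\mathfrak N)$ is the set of holomorphic functions on $\mathbb D$ whose values are contractions in $\mathbf L(\mathfrak M,\mathfrak N)$. For $\Theta\in\mathbf S(\mathfrak M,\mathfrak N)$ put $\Theta_0=\Theta$, $\Gamma_0=\Theta(0)$; given $\Theta_n$ and $\Gamma_n=\Theta_n(0)$, let $\Theta_{n+1}\in\mathbf S(\mathfrak D_{\Gamma_n},\mathfrak D_{\Gamma_n^*})$ be the unique function with $$\Theta_n(\lambda)=\Gamma_n+\lambda D_{\Gamma_n^*}\Theta_{n+1}(\lambda)\bigl(I+\lambda\Gamma_n^*\Theta_{n+1}(\lambda)\bigr)^{-1}D_{\Gamma_n},\quad\lambda\in\mathbb D,$$ and $\Gamma_{n+1}=\Theta_{n+1}(0)$. The contractions $\Gamma_0\in\mathbf L(\mathfrak M,\mathfrak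 N)$, $\Gamma_n\in\mathbf L(\mathfrak D_{\Gamma_{n-1}},\mathfrak D_{\Gamma_{n-1}^*})$ are the Schur parameters of $\Theta$. If some $\Gamma_N$ is unitary the process terminates at $N$; then for $n>N$ all the spaces $\mathfrak D_{\Gamma_n},\mathfrak D_{\Gamma_n^*}$ are taken to be $\{0\}$ and $\Gamma_n=0$. If $\Gamma_N$ is isometric or co-isometric then $\Gamma_n=0$ for $n>N$. A sequence of contractions $\Gamma_0\in\mathbf L(\mathfrak M,\mathfrak N)$, $\Gamma_n\in\mathbf L(\mathfrak D_{\Gamma_{n-1}},\mathfrak D_{\Gamma_{n-1}^*})$, $n\ge 1$, is called a choice sequence. (Truncated) block operator CMV matrices. For a choice sequence $\{\Gamma_n\}_{n\ge0}$ starting from $\Gamma_0\in\mathbf L(\mathfrak M,\mathfrak N)$ let $$\mathfrak H_0=\bigoplus_{n\ge0}(\mathfrak D_{\Gamma_{2n}}\oplus\mathfrak D_{\Gamma^*_{2n+1}}),\qquad \widetilde{\mathfrak H}_0=\bigoplus_{n\ge0}(\mathfrak D_{\Gamma^*_{2n}}\oplus\mathfrak D_{\Gamma_{2n+1}})$$ (Hilbert space orthogonal sums; zero summands omitted). Here $\mathbf J_{\Gamma_0}:\mathfrak M\oplus\mathfrak D_{\Gamma_0^*}\to\mathfrak N\oplus\mathfrak D_{\Gamma_0}$ and $\mathbf J_{\Gamma_k}:\mathfrak D_{\Gamma_{k-1}}\oplus\mathfrak D_{\Gamma_k^*}\to\mathfrak D_{\Gamma_{k-1}^*}\oplus\mathfrak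 D_{\Gamma_k}$, $k\ge1$. Writing $\mathfrak M\oplus\widetilde{\mathfrak H}_0=(\mathfrak M\oplus\mathfrak D_{\Gamma_0^*})\oplus\bigoplus_{n\ge1}(\mathfrak D_{\Gamma_{2n-1}}\oplus\mathfrak D_{\Gamma_{2n}^*})$ and $\mathfrak N\oplus\mathfrak H_0=(\mathfrak N\oplus\mathfrak D_{\Gamma_0})\oplus\bigoplus_{n\ge1}(\mathfrak D_{\Gamma_{2n-1}^*}\oplus\mathfrak D_{\Gamma_{2n}})$, define the unitary operators $$\mathcal L_0=\mathbf J_{\Gamma_0}\oplus\bigoplus_{n\ge1}\mathbf J_{\Gamma_{2n}}:\mathfrak M\oplus\widetilde{\mathfrak H}_0\to\mathfrak N\oplus\mathfrak H_0,\qquad \mathcal V_0=\bigoplus_{n\ge1}\mathbf J_{\Gamma_{2n-1}}:\mathfrak H_0\to\widetilde{\mathfrak H}_0,$$ $$\mathcal U_0=\mathcal L_0(I_{\mathfrak M}\oplus\mathcal V_0):\mathfrak M\oplus\mathfrak H_0\to\mathfrak N\oplus\mathfrak H_0,\qquad \widetilde{\mathcal U}_0=(I_{\mathfrak N}\oplus\mathcal V_0)\mathcal L_0:\mathfrak M\oplus\widetilde{\mathfrak H}_0\to\mathfrak N\oplus\widetilde{\mathfrak H}_0 .$$ The truncated block operator CMV matrices are the contractions $$\mathcal T_0(\{\Gamma_n\}_{n\ge0})=P_{\mathfrak H_0}\mathcal U_0\!\upharpoonright\mathfrak H_0\in\mathbf L(\mathfrak H_0),\qquad \widetilde{\mathcal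 T}_0(\{\Gamma_n\}_{n\ge0})=P_{\widetilde{\mathfrak H}_0}\widetilde{\mathcal U}_0\!\upharpoonright\widetilde{\mathfrak H}_0\in\mathbf L(\widetilde{\mathfrak H}_0).$$ If $\{\Gamma_n\}$ is a choice sequence with $\Gamma_0\in\mathbf L(\mathfrak M,\mathfrak N)$, then $\{\Gamma_n^*\}$ is a choice sequence with $\Gamma_0^*\in\mathbf L(\mathfrak N,\mathfrak M)$, and $\mathcal T_0(\{\Gamma_n^*\})$, $\widetilde{\mathcal T}_0(\{\Gamma_n^*\})$ are obtained by applying the construction to it. *)

theory Defs
  imports "HOL-Analysis.Analysis" "HOL-Library.Nonpos_Ints"
begin

section \<open>Complex Hilbert spaces\<close>

text \<open>A complex Hilbert space is a complete real inner product space (so that its norm and topology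
  are the library ones) with a compatible complex structure; \<^term>\<open>inner\<close> is the real part of the
  complex inner product, which is linear in its first argument. The zero space is allowed.\<close>

class chilbert_space = real_inner + banach +
  fixes scaleC :: "complex \<Rightarrow> 'a \<Rightarrow> 'a" (infixr \<open>*\<^sub>C\<close> 75)
    and cinner :: "'a \<Rightarrow> 'a \<Rightarrow> complex"
  assumes scaleC_add_right: "c *\<^sub>C (x + y) = c *\<^sub>C x + c *\<^sub>C y"
    and scaleC_add_left: "(c + d) *\<^sub>C x = c *\<^sub>C x + d *\<^sub>C x"
    and scaleC_scaleC: "c *\<^sub>C d *\<^sub>C x = (c * d) *\<^sub>C x"
    and scaleC_of_real: "complex_of_real r *\<^sub>C x = r *\<^sub>R x"
    and cinner_commute: "cinner x y = cnj (cinner y x)"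
    and cinner_add_left: "cinner (x + y) z = cinner x z + cinner y z"
    and cinner_scaleC_left: "cinner (c *\<^sub>C x) y = c * cinner x y"
    and Re_cinner: "Re (cinner x y) = inner x y"

lemma cinner_self: "cinner x x = complex_of_real (inner x x)"
proof -
  have "Im (cinner x x) = 0"
    using arg_cong[OF cinner_commute[of x x], of Im] by simp
  then show ?thesis by (simp add: complex_eq_iff Re_cinner)
qed

lemma cinner_scaleC_right: "cinner x (c *\<^sub>C y) = cnj c * cinner x y"
  by (metis cinner_commute cinner_scaleC_left complex_cnj_mult)

lemma norm_scaleC: "norm (c *\<^sub>C x) = cmod c * norm x"
proof -
  have "cinner (c *\<^sub>C x) (c *\<^sub>C x) = complex_of_real ((cmod c)\<^sup>2 * inner x x)"
    by (simp only: cinner_scaleC_left cinner_scaleC_right cinner_self[of x] of_real_mult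
        complex_norm_square[of c] mult.assoc mult.left_commute)
  then have "inner (c *\<^sub>C x) (c *\<^sub>C x) = (cmod c)\<^sup>2 * inner x x"
    by (metis Re_cinner Re_complex_of_real)
  then show ?thesis
    by (simp add: norm_eq_sqrt_inner real_sqrt_mult)
qed

lemma Im_cinner: "Im (cinner x y) = inner ((-\<i>) *\<^sub>C x) y"
  by (simp add: cinner_scaleC_left flip: Re_cinner)

instantiation complex :: chilbert_space
begin
definition scaleC_complex :: "complex \<Rightarrow> complex \<Rightarrow> complex" where "scaleC_complex = (*)"
definition cinner_complex :: "complex \<Rightarrow> complex \<Rightarrow> complex" where "cinner_complex x y = x * cnj y"
instance
  by standard
    (simp_all add: scaleC_complex_def cinner_complex_def algebra_simps inner_complex_def scaleR_conv_of_real)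
end

instantiation prod :: (chilbert_space, chilbert_space) chilbert_space
begin
definition scaleC_prod :: "complex \<Rightarrow> 'a \<times> 'b \<Rightarrow> 'a \<times> 'b"
  where "scaleC_prod c p = (c *\<^sub>C fst p, c *\<^sub>C snd p)"
definition cinner_prod :: "'a \<times> 'b \<Rightarrow> 'a \<times> 'b \<Rightarrow> complex"
  where "cinner_prod p q = cinner (fst p) (fst q) + cinner (snd p) (snd q)"
instance
  by standard
    (auto simp: scaleC_prod_def cinner_prod_def scaleC_add_right scaleC_add_left scaleC_scaleC
      scaleC_of_real cinner_add_left cinner_scaleC_left Re_cinner inner_prod_def scaleR_prod_def
      ring_distribs simp flip: cinner_commute)
end

section \<open>Square-summable sequences in a Hilbert space\<close>

typedef (overloaded) 'a ell2 = "{f :: nat \<Rightarrow> 'a::chilbert_space. summable (\<lambda>n. (norm (f n))\<^sup>2)}"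
  morphisms ell2_nth Abs_ell2
  by (rule exI[of _ "\<lambda>_. 0"]) simp

setup_lifting type_definition_ell2

lemma norm_add_square_le:
  fixes x y :: "'a::real_inner"
  shows "(norm (x + y))\<^sup>2 \<le> 2 * ((norm x)\<^sup>2 + (norm y)\<^sup>2)"
proof -
  have "(norm (x + y))\<^sup>2 \<le> (norm x + norm y)\<^sup>2"
    by (intro power_mono norm_triangle_ineq norm_ge_zero)
  also have "\<dots> \<le> 2 * ((norm x)\<^sup>2 + (norm y)\<^sup>2)"
    using sum_squares_bound[of "norm x" "norm y"] by (simp add: power2_sum)
  finally show ?thesis .
qed

lemma summable_norm_add_square:
  fixes f g :: "nat \<Rightarrow> 'a::real_inner"
  assumes "summable (\<lambda>n. (norm (f n))\<^sup>2)" "summable (\<lambda>n. (norm (g n))\<^sup>2)"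
  shows "summable (\<lambda>n. (norm (f n + g n))\<^sup>2)"
proof (rule summable_comparison_test'[OF summable_mult[OF summable_add[OF assms], of 2], of 0])
  fix n
  show "norm ((norm (f n + g n))\<^sup>2) \<le> 2 * ((norm (f n))\<^sup>2 + (norm (g n))\<^sup>2)"
    using norm_add_square_le[of "f n" "g n"] by simp
qed

lemma summable_ell2_inner:
  fixes f g :: "nat \<Rightarrow> 'a::real_inner"
  assumes "summable (\<lambda>n. (norm (f n))\<^sup>2)" "summable (\<lambda>n. (norm (g n))\<^sup>2)"
  shows "summable (\<lambda>n. inner (f n) (g n))"
proof (rule summable_comparison_test'[OF summable_add[OF assms], of 0])
  fix n
  have "\<bar>inner (f n) (g n)\<bar> \<le> norm (f n) * norm (g n)"
    by (rule Cauchy_Schwarz_ineq2)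
  also have "\<dots> \<le> (norm (f n))\<^sup>2 + (norm (g n))\<^sup>2"
    using sum_squares_bound[of "norm (f n)" "norm (g n)"]
      mult_nonneg_nonneg[OF norm_ge_zero norm_ge_zero, of "f n" "g n"] by linarith
  finally show "norm (inner (f n) (g n)) \<le> (norm (f n))\<^sup>2 + (norm (g n))\<^sup>2" by simp
qed

lemma summable_norm_scaleC_square:
  fixes f :: "nat \<Rightarrow> 'a::chilbert_space"
  assumes "summable (\<lambda>n. (norm (f n))\<^sup>2)"
  shows "summable (\<lambda>n. (norm (c *\<^sub>C f n))\<^sup>2)"
  using summable_mult[OF assms, of "(cmod c)\<^sup>2"] by (simp add: norm_scaleC power_mult_distrib)

lemma summable_ell2_cinner:
  fixes f g :: "nat \<Rightarrow> 'a::chilbert_space"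
  assumes "summable (\<lambda>n. (norm (f n))\<^sup>2)" "summable (\<lambda>n. (norm (g n))\<^sup>2)"
  shows "summable (\<lambda>n. cinner (f n) (g n))"
  unfolding summable_complex_iff Im_cinner Re_cinner
  using summable_ell2_inner[OF assms]
    summable_ell2_inner[OF summable_norm_scaleC_square[OF assms(1)] assms(2)] by blast

instantiation ell2 :: (chilbert_space) real_inner
begin

lift_definition zero_ell2 :: "'a ell2" is "\<lambda>_. 0" by simp
lift_definition plus_ell2 :: "'a ell2 \<Rightarrow> 'a ell2 \<Rightarrow> 'a ell2" is "\<lambda>f g n. f n + g n"
  by (rule summable_norm_add_square)
lift_definition uminus_ell2 :: "'a ell2 \<Rightarrow> 'a ell2" is "\<lambda>f n. - f n" by simp
lift_definition minus_ell2 :: "'a ell2 \<Rightarrow> 'a ell2 \<Rightarrow> 'a ell2" is "\<lambda>f g n. f n - g n"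
proof -
  fix f g :: "nat \<Rightarrow> 'a"
  assume "summable (\<lambda>n. (norm (f n))\<^sup>2)" "summable (\<lambda>n. (norm (g n))\<^sup>2)"
  then show "summable (\<lambda>n. (norm (f n - g n))\<^sup>2)"
    using summable_norm_add_square[of f "\<lambda>n. - g n"] by simp
qed
lift_definition scaleR_ell2 :: "real \<Rightarrow> 'a ell2 \<Rightarrow> 'a ell2" is "\<lambda>r f n. r *\<^sub>R f n"
  by (simp add: power_mult_distrib summable_mult)
lift_definition inner_ell2 :: "'a ell2 \<Rightarrow> 'a ell2 \<Rightarrow> real" is "\<lambda>f g. \<Sum>n. inner (f n) (g n)" .
definition norm_ell2 :: "'a ell2 \<Rightarrow> real" where "norm_ell2 x = sqrt (inner x x)"
definition dist_ell2 :: "'a ell2 \<Rightarrow> 'a ell2 \<Rightarrow> real" where "dist_ell2 x y = norm (x - y)"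
definition sgn_ell2 :: "'a ell2 \<Rightarrow> 'a ell2" where "sgn_ell2 x = inverse (norm x) *\<^sub>R x"
definition uniformity_ell2 :: "('a ell2 \<times> 'a ell2) filter"
  where "uniformity_ell2 = (INF e\<in>{0<..}. principal {(x, y). dist x y < e})"
definition open_ell2 :: "'a ell2 set \<Rightarrow> bool"
  where "open_ell2 U \<longleftrightarrow> (\<forall>x\<in>U. \<forall>\<^sub>F (x', y) in uniformity. x' = x \<longrightarrow> y \<in> U)"

instance
proof
  fix x y z :: "'a ell2" and a b r :: real and U :: "'a ell2 set"
  show "x + y + z = x + (y + z)" by transfer (simp add: add.assoc)
  show "x + y = y + x" by transfer (simp add: add.commute)
  show "0 + x = x" by transfer simp
  show "- x + x = 0" by transfer simp
  show "x - y = x + - y" by transfer simp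
  show "a *\<^sub>R (x + y) = a *\<^sub>R x + a *\<^sub>R y" by transfer (simp add: scaleR_add_right)
  show "(a + b) *\<^sub>R x = a *\<^sub>R x + b *\<^sub>R x" by transfer (simp add: scaleR_add_left)
  show "a *\<^sub>R b *\<^sub>R x = (a * b) *\<^sub>R x" by transfer simp
  show "1 *\<^sub>R x = x" by transfer simp
  show "sgn x = inverse (norm x) *\<^sub>R x" by (rule sgn_ell2_def)
  show "dist x y = norm (x - y)" by (rule dist_ell2_def)
  show "uniformity = (INF e\<in>{0<..}. principal {(x :: 'a ell2, y). dist x y < e})"
    by (rule uniformity_ell2_def)
  show "open U = (\<forall>x\<in>U. \<forall>\<^sub>F (x', y) in uniformity. x' = x \<longrightarrow> y \<in> U)"
    by (rule open_ell2_def)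
  show "inner x y = inner y x" by transfer (simp add: inner_commute)
  show "inner (x + y) z = inner x z + inner y z"
    by transfer (simp add: inner_add_left suminf_add[symmetric] summable_ell2_inner)
  show "inner (r *\<^sub>R x) y = r * inner x y"
    by transfer (simp add: suminf_mult summable_ell2_inner)
  show "0 \<le> inner x x"
    by transfer (simp add: suminf_nonneg summable_ell2_inner)
  show "inner x x = 0 \<longleftrightarrow> x = 0"
    by transfer (simp add: suminf_eq_zero_iff summable_ell2_inner fun_eq_iff)
  show "norm x = sqrt (inner x x)" by (rule norm_ell2_def)
qed

end

lemma norm_ell2_square: "(norm x)\<^sup>2 = (\<Sum>n. (norm (ell2_nth x n))\<^sup>2)"
  unfolding power2_norm_eq_inner inner_ell2.rep_eq ..

lemma summable_ell2_nth: "summable (\<lambda>n. (norm (ell2_nth x n))\<^sup>2)"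
  using ell2_nth[of x] by simp

lemma norm_ell2_nth_le: "norm (ell2_nth x n) \<le> norm x"
proof -
  have "(norm (ell2_nth x n))\<^sup>2 \<le> (norm x)\<^sup>2"
    using sum_le_suminf[OF summable_ell2_nth, of "{n}" x] by (simp add: norm_ell2_square)
  then show ?thesis by (rule power2_le_imp_le) simp
qed

instance ell2 :: (chilbert_space) banach
proof
  fix X :: "nat \<Rightarrow> 'a ell2"
  assume X: "Cauchy X"
  have "Cauchy (\<lambda>i. ell2_nth (X i) n)" for n
  proof (rule metric_CauchyI)
    fix e :: real assume "e > 0"
    then obtain M where M: "\<And>i j. i \<ge> M \<Longrightarrow> j \<ge> M \<Longrightarrow> dist (X i) (X j) < e"
      using metric_CauchyD[OF X] by metis
    have "dist (ell2_nth (X i) n) (ell2_nth (X j) n) \<le> dist (X i) (X j)" for i j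
      using norm_ell2_nth_le[of "X i - X j" n] by (simp add: dist_norm minus_ell2.rep_eq)
    with M show "\<exists>M. \<forall>i\<ge>M. \<forall>j\<ge>M. dist (ell2_nth (X i) n) (ell2_nth (X j) n) < e"
      by (meson le_less_trans)
  qed
  then have "\<exists>l. (\<lambda>i. ell2_nth (X i) n) \<longlonglongrightarrow> l" for n
    by (meson Cauchy_convergent convergent_def)
  then obtain L where L: "\<And>n. (\<lambda>i. ell2_nth (X i) n) \<longlonglongrightarrow> L n"
    by metis
  have bound: "summable (\<lambda>n. (norm (ell2_nth (X i) n - L n))\<^sup>2) \<and>
      (\<Sum>n. (norm (ell2_nth (X i) n - L n))\<^sup>2) \<le> e\<^sup>2"
    if M: "\<And>j. j \<ge> M \<Longrightarrow> norm (X i - X j) \<le> e" for i M e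
  proof -
    have fin: "(\<Sum>n<N. (norm (ell2_nth (X i) n - L n))\<^sup>2) \<le> e\<^sup>2" for N
    proof (rule LIMSEQ_le_const2)
      show "(\<lambda>j. \<Sum>n<N. (norm (ell2_nth (X i) n - ell2_nth (X j) n))\<^sup>2)
          \<longlonglongrightarrow> (\<Sum>n<N. (norm (ell2_nth (X i) n - L n))\<^sup>2)"
        by (intro tendsto_intros L)
      have "(\<Sum>n<N. (norm (ell2_nth (X i) n - ell2_nth (X j) n))\<^sup>2) \<le> e\<^sup>2" if "j \<ge> M" for j
      proof -
        have "(\<Sum>n<N. (norm (ell2_nth (X i) n - ell2_nth (X j) n))\<^sup>2) \<le> (norm (X i - X j))\<^sup>2"
          using sum_le_suminf[OF summable_ell2_nth, of "{..<N}" "X i - X j"]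
          by (simp add: norm_ell2_square minus_ell2.rep_eq)
        also have "\<dots> \<le> e\<^sup>2"
          by (intro power_mono M that norm_ge_zero)
        finally show ?thesis .
      qed
      then show "\<exists>M. \<forall>j\<ge>M. (\<Sum>n<N. (norm (ell2_nth (X i) n - ell2_nth (X j) n))\<^sup>2) \<le> e\<^sup>2"
        by blast
    qed
    have "summable (\<lambda>n. (norm (ell2_nth (X i) n - L n))\<^sup>2)"
      by (rule summableI_nonneg_bounded[where x = "e\<^sup>2"]) (auto intro: fin)
    then show ?thesis
      using fin by (auto intro: suminf_le_const)
  qed
  have cau: "\<exists>M. \<forall>i\<ge>M. \<forall>j\<ge>M. norm (X i - X j) < e" if "e > 0" for e
    using metric_CauchyD[OF X that] by (simp add: dist_norm)
  have "summable (\<lambda>n. (norm (L n))\<^sup>2)"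
  proof -
    obtain M where "\<forall>j\<ge>M. norm (X M - X j) < 1"
      using cau[of 1] by auto
    then have "summable (\<lambda>n. (norm (ell2_nth (X M) n - L n))\<^sup>2)"
      using bound[of M M 1] by force
    then have "summable (\<lambda>n. (norm (L n - ell2_nth (X M) n))\<^sup>2)"
      by (simp add: norm_minus_commute)
    from summable_norm_add_square[OF this summable_ell2_nth[of "X M"]]
    show ?thesis by simp
  qed
  then have nth: "ell2_nth (Abs_ell2 L) = L"
    by (simp add: Abs_ell2_inverse)
  have "X \<longlonglongrightarrow> Abs_ell2 L"
  proof (rule metric_LIMSEQ_I)
    fix e :: real assume "e > 0"
    then obtain M where M: "\<forall>i\<ge>M. \<forall>j\<ge>M. norm (X i - X j) < e / 2"
      using cau[of "e / 2"] by auto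
    have "dist (X i) (Abs_ell2 L) < e" if "i \<ge> M" for i
    proof -
      have "(norm (X i - Abs_ell2 L))\<^sup>2 \<le> (e / 2)\<^sup>2"
        using bound[of M i "e / 2"] M that
        by (auto simp: norm_ell2_square minus_ell2.rep_eq nth intro: less_imp_le)
      then have "norm (X i - Abs_ell2 L) \<le> e / 2"
        by (rule power2_le_imp_le) (use \<open>e > 0\<close> in simp)
      then show ?thesis using \<open>e > 0\<close> by (simp add: dist_norm)
    qed
    then show "\<exists>M. \<forall>i\<ge>M. dist (X i) (Abs_ell2 L) < e" by blast
  qed
  then show "convergent X" by (auto simp: convergent_def)
qed

instantiation ell2 :: (chilbert_space) chilbert_space
begin

lift_definition scaleC_ell2 :: "complex \<Rightarrow> 'a ell2 \<Rightarrow> 'a ell2" is "\<lambda>c f n. c *\<^sub>C f n"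
  by (rule summable_norm_scaleC_square)
lift_definition cinner_ell2 :: "'a ell2 \<Rightarrow> 'a ell2 \<Rightarrow> complex" is "\<lambda>f g. \<Sum>n. cinner (f n) (g n)" .

instance
proof
  fix x y z :: "'a ell2" and c d :: complex and r :: real
  show "c *\<^sub>C (x + y) = c *\<^sub>C x + c *\<^sub>C y" by transfer (simp add: scaleC_add_right)
  show "(c + d) *\<^sub>C x = c *\<^sub>C x + d *\<^sub>C x" by transfer (simp add: scaleC_add_left)
  show "c *\<^sub>C d *\<^sub>C x = (c * d) *\<^sub>C x" by transfer (simp add: scaleC_scaleC)
  show "complex_of_real r *\<^sub>C x = r *\<^sub>R x" by transfer (simp add: scaleC_of_real)
  show "cinner x y = cnj (cinner y x)"
  proof transfer
    fix f g :: "nat \<Rightarrow> 'a"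
    assume "summable (\<lambda>n. (norm (f n))\<^sup>2)" "summable (\<lambda>n. (norm (g n))\<^sup>2)"
    then have "(\<lambda>n. cinner (g n) (f n)) sums (\<Sum>n. cinner (g n) (f n))"
      by (intro summable_sums summable_ell2_cinner)
    then have "(\<lambda>n. cnj (cinner (g n) (f n))) sums cnj (\<Sum>n. cinner (g n) (f n))"
      by (simp add: sums_cnj)
    then show "(\<Sum>n. cinner (f n) (g n)) = cnj (\<Sum>n. cinner (g n) (f n))"
      by (simp add: sums_iff flip: cinner_commute)
  qed
  show "cinner (x + y) z = cinner x z + cinner y z"
    by transfer (simp add: cinner_add_left suminf_add[symmetric] summable_ell2_cinner)
  show "cinner (c *\<^sub>C x) y = c * cinner x y"
    by transfer (simp add: cinner_scaleC_left suminf_mult summable_ell2_cinner)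
  show "Re (cinner x y) = inner x y"
    by transfer (simp add: summable_ell2_cinner flip: Re_cinner Re_suminf)
qed

end

section \<open>Operators between closed subspaces\<close>

definition closed_csubspace :: "'a::chilbert_space set \<Rightarrow> bool" where
  "closed_csubspace S \<longleftrightarrow> closed S \<and> subspace S \<and> (\<forall>c. \<forall>x\<in>S. c *\<^sub>C x \<in> S)"

text \<open>All Hilbert spaces below are closed subspaces \<open>S\<close> of types of class \<^class>\<open>chilbert_space\<close>. A
  bounded operator from \<open>S\<close> to \<open>T\<close> is encoded by its extension by zero to the orthogonal complement
  of \<open>S\<close>. With this encoding equality of operators is equality of functions, sums, composition and
  the adjoint are those of the ambient spaces, and the identity of \<open>S\<close> is the orthogonal
  projection onto \<open>S\<close>.\<close>

definition bop :: "'a::chilbert_space set \<Rightarrow> 'b::chilbert_space set \<Rightarrow> ('a \<Rightarrow> 'b) set" where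
  "bop S T = {A. bounded_linear A \<and> (\<forall>c x. A (c *\<^sub>C x) = c *\<^sub>C A x) \<and> range A \<subseteq> T \<and>
     (\<forall>x. (\<forall>y\<in>S. cinner x y = 0) \<longrightarrow> A x = 0)}"

definition proj :: "'a::chilbert_space set \<Rightarrow> 'a \<Rightarrow> 'a" where
  "proj S x = (THE p. p \<in> S \<and> (\<forall>y\<in>S. cinner (x - p) y = 0))"

definition cadjoint :: "('a::chilbert_space \<Rightarrow> 'b::chilbert_space) \<Rightarrow> 'b \<Rightarrow> 'a" where
  "cadjoint A = (THE B. \<forall>x y. cinner (A x) y = cinner x (B y))"

definition psqrt :: "('a::chilbert_space \<Rightarrow> 'a) \<Rightarrow> 'a \<Rightarrow> 'a" where
  "psqrt A = (THE B. B \<in> bop UNIV UNIV \<and> (\<forall>x. cinner (B x) x \<in> \<real>\<^sub>\<ge>\<^sub>0) \<and> B \<circ> B = A)"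

definition op_inverse :: "'a::chilbert_space set \<Rightarrow> ('a \<Rightarrow> 'a) \<Rightarrow> 'a \<Rightarrow> 'a" where
  "op_inverse S A = (THE B. B \<in> bop S S \<and> (\<forall>x\<in>S. B (A x) = x \<and> A (B x) = x))"

definition contractions :: "'a::chilbert_space set \<Rightarrow> 'b::chilbert_space set \<Rightarrow> ('a \<Rightarrow> 'b) set" where
  "contractions S T = {A \<in> bop S T. \<forall>x. norm (A x) \<le> norm x}"

definition unitaries :: "'a::chilbert_space set \<Rightarrow> 'b::chilbert_space set \<Rightarrow> ('a \<Rightarrow> 'b) set" where
  "unitaries S T = {A \<in> bop S T. A ` S = T \<and> (\<forall>x\<in>S. \<forall>y\<in>S. cinner (A x) (A y) = cinner x y)}"

text \<open>For a contraction \<open>A\<close> from \<open>S\<close> to \<open>T\<close>: the defect operator \<open>D\<^sub>A = (I - A\<^sup>*A)\<^bsup>1/2\<^esup>\<close>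
  is \<open>defect_op S A\<close>, and \<open>D\<close> of the adjoint is \<open>defect_op T (cadjoint A)\<close>.\<close>

definition defect_op :: "'a::chilbert_space set \<Rightarrow> ('a \<Rightarrow> 'b::chilbert_space) \<Rightarrow> 'a \<Rightarrow> 'a" where
  "defect_op S A = psqrt (\<lambda>x. proj S x - cadjoint A (A x))"

definition defect_space :: "'a::chilbert_space set \<Rightarrow> ('a \<Rightarrow> 'b::chilbert_space) \<Rightarrow> 'a set" where
  "defect_space S A = closure (range (defect_op S A))"

text \<open>The elementary rotation, as an operator from \<open>S \<times> defect_space T (cadjoint A)\<close> to
  \<open>T \<times> defect_space S A\<close>; the projection implements the extension by zero.\<close>

definition rotation ::
  "'a::chilbert_space set \<Rightarrow> 'b::chilbert_space set \<Rightarrow> ('a \<Rightarrow> 'b) \<Rightarrow> 'a \<times> 'b \<Rightarrow> 'b \<times> 'a" where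
  "rotation S T A = (\<lambda>(x, y). let y' = proj (defect_space T (cadjoint A)) y in
     (A x + defect_op T (cadjoint A) y', defect_op S A x - cadjoint A y'))"

section \<open>Characteristic functions\<close>

definition reduces :: "'a::chilbert_space set \<Rightarrow> ('a \<Rightarrow> 'a) \<Rightarrow> bool" where
  "reduces K A \<longleftrightarrow> closed_csubspace K \<and> A ` K \<subseteq> K \<and> cadjoint A ` K \<subseteq> K"

definition completely_nonunitary :: "'a::chilbert_space set \<Rightarrow> ('a \<Rightarrow> 'a) \<Rightarrow> bool" where
  "completely_nonunitary S A \<longleftrightarrow> A \<in> contractions S S \<and>
     (\<forall>K. K \<subseteq> S \<and> reduces K A \<and> A \<circ> proj K \<in> unitaries K K \<longrightarrow> K = {0})"

definition char_fun :: "'a::chilbert_space set \<Rightarrow> ('a \<Rightarrow> 'a) \<Rightarrow> complex \<Rightarrow> 'a \<Rightarrow> 'a" where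
  "char_fun S A z = (\<lambda>x. - A x + z *\<^sub>C defect_op S (cadjoint A)
       (op_inverse S (\<lambda>y. proj S y - z *\<^sub>C cadjoint A y) (defect_op S A x)))
     \<circ> proj (defect_space S A)"

text \<open>Coincidence of \<open>\<Theta>\<close> with values in \<open>L(M, N)\<close> and \<open>\<Omega>\<close> with values in \<open>L(K, L)\<close>.\<close>

definition coincide ::
  "'a::chilbert_space set \<Rightarrow> 'b::chilbert_space set \<Rightarrow> (complex \<Rightarrow> 'a \<Rightarrow> 'b) \<Rightarrow>
   'c::chilbert_space set \<Rightarrow> 'd::chilbert_space set \<Rightarrow> (complex \<Rightarrow> 'c \<Rightarrow> 'd) \<Rightarrow> bool" where
  "coincide M N \<Theta> K L \<Omega> \<longleftrightarrow>
     (\<exists>V \<in> unitaries N L. \<exists>U \<in> unitaries K M. \<forall>z. norm z < 1 \<longrightarrow> V \<circ> \<Theta> z \<circ> U = \<Omega> z)"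

section \<open>Schur class and Schur parameters\<close>

definition schur_class ::
  "'a::chilbert_space set \<Rightarrow> 'b::chilbert_space set \<Rightarrow> (complex \<Rightarrow> 'a \<Rightarrow> 'b) set" where
  "schur_class M N = {\<Theta>. (\<forall>z. norm z < 1 \<longrightarrow> \<Theta> z \<in> contractions M N) \<and>
     (\<forall>z. norm z < 1 \<longrightarrow> (\<exists>\<Theta>' \<in> bop M N.
        ((\<lambda>h. onorm (\<lambda>x. (1 / h) *\<^sub>C (\<Theta> (z + h) x - \<Theta> z x) - \<Theta>' x)) \<longlongrightarrow> 0) (at 0)))}"

text \<open>\<open>dom_space \<Gamma> n\<close> and \<open>cod_space \<Gamma> n\<close> are the spaces between which \<open>\<Gamma> n\<close> acts: the
  whole types for \<open>n = 0\<close>, and the defect spaces of \<open>\<Gamma> (n - 1)\<close> and its adjoint for \<open>n > 0\<close>. All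
  of them are subspaces of the two spaces of \<open>\<Gamma> 0\<close>.\<close>

primrec dom_space :: "(nat \<Rightarrow> 'a::chilbert_space \<Rightarrow> 'b::chilbert_space) \<Rightarrow> nat \<Rightarrow> 'a set" where
  "dom_space \<Gamma> 0 = UNIV"
| "dom_space \<Gamma> (Suc n) = defect_space (dom_space \<Gamma> n) (\<Gamma> n)"

primrec cod_space :: "(nat \<Rightarrow> 'a::chilbert_space \<Rightarrow> 'b::chilbert_space) \<Rightarrow> nat \<Rightarrow> 'b set" where
  "cod_space \<Gamma> 0 = UNIV"
| "cod_space \<Gamma> (Suc n) = defect_space (cod_space \<Gamma> n) (cadjoint (\<Gamma> n))"

text \<open>Termination of the Schur algorithm needs no separate clause: once a defect space is zero, the
  later \<open>\<Theta>\<^sub>n\<close> and \<open>\<Gamma>\<^sub>n\<close> act from or to the zero space and hence vanish.\<close>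

definition schur_parameters ::
  "(complex \<Rightarrow> 'a::chilbert_space \<Rightarrow> 'b::chilbert_space) \<Rightarrow> (nat \<Rightarrow> 'a \<Rightarrow> 'b) \<Rightarrow> bool" where
  "schur_parameters \<Theta> \<Gamma> \<longleftrightarrow> (\<exists>\<Theta>s. \<Theta>s 0 = \<Theta> \<and>
     (\<forall>n. \<Theta>s n \<in> schur_class (dom_space \<Gamma> n) (cod_space \<Gamma> n) \<and> \<Gamma> n = \<Theta>s n 0 \<and>
       (\<forall>z. norm z < 1 \<longrightarrow> \<Theta>s n z = (\<lambda>x. \<Gamma> n x +
          z *\<^sub>C defect_op (cod_space \<Gamma> n) (cadjoint (\<Gamma> n)) (\<Theta>s (Suc n) z
            (op_inverse (dom_space \<Gamma> (Suc n))
               (\<lambda>y. proj (dom_space \<Gamma> (Suc n)) y + z *\<^sub>C cadjoint (\<Gamma> n) (\<Theta>s (Suc n) z y))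
               (defect_op (dom_space \<Gamma> n) (\<Gamma> n) x)))))))"

section \<open>Truncated block operator CMV matrices\<close>

text \<open>\<open>H0_space \<Gamma>\<close> is the orthogonal sum of the \<open>\<DD>(\<Gamma>\<^bsub>2n\<^esub>) \<oplus> \<DD>(\<Gamma>\<^bsub>2n+1\<^esub>\<^sup>*)\<close>, and
  \<open>H0t_space \<Gamma>\<close> that of the \<open>\<DD>(\<Gamma>\<^bsub>2n\<^esub>\<^sup>*) \<oplus> \<DD>(\<Gamma>\<^bsub>2n+1\<^esub>)\<close>.\<close>

definition H0_space ::
  "(nat \<Rightarrow> 'a::chilbert_space \<Rightarrow> 'b::chilbert_space) \<Rightarrow> ('a \<times> 'b) ell2 set" where
  "H0_space \<Gamma> =
     {h. \<forall>n. ell2_nth h n \<in> dom_space \<Gamma> (Suc (2 * n)) \<times> cod_space \<Gamma> (Suc (2 * n + 1))}"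

definition H0t_space ::
  "(nat \<Rightarrow> 'a::chilbert_space \<Rightarrow> 'b::chilbert_space) \<Rightarrow> ('b \<times> 'a) ell2 set" where
  "H0t_space \<Gamma> =
     {h. \<forall>n. ell2_nth h n \<in> cod_space \<Gamma> (Suc (2 * n)) \<times> dom_space \<Gamma> (Suc (2 * n + 1))}"

text \<open>Orthogonal sum of a sequence of operators, meaningful if they are uniformly bounded.\<close>

definition ell2_map ::
  "(nat \<Rightarrow> 'a::chilbert_space \<Rightarrow> 'b::chilbert_space) \<Rightarrow> 'a ell2 \<Rightarrow> 'b ell2" where
  "ell2_map A h = Abs_ell2 (\<lambda>n. A n (ell2_nth h n))"

text \<open>The identification of \<open>X \<oplus> \<Oplus>\<^sub>n (Y\<^sub>n \<oplus> X\<^sub>n)\<close> with \<open>(X \<oplus> Y\<^sub>0) \<oplus> \<Oplus>\<^sub>n (X\<^sub>n \<oplus> Y\<^bsub>n+1\<^esub>)\<close>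
  and its inverse.\<close>

definition regroup :: "'a::chilbert_space \<times> ('b::chilbert_space \<times> 'a) ell2 \<Rightarrow> ('a \<times> 'b) ell2" where
  "regroup = (\<lambda>(f, h). Abs_ell2
     (\<lambda>n. (case n of 0 \<Rightarrow> f | Suc m \<Rightarrow> snd (ell2_nth h m), fst (ell2_nth h n))))"

definition ungroup :: "('a::chilbert_space \<times> 'b::chilbert_space) ell2 \<Rightarrow> 'a \<times> ('b \<times> 'a) ell2" where
  "ungroup k = (fst (ell2_nth k 0),
     Abs_ell2 (\<lambda>n. (snd (ell2_nth k n), fst (ell2_nth k (Suc n)))))"

definition J_rot :: "(nat \<Rightarrow> 'a::chilbert_space \<Rightarrow> 'b::chilbert_space) \<Rightarrow> nat \<Rightarrow> 'a \<times> 'b \<Rightarrow> 'b \<times> 'a" where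
  "J_rot \<Gamma> n = rotation (dom_space \<Gamma> n) (cod_space \<Gamma> n) (\<Gamma> n)"

definition L0 ::
  "(nat \<Rightarrow> 'a::chilbert_space \<Rightarrow> 'b::chilbert_space) \<Rightarrow> 'a \<times> ('b \<times> 'a) ell2 \<Rightarrow> 'b \<times> ('a \<times> 'b) ell2" where
  "L0 \<Gamma> = ungroup \<circ> ell2_map (\<lambda>n. J_rot \<Gamma> (2 * n)) \<circ> regroup"

definition V0 :: "(nat \<Rightarrow> 'a::chilbert_space \<Rightarrow> 'b::chilbert_space) \<Rightarrow> ('a \<times> 'b) ell2 \<Rightarrow> ('b \<times> 'a) ell2" where
  "V0 \<Gamma> = ell2_map (\<lambda>n. J_rot \<Gamma> (2 * n + 1))"

definition U0 ::
  "(nat \<Rightarrow> 'a::chilbert_space \<Rightarrow> 'b::chilbert_space) \<Rightarrow> 'a \<times> ('a \<times> 'b) ell2 \<Rightarrow> 'b \<times> ('a \<times> 'b) ell2" where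
  "U0 \<Gamma> = L0 \<Gamma> \<circ> map_prod id (V0 \<Gamma>)"

definition U0t ::
  "(nat \<Rightarrow> 'a::chilbert_space \<Rightarrow> 'b::chilbert_space) \<Rightarrow> 'a \<times> ('b \<times> 'a) ell2 \<Rightarrow> 'b \<times> ('b \<times> 'a) ell2" where
  "U0t \<Gamma> = map_prod id (V0 \<Gamma>) \<circ> L0 \<Gamma>"

definition T0 :: "(nat \<Rightarrow> 'a::chilbert_space \<Rightarrow> 'b::chilbert_space) \<Rightarrow> ('a \<times> 'b) ell2 \<Rightarrow> ('a \<times> 'b) ell2" where
  "T0 \<Gamma> h = snd (U0 \<Gamma> (0, proj (H0_space \<Gamma>) h))"

definition T0t :: "(nat \<Rightarrow> 'a::chilbert_space \<Rightarrow> 'b::chilbert_space) \<Rightarrow> ('b \<times> 'a) ell2 \<Rightarrow> ('b \<times> 'a) ell2" where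
  "T0t \<Gamma> h = snd (U0t \<Gamma> (0, proj (H0t_space \<Gamma>) h))"

end

theory Submission
  imports Defs
begin

text \<open>
  The Schur algorithm and the CMV matrix are two readings of one chain of elementary rotations.
  Fix \<open>\<lambda>\<close> in the disc and a vector \<open>m\<close>, and put \<open>u\<^sub>0 = m\<close>. One step of the algorithm, which computes
  \<open>v\<^sub>n = \<Theta>\<^sub>n(\<lambda>) u\<^sub>n\<close>, amounts to solving
  \<open>J\<^bsub>\<Gamma>\<^sub>n\<^esub> (u\<^sub>n, \<lambda> v\<^bsub>n+1\<^esub>) = (v\<^sub>n, u\<^bsub>n+1\<^esub>)\<close> for \<open>u\<^bsub>n+1\<^esub>\<close>, where \<open>v\<^bsub>n+1\<^esub> = \<Theta>\<^bsub>n+1\<^esub>(\<lambda>) u\<^bsub>n+1\<^esub>\<close>.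
  The inverse of \<open>J\<^bsub>\<Gamma>\<^sub>n\<^esub>\<close> is the rotation of \<open>\<Gamma>\<^sub>n\<^sup>*\<close>. Hence, if the relations are weighted by powers of
  \<open>\<lambda>\<close> and the even and the odd ones are collected, they say
  \<open>U\<^sub>0 (\<Theta>(\<lambda>) m, h) = (m, \<lambda> h)\<close> for the unitary operator \<open>U\<^sub>0\<close> built from the adjoint parameters and the
  vector \<open>h\<close> with entries \<open>\<lambda>\<^sup>n (v\<^bsub>2n+1\<^esub>, u\<^bsub>2n+2\<^esub>)\<close> (lemma \<open>U0_transfer\<close>). So \<open>\<Theta>\<close> is the transfer
  function of the inverse of \<open>U\<^sub>0\<close>.

  The rest is a fact about an arbitrary unitary operator \<open>U\<close> from \<open>N \<oplus> H\<close> to \<open>M \<oplus> H\<close> with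
  compression \<open>T\<close> to \<open>H\<close>. Let \<open>C h\<close> be the component of \<open>U (0, h)\<close> in \<open>M\<close>, and \<open>E h\<close> that of
  \<open>U\<^sup>-\<^sup>1 (0, h)\<close> in \<open>N\<close>. Since \<open>U\<close> is isometric, \<open>\<parallel>C h\<parallel> = \<parallel>D\<^sub>T h\<parallel>\<close> and
  \<open>\<parallel>E h\<parallel> = \<parallel>D\<^bsub>T\<^sup>*\<^esub> h\<parallel>\<close>. If \<open>\<Theta>\<close> is purely contractive, \<open>C\<close> and \<open>E\<close> have dense range, so these
  equalities give unitary operators between the defect spaces and \<open>M\<close>, \<open>N\<close>, and they turn the
  characteristic function of \<open>T\<close> into \<open>\<Theta>\<close> (lemma \<open>char_fun_coincides\<close>).

  On a reducing subspace \<open>K\<close> on which \<open>T\<close> is unitary, \<open>C\<close> vanishes, so \<open>U\<^sub>0\<close> maps \<open>{0} \<times> K\<close> onto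
  itself. A defect operator is injective on its defect space, and with this the entries of the
  vectors of \<open>K\<close> are seen to vanish one after the other (lemma \<open>U0_no_unitary_part\<close>). Finally
  \<open>I \<oplus> V\<^sub>0\<close> conjugates \<open>U\<^sub>0\<close> into the operator behind the second CMV matrix and carries all this over.
\<close>

section \<open>Complex Hilbert spaces\<close>

lemma scaleC_one [simp]: "1 *\<^sub>C x = x"
  using scaleC_of_real[of 1 x] by simp

lemma scaleC_zero_right [simp]: "c *\<^sub>C 0 = 0"
  using norm_scaleC[of c 0] by simp

lemma scaleC_zero_left [simp]: "0 *\<^sub>C x = 0"
  using norm_scaleC[of 0 x] by simp

lemma scaleC_minus_right: "c *\<^sub>C (- x) = - (c *\<^sub>C x)"
  using scaleC_add_right[of c x "- x"] by (simp add: eq_neg_iff_add_eq_0 add.commute)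

lemma scaleC_diff_right: "c *\<^sub>C (x - y) = c *\<^sub>C x - c *\<^sub>C y"
  using scaleC_add_right[of c x "- y"] by (simp add: scaleC_minus_right)

lemma scaleC_scaleR: "c *\<^sub>C (r *\<^sub>R x) = r *\<^sub>R (c *\<^sub>C x)"
  by (simp add: scaleC_scaleC mult.commute flip: scaleC_of_real)

lemma bounded_linear_scaleC: "bounded_linear (\<lambda>x. c *\<^sub>C x)"
  by (rule bounded_linear_intro[where K = "cmod c"])
    (simp_all add: scaleC_add_right scaleC_scaleR norm_scaleC mult.commute)

lemma cinner_eq_inner: "cinner x y = Complex (inner x y) (inner ((-\<i>) *\<^sub>C x) y)"
  by (simp add: complex_eq_iff Re_cinner Im_cinner)

lemma cinner_zero_left [simp]: "cinner 0 y = 0"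
  by (simp add: cinner_eq_inner complex_eq_iff)

lemma cinner_zero_right [simp]: "cinner x 0 = 0"
  by (simp add: cinner_eq_inner complex_eq_iff)

lemma inner_scaleC_right: "inner x (c *\<^sub>C y) = inner (cnj c *\<^sub>C x) y"
  by (metis Re_cinner cinner_scaleC_left cinner_scaleC_right)

lemma inner_eqI: "(\<And>z. inner z x = inner z y) \<Longrightarrow> x = y"
  using vector_eq_ldot by blast

lemma fst_scaleC [simp]: "fst (c *\<^sub>C p) = c *\<^sub>C fst p"
  and snd_scaleC [simp]: "snd (c *\<^sub>C p) = c *\<^sub>C snd p"
  by (simp_all add: scaleC_prod_def)

definition bounded_clinear :: "('a::chilbert_space \<Rightarrow> 'b::chilbert_space) \<Rightarrow> bool" where
  "bounded_clinear A \<longleftrightarrow> bounded_linear A \<and> (\<forall>c x. A (c *\<^sub>C x) = c *\<^sub>C A x)"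

lemma bounded_clinearI:
  assumes "\<And>x y. A (x + y) = A x + A y" "\<And>c x. A (c *\<^sub>C x) = c *\<^sub>C A x"
    and "\<And>x. norm (A x) \<le> K * norm x"
  shows "bounded_clinear A"
  unfolding bounded_clinear_def
proof (intro conjI allI assms(2))
  have "A (r *\<^sub>R x) = r *\<^sub>R A x" for r x
    using assms(2)[of "complex_of_real r" x] by (simp add: scaleC_of_real)
  then show "bounded_linear A"
    by (intro bounded_linear_intro[where K = K]) (simp_all add: assms mult.commute)
qed

lemma
  assumes "bounded_clinear A"
  shows bounded_clinear_add: "A (x + y) = A x + A y"
    and bounded_clinear_diff: "A (x - y) = A x - A y"
    and bounded_clinear_minus: "A (- x) = - A x"
    and bounded_clinear_scaleC: "A (c *\<^sub>C x) = c *\<^sub>C A x"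
    and bounded_clinear_scaleR: "A (r *\<^sub>R x) = r *\<^sub>R A x"
    and bounded_clinear_zero: "A 0 = 0"
    and bounded_clinear_continuous: "continuous_on X A"
    and bounded_clinear_tendsto: "(f \<longlongrightarrow> l) F \<Longrightarrow> ((\<lambda>n. A (f n)) \<longlongrightarrow> A l) F"
    and bounded_clinear_bounded_linear: "bounded_linear A"
proof -
  have l: "bounded_linear A" "linear A"
    using assms by (auto simp: bounded_clinear_def bounded_linear.linear)
  show "bounded_linear A" by fact
  show "A (x + y) = A x + A y" "A (x - y) = A x - A y" "A (- x) = - A x"
       "A (r *\<^sub>R x) = r *\<^sub>R A x" "A 0 = 0"
    using l(2) by (auto simp: linear_add linear_diff linear_neg linear_scale linear_0)
  show "A (c *\<^sub>C x) = c *\<^sub>C A x"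
    using assms by (auto simp: bounded_clinear_def)
  show "continuous_on X A"
    using l(1) by (simp add: linear_continuous_on)
  show "((\<lambda>n. A (f n)) \<longlongrightarrow> A l) F" if "(f \<longlongrightarrow> l) F"
    using bounded_linear.tendsto[OF l(1) that] .
qed

lemma
  shows bounded_clinear_ident: "bounded_clinear (\<lambda>x. x)"
    and bounded_clinear_const_zero: "bounded_clinear (\<lambda>x. 0)"
    and bounded_clinear_scale_by: "bounded_clinear (\<lambda>x. c *\<^sub>C x)"
    and bounded_clinear_compose:
      "bounded_clinear A \<Longrightarrow> bounded_clinear B \<Longrightarrow> bounded_clinear (\<lambda>x. A (B x))"
    and bounded_clinear_plus_map:
      "bounded_clinear A' \<Longrightarrow> bounded_clinear B' \<Longrightarrow> bounded_clinear (\<lambda>x. A' x + B' x)"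
    and bounded_clinear_diff_map:
      "bounded_clinear A' \<Longrightarrow> bounded_clinear B' \<Longrightarrow> bounded_clinear (\<lambda>x. A' x - B' x)"
    and bounded_clinear_uminus_map: "bounded_clinear A' \<Longrightarrow> bounded_clinear (\<lambda>x. - A' x)"
    and bounded_clinear_Pair:
      "bounded_clinear A' \<Longrightarrow> bounded_clinear C' \<Longrightarrow> bounded_clinear (\<lambda>x. (A' x, C' x))"
    and bounded_clinear_fst: "bounded_clinear fst"
    and bounded_clinear_snd: "bounded_clinear snd"
  by (auto simp: bounded_clinear_def scaleC_add_right scaleC_diff_right scaleC_minus_right
      scaleC_scaleC mult.commute scaleC_prod_def
      intro: bounded_linear_ident bounded_linear_zero bounded_linear_scaleC bounded_linear_compose
        bounded_linear_add bounded_linear_sub bounded_linear_minus bounded_linear_Pair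
        bounded_linear_fst bounded_linear_snd)

section \<open>Orthogonal projections and adjoints\<close>

lemma minus_midpoint_norm:
  fixes x y z :: "'a::real_inner"
  shows "(norm (y - z))\<^sup>2 = 2 * (norm (x - y))\<^sup>2 + 2 * (norm (x - z))\<^sup>2
    - 4 * (norm (x - (1/2) *\<^sub>R (y + z)))\<^sup>2"
  unfolding power2_norm_eq_inner by (simp add: inner_simps inner_commute algebra_simps)

text \<open>A minimising sequence for the distance to \<open>S\<close> is Cauchy by the parallelogram law, because the
  midpoint of two of its members is again at least at minimal distance; its limit is the foot of the
  perpendicular.\<close>

lemma exists_perpendicular_foot:
  fixes S :: "'a::{real_inner,banach} set"
  assumes "closed S" "subspace S"
  shows "\<exists>p\<in>S. \<forall>y\<in>S. inner (x - p) y = 0"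
proof -
  define d where "d = (INF y\<in>S. (norm (x - y))\<^sup>2)"
  have bdd: "bdd_below ((\<lambda>y. (norm (x - y))\<^sup>2) ` S)"
    by (rule bdd_belowI[of _ 0]) auto
  have d_le: "d \<le> (norm (x - y))\<^sup>2" if "y \<in> S" for y
    unfolding d_def using bdd that by (rule cINF_lower)
  have ne: "S \<noteq> {}" using subspace_0[OF assms(2)] by blast
  have "\<exists>y\<in>S. (norm (x - y))\<^sup>2 < d + inverse (real (Suc n))" for n
    using cInf_lessD[of "(\<lambda>y. (norm (x - y))\<^sup>2) ` S" "d + inverse (real (Suc n))"] ne
    by (auto simp: d_def)
  then obtain Y where YS: "\<And>n. Y n \<in> S"
    and Y: "\<And>n. (norm (x - Y n))\<^sup>2 < d + inverse (real (Suc n))"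
    by metis
  have close: "(norm (Y n - Y m))\<^sup>2 \<le> 2 * inverse (real (Suc n)) + 2 * inverse (real (Suc m))" for n m
  proof -
    have "(1/2) *\<^sub>R (Y n + Y m) \<in> S"
      using assms(2) YS by (simp add: subspace_add subspace_scale)
    from d_le[OF this] show ?thesis
      using Y[of n] Y[of m] minus_midpoint_norm[of "Y n" "Y m" x] by linarith
  qed
  have "Cauchy Y"
  proof (rule metric_CauchyI)
    fix e :: real assume e: "e > 0"
    then obtain N where N: "inverse (real (Suc N)) < e\<^sup>2 / 4"
      using reals_Archimedean[of "e\<^sup>2 / 4"] by auto
    have "dist (Y m) (Y n) < e" if "m \<ge> N" "n \<ge> N" for m n
    proof -
      have "inverse (real (Suc m)) \<le> inverse (real (Suc N))"
           "inverse (real (Suc n)) \<le> inverse (real (Suc N))"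
        using that by (auto intro!: le_imp_inverse_le)
      then have "(norm (Y m - Y n))\<^sup>2 < e\<^sup>2"
        using close[of m n] N by linarith
      then show ?thesis
        using e power2_less_imp_less[of "norm (Y m - Y n)" e] by (simp add: dist_norm)
    qed
    then show "\<exists>M. \<forall>m\<ge>M. \<forall>n\<ge>M. dist (Y m) (Y n) < e" by blast
  qed
  then obtain p where p: "Y \<longlonglongrightarrow> p"
    using Cauchy_convergent convergent_def by blast
  have pS: "p \<in> S"
    using closed_sequentially[OF assms(1) _ p] YS by blast
  have "(norm (x - p))\<^sup>2 \<le> d + 0"
  proof (rule LIMSEQ_le)
    show "(\<lambda>n. (norm (x - Y n))\<^sup>2) \<longlonglongrightarrow> (norm (x - p))\<^sup>2"
      by (intro tendsto_intros p)
    show "(\<lambda>n. d + inverse (real (Suc n))) \<longlonglongrightarrow> d + 0"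
      by (intro tendsto_intros LIMSEQ_inverse_real_of_nat)
    show "\<exists>N. \<forall>n\<ge>N. (norm (x - Y n))\<^sup>2 \<le> d + inverse (real (Suc n))"
      using Y less_imp_le by blast
  qed
  then have min: "(norm (x - p))\<^sup>2 \<le> (norm (x - y))\<^sup>2" if "y \<in> S" for y
    using d_le[OF that] by linarith
  have "inner (x - p) y = 0" if "y \<in> S" for y
  proof (cases "y = 0")
    case False
    define t where "t = inner (x - p) y / inner y y"
    have "p + t *\<^sub>R y \<in> S"
      using assms(2) pS that by (simp add: subspace_add subspace_scale)
    from min[OF this] have "0 \<le> - 2 * t * inner (x - p) y + t * t * inner y y"
      unfolding power2_norm_eq_inner
      by (simp add: inner_simps inner_commute algebra_simps)
    also have "\<dots> = - ((inner (x - p) y)\<^sup>2 / inner y y)"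
      using False by (simp add: t_def power2_eq_square field_simps)
    finally have "(inner (x - p) y)\<^sup>2 / inner y y \<le> 0" by simp
    moreover have "inner y y > 0" using False by simp
    ultimately have "(inner (x - p) y)\<^sup>2 \<le> 0"
      by (simp add: divide_le_0_iff)
    then show ?thesis by simp
  qed simp
  with pS show ?thesis by blast
qed

lemma closed_csubspaceD:
  assumes "closed_csubspace S"
  shows "closed S" "subspace S" "0 \<in> S" "x \<in> S \<Longrightarrow> y \<in> S \<Longrightarrow> x + y \<in> S"
    "x \<in> S \<Longrightarrow> y \<in> S \<Longrightarrow> x - y \<in> S" "x \<in> S \<Longrightarrow> c *\<^sub>C x \<in> S" "x \<in> S \<Longrightarrow> - x \<in> S"
  using assms by (auto simp: closed_csubspace_def subspace_0 subspace_add subspace_diff subspace_neg)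

lemma closed_csubspace_UNIV [simp]: "closed_csubspace UNIV"
  by (simp add: closed_csubspace_def)

lemma closed_csubspace_Times:
  assumes "closed_csubspace S" "closed_csubspace T"
  shows "closed_csubspace (S \<times> T)"
  using assms closed_csubspaceD(1)[OF assms(1)] closed_csubspaceD(1)[OF assms(2)]
  by (auto simp: closed_csubspace_def subspace_def closed_Times scaleC_prod_def zero_prod_def)

lemma cinner_zero_iff_inner:
  assumes "\<And>c y. y \<in> S \<Longrightarrow> c *\<^sub>C y \<in> S"
  shows "(\<forall>y\<in>S. cinner x y = 0) \<longleftrightarrow> (\<forall>y\<in>S. inner x y = 0)"
proof -
  have "cinner x y = Complex (inner x y) (inner x (\<i> *\<^sub>C y))" for y
    by (simp add: cinner_eq_inner inner_scaleC_right)
  then show ?thesis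
    using assms by (auto simp: complex_eq_iff)
qed

context
  fixes S :: "'a::chilbert_space set"
  assumes S: "closed_csubspace S"
begin

lemma proj_ex1: "\<exists>!p. p \<in> S \<and> (\<forall>y\<in>S. cinner (x - p) y = 0)"
proof -
  have eq: "(\<forall>y\<in>S. cinner z y = 0) \<longleftrightarrow> (\<forall>y\<in>S. inner z y = 0)" for z
    using closed_csubspaceD(6)[OF S] by (rule cinner_zero_iff_inner)
  obtain p where p: "p \<in> S" "\<forall>y\<in>S. inner (x - p) y = 0"
    using exists_perpendicular_foot[OF closed_csubspaceD(1,2)[OF S]] by blast
  have "q = p" if q: "q \<in> S" "\<forall>y\<in>S. inner (x - q) y = 0" for q
  proof -
    have "q - p \<in> S" using p q by (simp add: closed_csubspaceD[OF S])
    then have "inner (x - p) (q - p) = 0" "inner (x - q) (q - p) = 0"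
      using p q by auto
    then have "inner (q - p) (q - p) = 0"
      by (simp add: inner_simps)
    then show ?thesis by simp
  qed
  with p show ?thesis unfolding eq by blast
qed

lemma proj_in [simp]: "proj S x \<in> S"
  and proj_orth: "y \<in> S \<Longrightarrow> cinner (x - proj S x) y = 0"
  using theI'[OF proj_ex1, of x] unfolding proj_def by auto

lemma proj_eqI: "p \<in> S \<Longrightarrow> (\<And>y. y \<in> S \<Longrightarrow> cinner (x - p) y = 0) \<Longrightarrow> proj S x = p"
  using proj_ex1[of x] proj_in proj_orth by blast

lemma proj_ident [simp]: "x \<in> S \<Longrightarrow> proj S x = x"
  by (rule proj_eqI) auto

lemma inner_minus_proj: "y \<in> S \<Longrightarrow> inner (x - proj S x) y = 0"
  by (metis Re_cinner proj_orth zero_complex.simps(1))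

lemma proj_norm: "(norm x)\<^sup>2 = (norm (proj S x))\<^sup>2 + (norm (x - proj S x))\<^sup>2"
  using inner_minus_proj[OF proj_in, of x x]
  by (simp add: power2_norm_eq_inner inner_simps inner_commute)

lemma norm_proj_le: "norm (proj S x) \<le> norm x"
  by (rule power2_le_imp_le) (simp_all add: proj_norm[of x])

lemma bounded_clinear_proj: "bounded_clinear (proj S)"
proof (rule bounded_clinearI[where K = 1])
  show "proj S (x + y) = proj S x + proj S y" for x y
  proof (rule proj_eqI)
    fix z assume "z \<in> S"
    then show "cinner (x + y - (proj S x + proj S y)) z = 0"
      using cinner_add_left[of "x - proj S x" "y - proj S y" z] proj_orth
      by (simp add: algebra_simps)
  qed (simp add: closed_csubspaceD[OF S])
  show "proj S (c *\<^sub>C x) = c *\<^sub>C proj S x" for c x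
  proof (rule proj_eqI)
    fix z assume "z \<in> S"
    then show "cinner (c *\<^sub>C x - c *\<^sub>C proj S x) z = 0"
      using proj_orth by (simp add: cinner_scaleC_left flip: scaleC_diff_right)
  qed (simp add: closed_csubspaceD[OF S])
qed (simp add: norm_proj_le)

lemma inner_proj_commute: "inner (proj S x) y = inner x (proj S y)"
  using inner_minus_proj[OF proj_in, of x y] inner_minus_proj[OF proj_in, of y x]
  by (simp add: inner_simps inner_commute)

lemma bop_iff: "A \<in> bop S T \<longleftrightarrow> bounded_clinear A \<and> range A \<subseteq> T \<and> (\<forall>x. A (proj S x) = A x)"
proof -
  have "(\<forall>x. (\<forall>y\<in>S. cinner x y = 0) \<longrightarrow> A x = 0) \<longleftrightarrow> (\<forall>x. A (proj S x) = A x)"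
    if A: "bounded_clinear A"
  proof safe
    fix x assume "\<forall>x. (\<forall>y\<in>S. cinner x y = 0) \<longrightarrow> A x = 0"
    then have "A (x - proj S x) = 0" using proj_orth by blast
    then show "A (proj S x) = A x" by (simp add: bounded_clinear_diff[OF A])
  next
    fix x assume P: "\<forall>x. A (proj S x) = A x" and 0: "\<forall>y\<in>S. cinner x y = 0"
    have "proj S x = 0" by (rule proj_eqI) (use 0 closed_csubspaceD[OF S] in auto)
    then show "A x = 0" using P[rule_format, of x] bounded_clinear_zero[OF A] by simp
  qed
  then show ?thesis by (auto simp: bop_def bounded_clinear_def)
qed

end

lemma proj_UNIV [simp]: "proj UNIV x = x"
  by (simp add: proj_ident)

lemma bop_UNIV: "A \<in> bop UNIV UNIV \<longleftrightarrow> bounded_clinear A"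
  by (simp add: bop_iff)

text \<open>A vector perpendicular to the kernel of \<open>f\<close>, suitably scaled, represents \<open>f\<close>, because the kernel
  has codimension one.\<close>

lemma riesz_representation:
  fixes f :: "'a::{real_inner,banach} \<Rightarrow> real"
  assumes "bounded_linear f"
  shows "\<exists>w. \<forall>x. f x = inner x w"
proof (cases "\<forall>x. f x = 0")
  case False
  then obtain x0 where x0: "f x0 \<noteq> 0" by blast
  interpret f: bounded_linear f by fact
  have "closed {x. f x = 0}"
    by (intro closed_Collect_eq linear_continuous_on assms continuous_on_const)
  moreover have "subspace {x. f x = 0}"
    by (simp add: subspace_def f.add f.scaleR)
  ultimately obtain p where p: "f p = 0" "\<And>y. f y = 0 \<Longrightarrow> inner (x0 - p) y = 0"
    using exists_perpendicular_foot[of "{x. f x = 0}" x0] by blast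
  define e where "e = x0 - p"
  have fe: "f e \<noteq> 0" using x0 p by (simp add: e_def f.diff)
  then have e0: "inner e e \<noteq> 0" by auto
  have "f x = inner x ((f e / inner e e) *\<^sub>R e)" for x
  proof -
    have "f (x - (f x / f e) *\<^sub>R e) = 0" using fe by (simp add: f.diff f.scaleR)
    then have "inner e (x - (f x / f e) *\<^sub>R e) = 0"
      using p(2) unfolding e_def by blast
    then have "inner e x = (f x / f e) * inner e e"
      by (simp add: inner_diff_right)
    then show ?thesis using fe e0 by (simp add: inner_commute field_simps)
  qed
  then show ?thesis by blast
qed (auto intro: exI[of _ 0])

context
  fixes A :: "'a::chilbert_space \<Rightarrow> 'b::chilbert_space"
  assumes A: "bounded_clinear A"
begin

lemma cadjoint_exists: "\<exists>B. \<forall>x y. cinner (A x) y = cinner x (B y)"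
proof -
  have "\<exists>w. \<forall>x. cinner (A x) y = cinner x w" for y
  proof -
    have "bounded_linear (\<lambda>x. inner (A x) y)"
      using bounded_linear_compose[OF bounded_linear_inner_left bounded_clinear_bounded_linear[OF A]] .
    then obtain w where w: "\<And>x. inner (A x) y = inner x w"
      using riesz_representation by blast
    have "cinner (A x) y = cinner x w" for x
      using w by (simp add: cinner_eq_inner flip: bounded_clinear_scaleC[OF A])
    then show ?thesis by blast
  qed
  then show ?thesis by metis
qed

lemma cadjoint_eqI:
  assumes "\<And>x y. inner (A x) y = inner x (B y)"
  shows "cadjoint A = B"
  unfolding cadjoint_def
proof (rule the_equality)
  show "\<forall>x y. cinner (A x) y = cinner x (B y)"
    using assms by (simp add: cinner_eq_inner flip: bounded_clinear_scaleC[OF A])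
  show "B' = B" if "\<forall>x y. cinner (A x) y = cinner x (B' y)" for B'
  proof
    fix y
    have "inner x (B' y) = inner x (B y)" for x
      using assms that by (metis Re_cinner)
    then show "B' y = B y" by (rule inner_eqI)
  qed
qed

lemma inner_cadjoint: "inner (A x) y = inner x (cadjoint A y)"
proof -
  obtain B where B: "\<forall>x y. cinner (A x) y = cinner x (B y)"
    using cadjoint_exists by blast
  then have "\<And>x y. inner (A x) y = inner x (B y)"
    by (metis Re_cinner)
  with cadjoint_eqI show ?thesis by metis
qed

lemma bounded_clinear_cadjoint: "bounded_clinear (cadjoint A)"
proof -
  obtain K where K: "K \<ge> 0" "\<And>x. norm (A x) \<le> norm x * K"
    using bounded_linear.nonneg_bounded[OF bounded_clinear_bounded_linear[OF A]] by blast
  show ?thesis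
  proof (rule bounded_clinearI[where K = K])
    show "cadjoint A (x + y) = cadjoint A x + cadjoint A y" for x y
      by (rule inner_eqI) (simp add: inner_add_right flip: inner_cadjoint)
    show "cadjoint A (c *\<^sub>C x) = c *\<^sub>C cadjoint A x" for c x
      by (rule inner_eqI) (simp add: inner_scaleC_right bounded_clinear_scaleC[OF A] flip: inner_cadjoint)
    show "norm (cadjoint A y) \<le> K * norm y" for y
    proof (cases "cadjoint A y = 0")
      case False
      have "norm (cadjoint A y) * norm (cadjoint A y) = inner (A (cadjoint A y)) y"
        by (simp add: inner_cadjoint flip: power2_norm_eq_inner power2_eq_square)
      also have "\<dots> \<le> norm (A (cadjoint A y)) * norm y" by (rule norm_cauchy_schwarz)
      also have "\<dots> \<le> norm (cadjoint A y) * K * norm y"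
        by (intro mult_right_mono K) simp
      finally show ?thesis using False by simp
    qed (simp add: K)
  qed
qed

end

lemma cadjoint_cadjoint: "bounded_clinear A \<Longrightarrow> cadjoint (cadjoint A) = A"
  by (rule cadjoint_eqI[OF bounded_clinear_cadjoint]) (simp_all add: inner_cadjoint inner_commute[of _ "A _"] inner_commute[of "cadjoint A _"])

lemma contractionsD:
  assumes "A \<in> contractions S T" "closed_csubspace S"
  shows "bounded_clinear A" "A x \<in> T" "A (proj S x) = A x" "norm (A x) \<le> norm x"
  using assms by (auto simp: contractions_def bop_iff)

lemma cadjoint_contractions:
  assumes A: "A \<in> contractions S T" and S: "closed_csubspace S" and T: "closed_csubspace T"
  shows "cadjoint A \<in> contractions T S"
proof -
  note AD = contractionsD[OF A S]
  have A_T: "proj T (A x) = A x" for x using AD(2) T by simp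
  have 1: "proj S (cadjoint A y) = cadjoint A y" for y
    by (rule inner_eqI) (simp add: AD(3) inner_cadjoint[OF AD(1), symmetric] flip: inner_proj_commute[OF S])
  have 2: "cadjoint A (proj T y) = cadjoint A y" for y
    by (rule inner_eqI) (simp add: A_T inner_cadjoint[OF AD(1), symmetric] flip: inner_proj_commute[OF T])
  have 3: "norm (cadjoint A y) \<le> norm y" for y
  proof (cases "cadjoint A y = 0")
    case False
    have "norm (cadjoint A y) * norm (cadjoint A y) = inner (A (cadjoint A y)) y"
      by (simp add: inner_cadjoint[OF AD(1)] flip: power2_norm_eq_inner power2_eq_square)
    also have "\<dots> \<le> norm (A (cadjoint A y)) * norm y" by (rule norm_cauchy_schwarz)
    also have "\<dots> \<le> norm (cadjoint A y) * norm y" by (intro mult_right_mono AD(4)) simp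
    finally show ?thesis using False by simp
  qed simp
  have "range (cadjoint A) \<subseteq> S" using 1 proj_in[OF S] by (metis image_subsetI)
  then show ?thesis
    using 2 3 bounded_clinear_cadjoint[OF AD(1)] by (simp add: contractions_def bop_iff[OF T])
qed

section \<open>Positive square roots\<close>

text \<open>The recursion \<open>B\<^bsub>n+1\<^esub> = (X + B\<^sub>n\<^sup>2) / 2\<close> is made so that a limit \<open>B\<close> satisfies
  \<open>(I - B)\<^sup>2 = I - X\<close>. Run with the number \<open>1\<close> for \<open>X\<close> it increases to \<open>1\<close>, and this scalar
  sequence dominates the operator one when \<open>X\<close> is a contraction.\<close>

primrec sqrt_iter :: "('a::chilbert_space \<Rightarrow> 'a) \<Rightarrow> nat \<Rightarrow> 'a \<Rightarrow> 'a" where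
  "sqrt_iter X 0 = (\<lambda>x. 0)"
| "sqrt_iter X (Suc n) = (\<lambda>x. (1/2) *\<^sub>R (X x + sqrt_iter X n (sqrt_iter X n x)))"

primrec sqrt_iter_bound :: "nat \<Rightarrow> real" where
  "sqrt_iter_bound 0 = 0"
| "sqrt_iter_bound (Suc n) = (1 + (sqrt_iter_bound n)\<^sup>2) / 2"

definition sqrt_id_minus :: "('a::chilbert_space \<Rightarrow> 'a) \<Rightarrow> 'a \<Rightarrow> 'a" where
  "sqrt_id_minus X x = x - lim (\<lambda>n. sqrt_iter X n x)"

lemma sqrt_iter_bound_range: "0 \<le> sqrt_iter_bound n \<and> sqrt_iter_bound n \<le> 1"
  by (induction n) (auto simp: power_le_one)

lemma sqrt_iter_bound_mono: "sqrt_iter_bound n \<le> sqrt_iter_bound (Suc n)"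
proof -
  have "sqrt_iter_bound (Suc n) - sqrt_iter_bound n = (1 - sqrt_iter_bound n)\<^sup>2 / 2"
    by (simp add: power2_eq_square field_simps)
  then show ?thesis by (smt (verit) divide_nonneg_pos zero_le_power2)
qed

definition self_adjoint :: "('a::chilbert_space \<Rightarrow> 'a) \<Rightarrow> bool" where
  "self_adjoint A \<longleftrightarrow> (\<forall>x y. inner (A x) y = inner x (A y))"

lemma self_adjoint_cinner_real:
  assumes "bounded_clinear A" "self_adjoint A"
  shows "cinner (A x) x = complex_of_real (inner (A x) x)"
proof -
  have "inner ((-\<i>) *\<^sub>C A x) x = inner (A ((-\<i>) *\<^sub>C x)) x"
    using assms(1) by (simp add: bounded_clinear_scaleC)
  also have "\<dots> = inner x (\<i> *\<^sub>C A x)"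
    using assms by (simp add: self_adjoint_def inner_scaleC_right)
  also have "\<dots> = - inner ((-\<i>) *\<^sub>C A x) x"
  proof -
    have "(-\<i>) *\<^sub>C A x = - (\<i> *\<^sub>C A x)"
      using scaleC_add_left[of "-\<i>" \<i> "A x"] by (simp add: eq_neg_iff_add_eq_0)
    then show ?thesis by (simp add: inner_commute)
  qed
  finally show ?thesis by (simp add: complex_eq_iff cinner_eq_inner)
qed

text \<open>Polarisation: the form \<open>inner ((-\<i>) *\<^sub>C A x) y\<close> vanishes on the diagonal, so it is antisymmetric, and
  replacing \<open>x\<close> by \<open>\<i> *\<^sub>C x\<close> turns antisymmetry into symmetry.\<close>

lemma cinner_real_imp_self_adjoint:
  assumes A: "bounded_clinear A" and R: "\<And>x. cinner (A x) x \<in> \<real>"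
  shows "self_adjoint A"
proof -
  have Im0: "inner ((-\<i>) *\<^sub>C A x) x = 0" for x
    using R[of x] by (simp add: complex_is_Real_iff flip: Im_cinner)
  have anti: "inner ((-\<i>) *\<^sub>C A x) y = - inner ((-\<i>) *\<^sub>C A y) x" for x y
    using Im0[of "x + y"] Im0[of x] Im0[of y]
    by (simp add: bounded_clinear_add[OF A] scaleC_add_right inner_simps)
  have "inner (A x) y = inner (A y) x" for x y
  proof -
    have "inner (A x) y = inner ((-\<i>) *\<^sub>C A (\<i> *\<^sub>C x)) y"
      by (simp add: bounded_clinear_scaleC[OF A] scaleC_scaleC)
    also have "\<dots> = - inner ((-\<i>) *\<^sub>C A y) (\<i> *\<^sub>C x)" by (rule anti)
    also have "\<dots> = - inner ((-1) *\<^sub>C A y) x"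
      by (simp add: inner_scaleC_right scaleC_scaleC)
    also have "\<dots> = inner (A y) x"
      using scaleC_of_real[of "-1" "A y"] by simp
    finally show ?thesis .
  qed
  then show ?thesis by (simp add: self_adjoint_def inner_commute)
qed

context
  fixes X :: "'a::chilbert_space \<Rightarrow> 'a"
  assumes X: "bounded_clinear X" and X_le: "\<And>x. norm (X x) \<le> norm x"
begin

lemma sqrt_iter_linear:
  "sqrt_iter X n (x + y) = sqrt_iter X n x + sqrt_iter X n y"
  "sqrt_iter X n (c *\<^sub>C x) = c *\<^sub>C sqrt_iter X n x"
  by (induction n arbitrary: x y)
    (simp_all add: bounded_clinear_add[OF X] bounded_clinear_scaleC[OF X] scaleC_add_right
      scaleC_scaleR algebra_simps)

lemma sqrt_iter_norm: "norm (sqrt_iter X n x) \<le> sqrt_iter_bound n * norm x"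
proof (induction n arbitrary: x)
  case (Suc n)
  let ?B = "sqrt_iter X n" and ?b = "sqrt_iter_bound n"
  have "norm (?B (?B x)) \<le> ?b * norm (?B x)" by (rule Suc.IH)
  also have "\<dots> \<le> ?b * (?b * norm x)"
    using sqrt_iter_bound_range Suc.IH by (intro mult_left_mono) auto
  finally have "norm (X x + ?B (?B x)) \<le> norm x + ?b * (?b * norm x)"
    using X_le[of x] norm_triangle_ineq[of "X x" "?B (?B x)"] by linarith
  then have "norm ((1/2) *\<^sub>R (X x + ?B (?B x))) \<le> (norm x + ?b * (?b * norm x)) / 2"
    by (simp only: norm_scaleR) simp
  then show ?case by (simp add: power2_eq_square add_divide_distrib distrib_right mult.assoc del: scaleR_add_right)
qed simp

lemma sqrt_iter_le: "norm (sqrt_iter X n x) \<le> norm x"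
  using sqrt_iter_norm[of n x]
    mult_left_le_one_le[of "norm x" "sqrt_iter_bound n"] sqrt_iter_bound_range[of n]
  by simp

lemma sqrt_iter_bounded_clinear: "bounded_clinear (sqrt_iter X n)"
  by (rule bounded_clinearI[OF sqrt_iter_linear sqrt_iter_norm])

text \<open>\<open>B'\<^sup>2 - B\<^sup>2 = B' (B' - B) + (B' - B) B\<close> reduces each difference to the previous one in exactly the
  way in which the scalar differences reduce.\<close>

lemma sqrt_iter_step:
  "norm (sqrt_iter X (Suc n) x - sqrt_iter X n x)
    \<le> (sqrt_iter_bound (Suc n) - sqrt_iter_bound n) * norm x"
proof (induction n arbitrary: x)
  case 0
  show ?case using X_le[of x] by simp
next
  case (Suc n)
  let ?B = "sqrt_iter X n" and ?B' = "sqrt_iter X (Suc n)"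
  let ?b = "sqrt_iter_bound n" and ?b' = "sqrt_iter_bound (Suc n)"
  have d: "0 \<le> ?b' - ?b" using sqrt_iter_bound_mono[of n] by simp
  have "norm (?B' (?B' x - ?B x)) \<le> ?b' * norm (?B' x - ?B x)" by (rule sqrt_iter_norm)
  also have "\<dots> \<le> ?b' * ((?b' - ?b) * norm x)"
    using sqrt_iter_bound_range[of "Suc n"] Suc.IH by (intro mult_left_mono) auto
  finally have 1: "norm (?B' (?B' x - ?B x)) \<le> ?b' * ((?b' - ?b) * norm x)" .
  have "norm (?B' (?B x) - ?B (?B x)) \<le> (?b' - ?b) * norm (?B x)" by (rule Suc.IH)
  also have "\<dots> \<le> (?b' - ?b) * (?b * norm x)"
    using d sqrt_iter_norm by (intro mult_left_mono) auto
  finally have 2: "norm (?B' (?B x) - ?B (?B x)) \<le> (?b' - ?b) * (?b * norm x)" .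
  have "?B' (?B' x) - ?B (?B x) = ?B' (?B' x - ?B x) + (?B' (?B x) - ?B (?B x))"
    by (simp only: bounded_clinear_diff[OF sqrt_iter_bounded_clinear]) simp
  then have "norm (?B' (?B' x) - ?B (?B x)) \<le> ?b' * ((?b' - ?b) * norm x) + (?b' - ?b) * (?b * norm x)"
    by (simp only: norm_triangle_le[OF add_mono[OF 1 2]])
  moreover have "sqrt_iter X (Suc (Suc n)) x - ?B' x = (1/2) *\<^sub>R (?B' (?B' x) - ?B (?B x))"
  proof -
    have alg: "v - w = (1/2) *\<^sub>R (p - q)"
      if "v = (1/2) *\<^sub>R (u + p)" "w = (1/2) *\<^sub>R (u + q)" for u v w p q :: 'a
      by (simp add: that scaleR_diff_right scaleR_add_right)
    show ?thesis by (rule alg) (rule sqrt_iter.simps(2)[THEN fun_cong])+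
  qed
  ultimately have "norm (sqrt_iter X (Suc (Suc n)) x - ?B' x)
      \<le> (?b' * ((?b' - ?b) * norm x) + (?b' - ?b) * (?b * norm x)) / 2"
    by (simp only: norm_scaleR) simp
  also have "\<dots> = (sqrt_iter_bound (Suc (Suc n)) - ?b') * norm x"
  proof -
    have alg: "(b' * ((b' - b) * t) + (b' - b) * (b * t)) / 2 = (b'' - b') * t"
      if "b'' = (1 + b'\<^sup>2) / 2" "b' = (1 + b\<^sup>2) / 2" for b b' b'' t :: real
    proof -
      have "b'' - b' = ((1 + b'\<^sup>2) - (1 + b\<^sup>2)) / 2"
        by (simp only: diff_divide_distrib flip: that)
      then show ?thesis by (simp only:) (simp add: power2_eq_square algebra_simps)
    qed
    show ?thesis by (rule alg) (rule sqrt_iter_bound.simps(2))+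
  qed
  finally show ?case .
qed

lemma sqrt_iter_diff:
  "norm (sqrt_iter X (n + k) x - sqrt_iter X n x)
    \<le> (sqrt_iter_bound (n + k) - sqrt_iter_bound n) * norm x"
proof (induction k)
  case (Suc k)
  have "norm (sqrt_iter X (n + Suc k) x - sqrt_iter X n x)
      \<le> norm (sqrt_iter X (Suc (n + k)) x - sqrt_iter X (n + k) x)
        + norm (sqrt_iter X (n + k) x - sqrt_iter X n x)"
    using norm_triangle_ineq[of "sqrt_iter X (Suc (n + k)) x - sqrt_iter X (n + k) x"
        "sqrt_iter X (n + k) x - sqrt_iter X n x"]
    by (simp only: add_Suc_right diff_add_cancel add_diff_eq)
  also have "\<dots> \<le> (sqrt_iter_bound (n + Suc k) - sqrt_iter_bound n) * norm x"
    using Suc.IH sqrt_iter_step[of "n + k" x] by (simp only: add_Suc_right left_diff_distrib)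
  finally show ?case .
qed simp

lemma sqrt_iter_converges: "(\<lambda>n. sqrt_iter X n x) \<longlonglongrightarrow> x - sqrt_id_minus X x"
proof -
  obtain l where "sqrt_iter_bound \<longlonglongrightarrow> l"
    by (rule incseq_convergent[of sqrt_iter_bound 1])
      (simp_all only: incseq_Suc_iff sqrt_iter_bound_range sqrt_iter_bound_mono simp_thms)
  then have b: "Cauchy (\<lambda>n. sqrt_iter_bound n * norm x)"
    by (intro LIMSEQ_imp_Cauchy[of _ "l * norm x"] tendsto_mult_right)
  have "Cauchy (\<lambda>n. sqrt_iter X n x)"
  proof (rule metric_CauchyI)
    fix e :: real assume "e > 0"
    then obtain M where M: "\<And>m n. m \<ge> M \<Longrightarrow> n \<ge> M \<Longrightarrow>
        dist (sqrt_iter_bound m * norm x) (sqrt_iter_bound n * norm x) < e"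
      using metric_CauchyD[OF b] by metis
    have *: "dist (sqrt_iter X m x) (sqrt_iter X n x) < e" if "m \<ge> n" "n \<ge> M" for m n
    proof -
      have "dist (sqrt_iter X m x) (sqrt_iter X n x)
          \<le> sqrt_iter_bound m * norm x - sqrt_iter_bound n * norm x"
        using sqrt_iter_diff[of n "m - n" x] that by (simp add: dist_norm left_diff_distrib)
      also have "\<dots> < e"
        using M[of m n] that by (simp add: dist_real_def)
      finally show ?thesis .
    qed
    have "dist (sqrt_iter X m x) (sqrt_iter X n x) < e" if "m \<ge> M" "n \<ge> M" for m n
      using *[of n m] *[of m n] that by (cases "m \<ge> n") (auto simp: dist_commute)
    then show "\<exists>M. \<forall>m\<ge>M. \<forall>n\<ge>M. dist (sqrt_iter X m x) (sqrt_iter X n x) < e" by blast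
  qed
  then have "convergent (\<lambda>n. sqrt_iter X n x)" by (rule Cauchy_convergent)
  then have "(\<lambda>n. sqrt_iter X n x) \<longlonglongrightarrow> lim (\<lambda>n. sqrt_iter X n x)"
    by (rule convergent_LIMSEQ_iff[THEN iffD1])
  moreover have "x - sqrt_id_minus X x = lim (\<lambda>n. sqrt_iter X n x)"
    unfolding sqrt_id_minus_def by simp
  ultimately show ?thesis by (simp only:)
qed

lemma sqrt_defect_contraction: "norm (x - sqrt_id_minus X x) \<le> norm x"
proof (rule LIMSEQ_le_const2[OF tendsto_norm[OF sqrt_iter_converges]])
  show "\<exists>N. \<forall>n\<ge>N. norm (sqrt_iter X n x) \<le> norm x"
    by (intro exI allI impI sqrt_iter_le)
qed

lemma sqrt_id_minus_bounded_clinear: "bounded_clinear (sqrt_id_minus X)"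
proof -
  let ?L = "\<lambda>x. x - sqrt_id_minus X x"
  have "bounded_clinear ?L"
  proof (rule bounded_clinearI[where K = 1])
    show "?L (x + y) = ?L x + ?L y" for x y
      by (rule LIMSEQ_unique[OF sqrt_iter_converges])
        (simp add: sqrt_iter_linear tendsto_add[OF sqrt_iter_converges sqrt_iter_converges])
    show "?L (c *\<^sub>C x) = c *\<^sub>C ?L x" for c x
      by (rule LIMSEQ_unique[OF sqrt_iter_converges])
        (simp add: sqrt_iter_linear bounded_linear.tendsto[OF bounded_linear_scaleC sqrt_iter_converges])
  qed (simp add: sqrt_defect_contraction)
  from bounded_clinear_diff_map[OF bounded_clinear_ident this] show ?thesis by simp
qed

lemma sqrt_id_minus_square: "sqrt_id_minus X (sqrt_id_minus X x) = x - X x"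
proof -
  define L where "L x = x - sqrt_id_minus X x" for x
  have L: "(\<lambda>n. sqrt_iter X n x) \<longlonglongrightarrow> L x" for x
    unfolding L_def by (rule sqrt_iter_converges)
  have "(\<lambda>n. sqrt_iter X n (sqrt_iter X n x - L x) + sqrt_iter X n (L x)) \<longlonglongrightarrow> 0 + L (L x)"
  proof (rule tendsto_add[OF _ L])
    have "(\<lambda>n. norm (sqrt_iter X n x - L x)) \<longlonglongrightarrow> 0"
      using L[of x] by (simp add: LIM_zero tendsto_norm_zero)
    then show "(\<lambda>n. sqrt_iter X n (sqrt_iter X n x - L x)) \<longlonglongrightarrow> 0"
    proof (rule Lim_null_comparison[rotated])
      show "\<forall>\<^sub>F n in sequentially. norm (sqrt_iter X n (sqrt_iter X n x - L x))
          \<le> norm (sqrt_iter X n x - L x)"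
        by (intro always_eventually allI sqrt_iter_le)
    qed
  qed
  then have "(\<lambda>n. (1/2) *\<^sub>R (X x + sqrt_iter X n (sqrt_iter X n x))) \<longlonglongrightarrow> (1/2) *\<^sub>R (X x + L (L x))"
    by (intro tendsto_intros) (simp add: bounded_clinear_diff[OF sqrt_iter_bounded_clinear])
  then have "(\<lambda>n. sqrt_iter X (Suc n) x) \<longlonglongrightarrow> (1/2) *\<^sub>R (X x + L (L x))" by simp
  moreover have "(\<lambda>n. sqrt_iter X (Suc n) x) \<longlonglongrightarrow> L x"
    by (rule LIMSEQ_Suc[OF L])
  ultimately have "L x = (1/2) *\<^sub>R (X x + L (L x))"
    using LIMSEQ_unique by blast
  then have "2 *\<^sub>R L x = X x + L (L x)"
    by (metis scaleR_half_double scaleR_scaleR mult.commute scaleR_left_imp_eq scaleR_right_distrib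
        scaleR_2)
  moreover have "L (L x) = x - 2 *\<^sub>R sqrt_id_minus X x + sqrt_id_minus X (sqrt_id_minus X x)"
    unfolding L_def by (simp add: bounded_clinear_diff[OF sqrt_id_minus_bounded_clinear] scaleR_2)
  moreover have "2 *\<^sub>R L x = 2 *\<^sub>R x - 2 *\<^sub>R sqrt_id_minus X x"
    by (simp add: L_def scaleR_diff_right)
  ultimately show ?thesis by (simp add: scaleR_2 algebra_simps)
qed

lemma sqrt_id_minus_self_adjoint:
  assumes "self_adjoint X"
  shows "self_adjoint (sqrt_id_minus X)"
  unfolding self_adjoint_def
proof (intro allI)
  fix x y
  have *: "inner (sqrt_iter X n x) y = inner x (sqrt_iter X n y)" for n x y
    using assms by (induction n arbitrary: x y) (simp_all add: inner_simps self_adjoint_def)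
  have "inner (x - sqrt_id_minus X x) y = inner x (y - sqrt_id_minus X y)"
  proof (rule LIMSEQ_unique)
    show "(\<lambda>n. inner (sqrt_iter X n x) y) \<longlonglongrightarrow> inner (x - sqrt_id_minus X x) y"
      by (intro tendsto_inner sqrt_iter_converges tendsto_const)
    show "(\<lambda>n. inner (sqrt_iter X n x) y) \<longlonglongrightarrow> inner x (y - sqrt_id_minus X y)"
      unfolding * by (intro tendsto_inner sqrt_iter_converges tendsto_const)
  qed
  then show "inner (sqrt_id_minus X x) y = inner x (sqrt_id_minus X y)"
    by (simp add: inner_simps)
qed

lemma sqrt_id_minus_nonneg: "0 \<le> inner (sqrt_id_minus X x) x"
proof -
  have "inner (x - sqrt_id_minus X x) x \<le> norm (x - sqrt_id_minus X x) * norm x"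
    by (rule norm_cauchy_schwarz)
  also have "\<dots> \<le> norm x * norm x"
    by (intro mult_right_mono sqrt_defect_contraction) simp
  also have "\<dots> = inner x x" by (simp flip: power2_norm_eq_inner power2_eq_square)
  finally show ?thesis by (simp add: inner_simps)
qed

end

text \<open>The approximants are polynomials in \<open>X\<close> and \<open>X'\<close>, the same ones for both. The case of the
  codefect operators of \<open>A\<close> and \<open>A\<^sup>*\<close> is the relation \<open>A D\<^sub>A = D\<^bsub>A\<^sup>*\<^esub> A\<close> from which the properties of
  rotations follow.\<close>

lemma sqrt_id_minus_intertwine:
  assumes X: "bounded_clinear X" "\<And>x. norm (X x) \<le> norm x"
    and X': "bounded_clinear X'" "\<And>x. norm (X' x) \<le> norm x"
    and C: "bounded_clinear C" and CX: "\<And>x. C (X x) = X' (C x)"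
  shows "C (sqrt_id_minus X x) = sqrt_id_minus X' (C x)"
proof -
  have *: "C (sqrt_iter X n x) = sqrt_iter X' n (C x)" for n x
    by (induction n arbitrary: x)
      (simp_all add: bounded_clinear_zero[OF C] bounded_clinear_add[OF C] bounded_clinear_scaleR[OF C] CX)
  have "C (x - sqrt_id_minus X x) = C x - sqrt_id_minus X' (C x)"
  proof (rule LIMSEQ_unique)
    show "(\<lambda>n. C (sqrt_iter X n x)) \<longlonglongrightarrow> C (x - sqrt_id_minus X x)"
      by (intro bounded_clinear_tendsto[OF C] sqrt_iter_converges X)
    show "(\<lambda>n. C (sqrt_iter X n x)) \<longlonglongrightarrow> C x - sqrt_id_minus X' (C x)"
      unfolding * by (intro sqrt_iter_converges X')
  qed
  then show ?thesis by (simp add: bounded_clinear_diff[OF C])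
qed

text \<open>Let \<open>R\<close> be the root just constructed and \<open>B\<close> another positive root. The two commute, since
  \<open>B\<close> commutes with \<open>X = I - B\<^sup>2\<close>. For \<open>y = (B - R) x\<close> this gives \<open>B y + R y = 0\<close>, so both positive
  forms vanish at \<open>y\<close>; as \<open>R\<close> is itself a square, \<open>R y = 0\<close>, hence \<open>B y = 0\<close>, and \<open>y\<close> is orthogonal to
  \<open>(B - R) x\<close>, that is, to itself.\<close>

lemma psqrt_eq:
  assumes X: "bounded_clinear X" and X_le: "\<And>x. norm (X x) \<le> norm x" and sa: "self_adjoint X"
  shows "psqrt (\<lambda>x. x - X x) = sqrt_id_minus X"
  unfolding psqrt_def bop_UNIV
proof (rule the_equality)
  let ?R = "sqrt_id_minus X"
  have R: "bounded_clinear ?R" by (rule sqrt_id_minus_bounded_clinear[OF X X_le])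
  have R_sa: "self_adjoint ?R" by (rule sqrt_id_minus_self_adjoint[OF X X_le sa])
  show "bounded_clinear ?R \<and> (\<forall>x. cinner (?R x) x \<in> \<real>\<^sub>\<ge>\<^sub>0) \<and> ?R \<circ> ?R = (\<lambda>x. x - X x)"
    using R sqrt_id_minus_square[OF X X_le] sqrt_id_minus_nonneg[OF X X_le]
    by (auto simp: self_adjoint_cinner_real[OF R R_sa] complex_nonneg_Reals_iff)
  fix B assume B': "bounded_clinear B \<and> (\<forall>x. cinner (B x) x \<in> \<real>\<^sub>\<ge>\<^sub>0) \<and> B \<circ> B = (\<lambda>x. x - X x)"
  then have B: "bounded_clinear B" and BB: "\<And>x. B (B x) = x - X x"
    by (auto simp: fun_eq_iff)
  have B_pos: "0 \<le> inner (B x) x" for x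
    using B' by (metis Re_cinner complex_nonneg_Reals_iff)
  have B_sa: "self_adjoint B"
    using B' by (intro cinner_real_imp_self_adjoint) (auto elim: nonneg_Reals_cases)
  have "B (X x) = X (B x)" for x
  proof -
    have "B (x - X x) = B x - X (B x)" by (simp flip: BB)
    then show ?thesis by (simp add: bounded_clinear_diff[OF B])
  qed
  then have comm: "B (?R x) = ?R (B x)" for x
    by (intro sqrt_id_minus_intertwine X X_le B)
  show "B = ?R"
  proof
    fix x
    define y where "y = B x - ?R x"
    have "B y + ?R y = 0"
      using BB[of x] sqrt_id_minus_square[OF X X_le, of x] comm[of x]
      by (simp add: y_def bounded_clinear_diff[OF B] bounded_clinear_diff[OF R])
    then have By: "B y = - ?R y" by (simp add: eq_neg_iff_add_eq_0)
    then have "inner (?R y) y = 0"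
      using B_pos[of y] sqrt_id_minus_nonneg[OF X X_le, of y] by simp
    have Ry: "?R y = 0"
    proof -
      \<comment> \<open>\<open>R = I - Y\<close> with \<open>Y\<close> a self-adjoint contraction, so \<open>R\<close> has a self-adjoint root in turn.\<close>
      let ?Y = "\<lambda>x. x - ?R x" and ?Q = "sqrt_id_minus (\<lambda>x. x - ?R x)"
      have Y: "bounded_clinear ?Y" by (rule bounded_clinear_diff_map[OF bounded_clinear_ident R])
      have Y_le: "norm (?Y x) \<le> norm x" for x by (rule sqrt_defect_contraction[OF X X_le])
      have Y_sa: "self_adjoint ?Y" using R_sa by (simp add: self_adjoint_def inner_simps)
      have QQ: "?Q (?Q z) = ?R z" for z
        using sqrt_id_minus_square[OF Y Y_le, of z] by simp
      have "inner (?Q y) (?Q y) = inner (?R y) y"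
        using sqrt_id_minus_self_adjoint[OF Y Y_le Y_sa] QQ[of y] by (simp add: self_adjoint_def inner_commute)
      then have "?Q y = 0" using \<open>inner (?R y) y = 0\<close> by simp
      then show ?thesis
        using QQ[of y] bounded_clinear_zero[OF sqrt_id_minus_bounded_clinear[OF Y Y_le]] by simp
    qed
    with By have "B y = 0" by simp
    have "inner y y = inner (B x) y - inner (?R x) y"
      by (simp add: y_def inner_simps)
    also have "\<dots> = 0"
      using B_sa R_sa Ry \<open>B y = 0\<close> by (simp add: self_adjoint_def)
    finally show "B x = ?R x" by (simp add: y_def)
  qed
qed

section \<open>Defect operators and elementary rotations\<close>

lemma limit_in_closure:
  fixes x :: "'a::first_countable_topology"
  shows "(\<And>n. f n \<in> S) \<Longrightarrow> f \<longlonglongrightarrow> x \<Longrightarrow> x \<in> closure S"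
  unfolding closure_sequential by (intro exI[of _ f]) simp

lemma closed_csubspace_closure_range:
  assumes "bounded_clinear F"
  shows "closed_csubspace (closure (range F))"
proof -
  note lin = bounded_clinear_add[OF assms, symmetric] bounded_clinear_scaleC[OF assms, symmetric]
    bounded_clinear_scaleR[OF assms, symmetric]
  have add: "x + y \<in> closure (range F)" if xy: "x \<in> closure (range F)" "y \<in> closure (range F)" for x y
  proof -
    obtain f where f: "\<forall>n. f n \<in> range F" "f \<longlonglongrightarrow> x"
      using xy(1) unfolding closure_sequential by blast
    obtain g where g: "\<forall>n. g n \<in> range F" "g \<longlonglongrightarrow> y"
      using xy(2) unfolding closure_sequential by blast
    have "f n + g n \<in> range F" for n
      using f(1)[rule_format, of n] g(1)[rule_format, of n] by (auto simp: lin)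
    then show ?thesis using tendsto_add[OF f(2) g(2)] by (rule limit_in_closure)
  qed
  have scale: "c *\<^sub>C x \<in> closure (range F)" if x: "x \<in> closure (range F)" for c x
  proof -
    obtain f where f: "\<forall>n. f n \<in> range F" "f \<longlonglongrightarrow> x"
      using x unfolding closure_sequential by blast
    have "c *\<^sub>C f n \<in> range F" for n
      using f(1)[rule_format, of n] by (auto simp: lin)
    then show ?thesis using bounded_linear.tendsto[OF bounded_linear_scaleC f(2)] by (rule limit_in_closure)
  qed
  have "F 0 \<in> closure (range F)" by (meson closure_subset rangeI subsetD)
  moreover have "r *\<^sub>R x \<in> closure (range F)" if "x \<in> closure (range F)" for r x
    using scale[OF that, of "complex_of_real r"] by (simp add: scaleC_of_real)
  ultimately show ?thesis
    using add scale by (simp add: closed_csubspace_def subspace_def bounded_clinear_zero[OF assms])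
qed

text \<open>\<open>I - D\<^sub>A\<^sup>2\<close>, the operator to which the square root iteration is applied: \<open>A\<^sup>*A\<close> on \<open>S\<close> and the
  identity on its orthogonal complement.\<close>

definition codefect :: "'a::chilbert_space set \<Rightarrow> ('a \<Rightarrow> 'b::chilbert_space) \<Rightarrow> 'a \<Rightarrow> 'a" where
  "codefect S A x = x - (proj S x - cadjoint A (A x))"

locale contraction =
  fixes S :: "'a::chilbert_space set" and T :: "'b::chilbert_space set" and A :: "'a \<Rightarrow> 'b"
  assumes S: "closed_csubspace S" and T: "closed_csubspace T" and A: "A \<in> contractions S T"
begin

lemmas A_bounded_clinear = contractionsD(1)[OF A S]
  and A_in = contractionsD(2)[OF A S]
  and A_proj = contractionsD(3)[OF A S]
  and A_le = contractionsD(4)[OF A S]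

lemma cadjoint_contraction: "contraction T S (cadjoint A)"
  using cadjoint_contractions[OF A S T] S T by unfold_locales

lemma cadjoint_invol: "cadjoint (cadjoint A) = A"
  by (rule cadjoint_cadjoint[OF A_bounded_clinear])

lemmas inner_A = inner_cadjoint[OF A_bounded_clinear]

lemma adj_bounded_clinear: "bounded_clinear (cadjoint A)"
  and adj_in: "cadjoint A y \<in> S"
  and adj_le: "norm (cadjoint A y) \<le> norm y"
  using contractionsD[OF cadjoint_contractions[OF A S T] T] by auto

lemma codefect_bounded_clinear: "bounded_clinear (codefect S A)"
  unfolding codefect_def
  by (intro bounded_clinear_ident bounded_clinear_diff_map bounded_clinear_compose[OF adj_bounded_clinear]
      A_bounded_clinear bounded_clinear_proj[OF S])

lemma codefect_self_adjoint: "self_adjoint (codefect S A)"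
  unfolding self_adjoint_def codefect_def
proof (intro allI)
  fix x y
  have "inner (cadjoint A (A x)) y = inner x (cadjoint A (A y))"
    by (metis inner_A inner_commute)
  then show "inner (x - (proj S x - cadjoint A (A x))) y = inner x (y - (proj S y - cadjoint A (A y)))"
    by (simp add: inner_simps inner_proj_commute[OF S])
qed

lemma codefect_le: "norm (codefect S A x) \<le> norm x"
proof (rule power2_le_imp_le)
  have "codefect S A x = (x - proj S x) + cadjoint A (A x)" by (simp add: codefect_def)
  moreover have "inner (x - proj S x) (cadjoint A (A x)) = 0"
    by (rule inner_minus_proj[OF S adj_in])
  ultimately have "(norm (codefect S A x))\<^sup>2 = (norm (x - proj S x))\<^sup>2 + (norm (cadjoint A (A x)))\<^sup>2"
    unfolding power2_norm_eq_inner by (simp add: inner_add_left inner_add_right inner_commute)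
  moreover have "norm (cadjoint A (A x)) \<le> norm (proj S x)"
    using adj_le[of "A (proj S x)"] A_le[of "proj S x"] by (simp add: A_proj)
  then have "(norm (cadjoint A (A x)))\<^sup>2 \<le> (norm (proj S x))\<^sup>2" by (simp add: power_mono)
  ultimately show "(norm (codefect S A x))\<^sup>2 \<le> (norm x)\<^sup>2"
    using proj_norm[OF S, of x] by linarith
qed simp

lemma defect_op_eq: "defect_op S A = sqrt_id_minus (codefect S A)"
  using psqrt_eq[OF codefect_bounded_clinear codefect_le codefect_self_adjoint]
  by (simp add: defect_op_def codefect_def)

lemma defect_bounded_clinear: "bounded_clinear (defect_op S A)"
  unfolding defect_op_eq by (rule sqrt_id_minus_bounded_clinear[OF codefect_bounded_clinear codefect_le])

lemma defect_self_adjoint: "inner (defect_op S A x) y = inner x (defect_op S A y)"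
  using sqrt_id_minus_self_adjoint[OF codefect_bounded_clinear codefect_le codefect_self_adjoint]
  by (simp add: defect_op_eq self_adjoint_def)

lemma defect_square: "defect_op S A (defect_op S A x) = proj S x - cadjoint A (A x)"
  unfolding defect_op_eq sqrt_id_minus_square[OF codefect_bounded_clinear codefect_le]
  by (simp add: codefect_def)

lemma defect_norm: "(norm (defect_op S A x))\<^sup>2 = (norm (proj S x))\<^sup>2 - (norm (A x))\<^sup>2"
proof -
  have "inner (proj S x) x = inner (proj S x) (proj S x)"
    using inner_proj_commute[OF S, of "proj S x" x] S by simp
  then show ?thesis
    unfolding power2_norm_eq_inner defect_self_adjoint defect_square
    by (simp add: inner_simps inner_A inner_commute)
qed

lemma defect_proj: "defect_op S A (proj S x) = defect_op S A x"
proof -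
  have "(norm (defect_op S A (x - proj S x)))\<^sup>2 = 0"
    unfolding defect_norm
    using S by (simp add: bounded_clinear_diff[OF A_bounded_clinear] A_proj
        bounded_clinear_diff[OF bounded_clinear_proj[OF S]])
  then show ?thesis by (simp add: bounded_clinear_diff[OF defect_bounded_clinear])
qed

lemma defect_in: "defect_op S A x \<in> S"
proof -
  have "inner z (proj S (defect_op S A x)) = inner z (defect_op S A x)" for z
    by (simp only: defect_self_adjoint[symmetric] inner_proj_commute[OF S, symmetric] defect_proj)
  then have "proj S (defect_op S A x) = defect_op S A x" by (rule inner_eqI)
  then show ?thesis using proj_in[OF S, of "defect_op S A x"] by simp
qed

lemma defect_in_space: "defect_op S A x \<in> defect_space S A"
  unfolding defect_space_def by (rule subsetD[OF closure_subset rangeI])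

lemma defect_space_closed: "closed_csubspace (defect_space S A)"
  unfolding defect_space_def by (rule closed_csubspace_closure_range[OF defect_bounded_clinear])

lemma defect_space_subset: "defect_space S A \<subseteq> S"
  unfolding defect_space_def using defect_in closed_csubspaceD(1)[OF S]
  by (intro closure_minimal) auto

text \<open>A self-adjoint operator has its kernel orthogonal to its range, hence to the closure of the
  range.\<close>

lemma defect_op_inj:
  assumes "y \<in> defect_space S A" "defect_op S A y = 0"
  shows "y = 0"
proof -
  have "defect_space S A \<subseteq> {z. inner z y = 0}"
    unfolding defect_space_def
    by (intro closure_minimal closed_Collect_eq continuous_intros)
      (auto simp: defect_self_adjoint assms(2))
  then show ?thesis using assms(1) by auto
qed

lemma defect_intertwine: "A (defect_op S A x) = defect_op T (cadjoint A) (A x)"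
proof -
  interpret adj: contraction T S "cadjoint A" by (rule cadjoint_contraction)
  have "A (codefect S A x) = codefect T (cadjoint A) (A x)" for x
    using A_in T by (simp add: codefect_def cadjoint_invol A_proj bounded_clinear_diff[OF A_bounded_clinear])
  then show ?thesis
    unfolding defect_op_eq adj.defect_op_eq
    by (intro sqrt_id_minus_intertwine codefect_bounded_clinear codefect_le
        adj.codefect_bounded_clinear adj.codefect_le A_bounded_clinear)
qed

lemma maps_defect_space:
  assumes "x \<in> defect_space S A"
  shows "A x \<in> defect_space T (cadjoint A)"
proof -
  interpret adj: contraction T S "cadjoint A" by (rule cadjoint_contraction)
  have "A ` closure (range (defect_op S A)) \<subseteq> defect_space T (cadjoint A)"
    using closed_csubspaceD(1)[OF adj.defect_space_closed]
    by (intro image_closure_subset bounded_clinear_continuous A_bounded_clinear)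
      (auto simp: defect_intertwine adj.defect_in_space)
  then show ?thesis using assms by (auto simp: defect_space_def)
qed

end

lemma norm_Pair_square: "(norm (a, b))\<^sup>2 = (norm a)\<^sup>2 + (norm b)\<^sup>2"
  by (simp add: norm_Pair)

context contraction
begin

interpretation adj: contraction T S "cadjoint A" by (rule cadjoint_contraction)

lemma rotation_eq: "rotation S T A p =
    (A (fst p) + defect_op T (cadjoint A) (proj (defect_space T (cadjoint A)) (snd p)),
     defect_op S A (fst p) - cadjoint A (proj (defect_space T (cadjoint A)) (snd p)))"
  by (simp add: rotation_def Let_def split_beta)

lemma rotation_bounded_clinear: "bounded_clinear (rotation S T A)"
  unfolding rotation_eq
  by (intro bounded_clinear_plus_map bounded_clinear_diff_map bounded_clinear_Pair bounded_clinear_compose[OF A_bounded_clinear]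
      bounded_clinear_compose[OF adj.defect_bounded_clinear]
      bounded_clinear_compose[OF defect_bounded_clinear]
      bounded_clinear_compose[OF adj_bounded_clinear]
      bounded_clinear_compose[OF bounded_clinear_proj[OF adj.defect_space_closed]]
      bounded_clinear_fst bounded_clinear_snd)

lemma rotation_in: "rotation S T A p \<in> T \<times> defect_space S A"
  unfolding rotation_eq
  using A_in adj.defect_in defect_in_space
    adj.maps_defect_space[OF proj_in[OF adj.defect_space_closed]]
  by (simp add: closed_csubspaceD(4)[OF T] closed_csubspaceD(5)[OF defect_space_closed] cadjoint_invol)

lemma rotation_norm:
  "(norm (rotation S T A (x, y)))\<^sup>2
    = (norm (proj S x))\<^sup>2 + (norm (proj (defect_space T (cadjoint A)) y))\<^sup>2"
proof -
  define z where "z = proj (defect_space T (cadjoint A)) y"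
  have z: "z \<in> T" "proj T z = z"
    using proj_in[OF adj.defect_space_closed, of y] adj.defect_space_subset T
    unfolding z_def by auto
  have cross: "inner (A x) (defect_op T (cadjoint A) z) = inner (defect_op S A x) (cadjoint A z)"
    by (simp add: adj.defect_self_adjoint[symmetric] defect_intertwine[symmetric] inner_A)
  show ?thesis
    unfolding rotation_eq norm_Pair_square z_def[symmetric] fst_conv snd_conv
    using defect_norm[of x] adj.defect_norm[of z] cross z(2)
    unfolding power2_norm_eq_inner by (simp add: inner_simps inner_commute)
qed

lemma rotation_le: "norm (rotation S T A p) \<le> norm p"
proof (rule power2_le_imp_le)
  obtain x y where p: "p = (x, y)" by (cases p)
  show "(norm (rotation S T A p))\<^sup>2 \<le> (norm p)\<^sup>2"
    unfolding p rotation_norm norm_Pair_square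
    by (intro add_mono power_mono norm_proj_le S adj.defect_space_closed norm_ge_zero)
qed simp

lemma rotation_isometric:
  assumes "p \<in> S \<times> defect_space T (cadjoint A)"
  shows "norm (rotation S T A p) = norm p"
proof -
  obtain x y where p: "p = (x, y)" by (cases p)
  have "(norm (rotation S T A p))\<^sup>2 = (norm p)\<^sup>2"
    using assms S adj.defect_space_closed unfolding p rotation_norm norm_Pair_square by simp
  then show ?thesis by simp
qed

text \<open>Multiplying the two block matrices out, the off-diagonal entries cancel by
  \<open>A D\<^sub>A = D\<^bsub>A\<^sup>*\<^esub> A\<close> and the diagonal ones are \<open>A\<^sup>*A + D\<^sub>A\<^sup>2\<close> and \<open>A A\<^sup>* + D\<^bsub>A\<^sup>*\<^esub>\<^sup>2\<close>.\<close>

lemma rotation_inverse: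
  assumes "p \<in> S \<times> defect_space T (cadjoint A)"
  shows "rotation T S (cadjoint A) (rotation S T A p) = p"
proof -
  obtain x y where p: "p = (x, y)" and x: "x \<in> S" and y: "y \<in> defect_space T (cadjoint A)"
    using assms by auto
  have [simp]: "proj (defect_space T (cadjoint A)) y = y" "proj S x = x" "proj T y = y"
    using x y S T adj.defect_space_closed adj.defect_space_subset by auto
  have 1: "rotation S T A p = (A x + defect_op T (cadjoint A) y, defect_op S A x - cadjoint A y)"
    by (simp add: rotation_eq p)
  then have "defect_op S A x - cadjoint A y \<in> defect_space S A"
    using rotation_in[of p] by simp
  then have "rotation T S (cadjoint A) (rotation S T A p) =
     (cadjoint A (A x + defect_op T (cadjoint A) y) + defect_op S A (defect_op S A x - cadjoint A y),
      defect_op T (cadjoint A) (A x + defect_op T (cadjoint A) y) - A (defect_op S A x - cadjoint A y))"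
    unfolding 1 contraction.rotation_eq[OF cadjoint_contraction] cadjoint_invol
    by (simp add: proj_ident[OF defect_space_closed])
  also have "\<dots> = (x, y)"
    using adj.defect_intertwine[of y]
    by (simp add: bounded_clinear_add[OF adj_bounded_clinear] bounded_clinear_diff[OF A_bounded_clinear]
        bounded_clinear_diff[OF defect_bounded_clinear] bounded_clinear_add[OF adj.defect_bounded_clinear]
        defect_square adj.defect_square defect_intertwine cadjoint_invol)
  finally show ?thesis by (simp add: p)
qed

lemma rotation_zero:
  assumes "y \<in> defect_space T (cadjoint A)" "fst (rotation S T A (0, y)) = 0"
  shows "y = 0"
proof (rule adj.defect_op_inj[OF assms(1)])
  show "defect_op T (cadjoint A) y = 0"
    using assms by (simp add: rotation_eq bounded_clinear_zero[OF A_bounded_clinear] adj.defect_space_closed)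
qed

end

section \<open>Isometries and unitary operators\<close>

lemma isometric_cinner:
  assumes A: "bounded_clinear A" and S: "closed_csubspace S"
    and iso: "\<And>x. x \<in> S \<Longrightarrow> norm (A x) = norm x" and xy: "x \<in> S" "y \<in> S"
  shows "cinner (A x) (A y) = cinner x y"
proof -
  have "inner (A x) (A y) = inner x y" if "x \<in> S" for x
    using iso[of "x + y"] iso[OF that] iso[OF xy(2)] closed_csubspaceD(4)[OF S that xy(2)]
    by (simp add: dot_norm bounded_clinear_add[OF A])
  with xy(1) show ?thesis
    by (simp add: cinner_eq_inner closed_csubspaceD(6)[OF S] flip: bounded_clinear_scaleC[OF A])
qed

text \<open>The closure of the relation between \<open>F x\<close> and \<open>G x\<close> is a closed subspace of the product on which
  the two coordinates have equal norms, so it is the graph of an isometry; completeness makes its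
  projections onto the coordinates closed, hence equal to the closures of the two ranges.\<close>

lemma unitary_of_equal_norms:
  fixes F :: "'x::chilbert_space \<Rightarrow> 'a::chilbert_space" and G :: "'x \<Rightarrow> 'b::chilbert_space"
  assumes F: "bounded_clinear F" and G: "bounded_clinear G" and FG: "\<And>x. norm (F x) = norm (G x)"
  shows "\<exists>Q \<in> unitaries (closure (range F)) (closure (range G)). \<forall>x. Q (F x) = G x"
proof -
  define R where "R = closure (range (\<lambda>x. (F x, G x)))"
  define S where "S = closure (range F)"
  have R: "closed_csubspace R" and S: "closed_csubspace S"
    unfolding R_def S_def
    using F G by (auto intro!: closed_csubspace_closure_range bounded_clinear_Pair)
  have gen: "(F x, G x) \<in> R" for x
    unfolding R_def by (rule subsetD[OF closure_subset rangeI])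
  have "R \<subseteq> {p. norm (fst p) = norm (snd p)}"
    unfolding R_def
    by (intro closure_minimal closed_Collect_eq continuous_intros) (auto simp: FG)
  then have iso: "norm a = norm b" if "(a, b) \<in> R" for a b
    using that by auto
  have uniq: "b = b'" if "(a, b) \<in> R" "(a, b') \<in> R" for a b b'
    using closed_csubspaceD(5)[OF R that] iso[of 0 "b - b'"] by (simp add: minus_prod_def)
  have swap: "\<exists>b\<in>closure (range G'). (a, b) \<in> closure (range (\<lambda>x. (F' x, G' x)))"
    if h: "bounded_clinear F'" "bounded_clinear G'" "\<And>x. norm (F' x) = norm (G' x)"
      "a \<in> closure (range F')"
    for F' :: "'x \<Rightarrow> 'c::chilbert_space" and G' :: "'x \<Rightarrow> 'd::chilbert_space" and a
  proof -
    obtain f where "\<forall>n. f n \<in> range F'" and fa: "f \<longlonglongrightarrow> a"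
      using h(4) unfolding closure_sequential by blast
    then have "\<forall>n. \<exists>x. f n = F' x" by blast
    then obtain x where x: "\<And>n. f n = F' (x n)" by metis
    have "Cauchy f" using fa by (rule LIMSEQ_imp_Cauchy)
    moreover have "dist (G' (x m)) (G' (x n)) = dist (f m) (f n)" for m n
      using h(3)[of "x m - x n"]
      by (simp add: dist_norm x bounded_clinear_diff[OF h(1)] bounded_clinear_diff[OF h(2)])
    ultimately have "Cauchy (\<lambda>n. G' (x n))" by (simp add: Cauchy_def)
    then obtain b where b: "(\<lambda>n. G' (x n)) \<longlonglongrightarrow> b"
      using Cauchy_convergent convergent_def by blast
    have "(\<lambda>n. (F' (x n), G' (x n))) \<longlonglongrightarrow> (a, b)"
      using tendsto_Pair[OF fa b] by (simp add: x)
    then have "(a, b) \<in> closure (range (\<lambda>x. (F' x, G' x)))"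
      by (rule limit_in_closure[rotated]) blast
    moreover have "b \<in> closure (range G')" using b by (rule limit_in_closure[rotated]) blast
    ultimately show ?thesis by blast
  qed
  have ex: "\<exists>b\<in>closure (range G). (a, b) \<in> R" if "a \<in> S" for a
    using swap[OF F G FG] that unfolding R_def S_def by blast
  have ex': "\<exists>a\<in>S. (a, b) \<in> R" if b: "b \<in> closure (range G)" for b
  proof -
    obtain a where a: "a \<in> S" "(b, a) \<in> closure (range (\<lambda>x. (G x, F x)))"
      using swap[OF G F FG[symmetric] b] unfolding S_def by blast
    then obtain f where f: "\<forall>n. f n \<in> range (\<lambda>x. (G x, F x))" "f \<longlonglongrightarrow> (b, a)"
      unfolding closure_sequential by blast
    have "(\<lambda>n. (snd (f n), fst (f n))) \<longlonglongrightarrow> (a, b)"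
      using tendsto_Pair[OF tendsto_snd[OF f(2)] tendsto_fst[OF f(2)]] by simp
    moreover have "(snd (f n), fst (f n)) \<in> range (\<lambda>x. (F x, G x))" for n
      using f(1)[rule_format, of n] by auto
    ultimately have "(a, b) \<in> R" unfolding R_def by (rule limit_in_closure[rotated])
    with a show ?thesis by blast
  qed
  define Q where "Q x = (THE b. (proj S x, b) \<in> R)" for x
  have Q: "(proj S x, Q x) \<in> R" for x
    unfolding Q_def by (rule theI') (metis uniq ex proj_in[OF S])
  have Q_eq: "Q x = b" if "(proj S x, b) \<in> R" for x b
    using uniq[OF Q that] .
  note P = bounded_clinear_proj[OF S]
  have Q_lin: "bounded_clinear Q"
  proof (rule bounded_clinearI[where K = 1])
    show "Q (x + y) = Q x + Q y" for x y
      using closed_csubspaceD(4)[OF R Q[of x] Q[of y]]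
      by (intro Q_eq) (simp add: bounded_clinear_add[OF P])
    show "Q (c *\<^sub>C x) = c *\<^sub>C Q x" for c x
      using closed_csubspaceD(6)[OF R Q[of x], of c]
      by (intro Q_eq) (simp add: bounded_clinear_scaleC[OF P] scaleC_prod_def)
    show "norm (Q x) \<le> 1 * norm x" for x
      using iso[OF Q[of x]] norm_proj_le[OF S, of x] by simp
  qed
  have Q_in: "Q x \<in> closure (range G)" for x
    using ex[OF proj_in[OF S], of x] uniq[OF Q] by blast
  have "Q \<in> unitaries S (closure (range G))"
    unfolding unitaries_def
  proof (intro CollectI conjI ballI)
    show "Q \<in> bop S (closure (range G))"
      using Q_lin Q_in Q proj_ident[OF S proj_in[OF S]]
      by (auto simp: bop_iff[OF S] Q_def)
    show "Q ` S = closure (range G)"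
    proof (intro equalityI subsetI)
      fix b assume "b \<in> closure (range G)"
      then obtain a where "a \<in> S" "(a, b) \<in> R" using ex' by blast
      then have "Q a = b" using Q_eq S by simp
      with \<open>a \<in> S\<close> show "b \<in> Q ` S" by blast
    qed (use Q_in in auto)
    show "cinner (Q x) (Q y) = cinner x y" if "x \<in> S" "y \<in> S" for x y
    proof (rule isometric_cinner[OF Q_lin S _ that])
      show "norm (Q x) = norm x" if "x \<in> S" for x
        using iso[OF Q[of x]] that S by simp
    qed
  qed
  moreover have "Q (F x) = G x" for x
  proof -
    have "F x \<in> S" unfolding S_def by (rule subsetD[OF closure_subset rangeI])
    then show ?thesis using gen[of x] S by (intro Q_eq) simp
  qed
  ultimately show ?thesis unfolding S_def by blast
qed

section \<open>Inverses of operators near the identity\<close>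

text \<open>The equation \<open>A x = y\<close> says that \<open>x\<close> is a fixed point of \<open>x \<mapsto> y + (x - A x)\<close>, a strict
  contraction of the complete space \<open>S\<close>.\<close>

lemma op_inverse_near_identity:
  fixes A :: "'a::chilbert_space \<Rightarrow> 'a"
  assumes S: "closed_csubspace S" and A: "bounded_clinear A" and A_in: "\<And>x. x \<in> S \<Longrightarrow> A x \<in> S"
    and q: "0 \<le> q" "q < 1" and near: "\<And>x. x \<in> S \<Longrightarrow> norm (x - A x) \<le> q * norm x"
  shows "op_inverse S A \<in> bop S S" "x \<in> S \<Longrightarrow> op_inverse S A (A x) = x"
    "x \<in> S \<Longrightarrow> A (op_inverse S A x) = x"
proof -
  have ex: "\<exists>!x. x \<in> S \<and> y + (x - A x) = x" if y: "y \<in> S" for y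
  proof (rule Banach_fix[where c = q])
    show "complete S" using closed_csubspaceD(1)[OF S] by (simp add: complete_eq_closed)
    show "S \<noteq> {}" using closed_csubspaceD(3)[OF S] by blast
    show "(\<lambda>x. y + (x - A x)) ` S \<subseteq> S"
      using y A_in by (auto intro!: closed_csubspaceD(4,5)[OF S])
    fix u v assume uv: "u \<in> S" "v \<in> S"
    have "norm ((u - v) - A (u - v)) \<le> q * norm (u - v)"
      using uv by (intro near closed_csubspaceD(5)[OF S]) auto
    then show "dist (y + (u - A u)) (y + (v - A v)) \<le> q * dist u v"
      by (simp add: dist_norm bounded_clinear_diff[OF A] algebra_simps)
  qed (use q in auto)
  then have ex1: "\<exists>!x. x \<in> S \<and> A x = y" if "y \<in> S" for y
  proof -
    have "y + (x - A x) = x \<longleftrightarrow> A x = y" for x by (auto simp: algebra_simps)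
    with ex[OF that] show ?thesis by simp
  qed
  define B where "B y = (THE x. x \<in> S \<and> A x = proj S y)" for y
  have B: "B y \<in> S" "A (B y) = proj S y" for y
    using theI'[OF ex1[OF proj_in[OF S]], of y] by (auto simp: B_def)
  have B_eq: "B y = x" if "x \<in> S" "A x = proj S y" for x y
    using ex1[OF proj_in[OF S], of y] B that by blast
  note P = bounded_clinear_proj[OF S]
  have B_lin: "bounded_clinear B"
  proof (rule bounded_clinearI[where K = "1 / (1 - q)"])
    show "B (x + y) = B x + B y" for x y
      by (rule B_eq) (simp_all add: B closed_csubspaceD(4)[OF S] bounded_clinear_add[OF A] bounded_clinear_add[OF P])
    show "B (c *\<^sub>C x) = c *\<^sub>C B x" for c x
      by (rule B_eq) (simp_all add: B closed_csubspaceD(6)[OF S] bounded_clinear_scaleC[OF A] bounded_clinear_scaleC[OF P])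
    show "norm (B x) \<le> 1 / (1 - q) * norm x" for x
    proof -
      have "norm (B x) \<le> norm (B x - proj S x) + norm (proj S x)"
        using norm_triangle_ineq[of "B x - proj S x" "proj S x"] by simp
      also have "\<dots> \<le> q * norm (B x) + norm x"
        using near[OF B(1), of x] norm_proj_le[OF S, of x] by (simp add: B(2))
      finally have "(1 - q) * norm (B x) \<le> norm x" by (simp add: algebra_simps)
      then show ?thesis using q by (simp add: field_simps)
    qed
  qed
  have "B (proj S x) = B x" for x
    by (rule B_eq) (simp_all add: B S)
  then have B_bop: "B \<in> bop S S" and B_inv: "\<forall>x\<in>S. B (A x) = x \<and> A (B x) = x"
    using B_lin B S by (auto simp: bop_iff[OF S] A_in intro!: B_eq)
  have "op_inverse S A = B"
    unfolding op_inverse_def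
  proof (rule the_equality)
    show "B \<in> bop S S \<and> (\<forall>x\<in>S. B (A x) = x \<and> A (B x) = x)"
      using B_bop B_inv ..
    fix C assume C: "C \<in> bop S S \<and> (\<forall>x\<in>S. C (A x) = x \<and> A (C x) = x)"
    show "C = B"
    proof
      fix x
      have "A (C (proj S x)) = proj S x" using C proj_in[OF S] by blast
      moreover have "C (proj S x) = C x" "C x \<in> S" using C by (auto simp: bop_iff[OF S])
      ultimately show "C x = B x" using B_eq[of "C x" x] by simp
    qed
  qed
  with B_bop B_inv show "op_inverse S A \<in> bop S S" "x \<in> S \<Longrightarrow> op_inverse S A (A x) = x"
    "x \<in> S \<Longrightarrow> A (op_inverse S A x) = x"
    by auto
qed

lemma op_inverse_id_minus:
  assumes S: "closed_csubspace S" and K: "K \<in> contractions S S" and z: "norm z < 1"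
  shows "x \<in> S \<Longrightarrow> op_inverse S (\<lambda>y. proj S y - z *\<^sub>C K y) (x - z *\<^sub>C K x) = x"
    and "x \<in> S \<Longrightarrow> y = op_inverse S (\<lambda>y. proj S y - z *\<^sub>C K y) x \<Longrightarrow> y \<in> S \<and> y - z *\<^sub>C K y = x"
proof -
  let ?A = "\<lambda>y. proj S y - z *\<^sub>C K y"
  note KD = contractionsD[OF K S]
  have lin: "bounded_clinear ?A"
    by (intro bounded_clinear_diff_map bounded_clinear_proj[OF S]
        bounded_clinear_compose[OF bounded_clinear_scale_by KD(1)])
  have in_S: "?A x \<in> S" for x
    by (intro closed_csubspaceD(5,6)[OF S] proj_in[OF S] KD(2))
  have near: "norm (x - ?A x) \<le> cmod z * norm x" if "x \<in> S" for x
    using that KD(4) by (simp add: S norm_scaleC mult_left_mono)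
  note inv = op_inverse_near_identity[OF S lin in_S norm_ge_zero z near, simplified]
  show "x \<in> S \<Longrightarrow> op_inverse S ?A (x - z *\<^sub>C K x) = x"
    using inv(2)[of x] S by simp
  show "y \<in> S \<and> y - z *\<^sub>C K y = x" if "x \<in> S" "y = op_inverse S ?A x"
    using inv(3)[OF that(1)] inv(1) S that(2) by (auto simp: bop_iff[OF S] image_subset_iff)
qed

section \<open>Unitary colligations\<close>

lemma dense_range:
  assumes F: "bounded_clinear F" and orth: "\<And>m. (\<And>x. inner (F x) m = 0) \<Longrightarrow> m = 0"
  shows "closure (range F) = UNIV"
proof -
  let ?S = "closure (range F)"
  have S: "closed_csubspace ?S" by (rule closed_csubspace_closure_range[OF F])
  have "m \<in> ?S" for m
  proof -
    have "inner (F x) (m - proj ?S m) = 0" for x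
      using inner_minus_proj[OF S, of "F x" m] subsetD[OF closure_subset rangeI, of F x]
      by (simp add: inner_commute)
    then have "m - proj ?S m = 0" by (rule orth)
    then show ?thesis using proj_in[OF S, of m] by simp
  qed
  then show ?thesis by blast
qed

locale unitary_colligation =
  fixes H :: "'x::chilbert_space set"
    and U :: "'n::chilbert_space \<times> 'x \<Rightarrow> 'm::chilbert_space \<times> 'x"
  assumes H: "closed_csubspace H"
    and U: "bounded_clinear U"
    and U_iso: "p \<in> UNIV \<times> H \<Longrightarrow> norm (U p) = norm p"
    and U_onto: "U ` (UNIV \<times> H) = UNIV \<times> H"
begin

text \<open>The two blocks \<open>T\<close> and \<open>C\<close> of \<open>U\<close> that start from \<open>H\<close>, and the inverse of \<open>U\<close> on \<open>H\<close>.
  The projection extends them by zero to the orthogonal complement of \<open>H\<close>, as is needed for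
  \<open>T\<close> to count as an operator in \<open>H\<close>.\<close>

definition main_op :: "'x \<Rightarrow> 'x" where "main_op h = snd (U (0, proj H h))"
definition output_op :: "'x \<Rightarrow> 'm" where "output_op h = fst (U (0, proj H h))"
definition preimage :: "'x \<Rightarrow> 'n \<times> 'x" where
  "preimage h = inv_into (UNIV \<times> H) U (0, proj H h)"

lemma UNIV_times_H: "closed_csubspace (UNIV \<times> H :: ('k::chilbert_space \<times> 'x) set)"
  by (rule closed_csubspace_Times[OF closed_csubspace_UNIV H])

lemma inner_U:
  assumes "p \<in> UNIV \<times> H" "q \<in> UNIV \<times> H"
  shows "inner (U p) (U q) = inner p q"
  using isometric_cinner[OF U UNIV_times_H U_iso assms] by (metis Re_cinner)

lemma U_inj:
  assumes "p \<in> UNIV \<times> H" "q \<in> UNIV \<times> H" "U p = U q"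
  shows "p = q"
  using U_iso[OF closed_csubspaceD(5)[OF UNIV_times_H assms(1,2)]] assms(3)
  by (simp add: bounded_clinear_diff[OF U])

lemma U_in: "p \<in> UNIV \<times> H \<Longrightarrow> snd (U p) \<in> H"
  using U_onto by (metis image_eqI mem_Times_iff)

lemma U_split: "U (0, proj H h) = (output_op h, main_op h)"
  by (simp add: main_op_def output_op_def)

lemma proj_pair_bounded_clinear: "bounded_clinear (\<lambda>h. U (0, proj H h))"
  by (intro bounded_clinear_compose[OF U] bounded_clinear_const_zero bounded_clinear_Pair bounded_clinear_proj[OF H])

lemma output_op_bounded_clinear: "bounded_clinear output_op"
  unfolding output_op_def
  by (rule bounded_clinear_compose[OF bounded_clinear_fst proj_pair_bounded_clinear])

lemma main_op_bounded_clinear: "bounded_clinear main_op"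
  unfolding main_op_def
  by (rule bounded_clinear_compose[OF bounded_clinear_snd proj_pair_bounded_clinear])

lemma main_op_in: "main_op h \<in> H"
  unfolding main_op_def by (rule U_in) (simp add: H)

lemma output_main_norm: "(norm (output_op h))\<^sup>2 + (norm (main_op h))\<^sup>2 = (norm (proj H h))\<^sup>2"
proof -
  have "norm (U (0, proj H h)) = norm (0 :: 'n, proj H h)"
    by (rule U_iso) (simp add: H)
  then have "(norm (U (0, proj H h)))\<^sup>2 = (norm (proj H h))\<^sup>2"
    by (simp add: norm_Pair)
  then show ?thesis by (simp add: U_split norm_Pair_square)
qed

lemma main_op_contraction: "main_op \<in> contractions H H"
  unfolding contractions_def bop_iff[OF H]
proof (intro CollectI conjI allI)
  show "range main_op \<subseteq> H" using main_op_in by blast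
  show "main_op (proj H h) = main_op h" for h by (simp add: main_op_def H)
  show "norm (main_op h) \<le> norm h" for h
  proof (rule order_trans[OF power2_le_imp_le norm_proj_le[OF H]])
    show "(norm (main_op h))\<^sup>2 \<le> (norm (proj H h))\<^sup>2"
      using output_main_norm[of h] zero_le_power2[of "norm (output_op h)"] by linarith
  qed simp
qed (rule main_op_bounded_clinear)

sublocale main: contraction H H main_op
  using H main_op_contraction by unfold_locales

sublocale adj: contraction H H "cadjoint main_op"
  by (rule main.cadjoint_contraction)

lemma preimage: "preimage h \<in> UNIV \<times> H" "U (preimage h) = (0, proj H h)"
proof -
  have "(0, proj H h) \<in> U ` (UNIV \<times> H)" by (simp add: U_onto H)
  then show "preimage h \<in> UNIV \<times> H" "U (preimage h) = (0, proj H h)"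
    unfolding preimage_def by (auto intro: inv_into_into f_inv_into_f)
qed

lemma preimage_eqI: "p \<in> UNIV \<times> H \<Longrightarrow> U p = (0, proj H h) \<Longrightarrow> preimage h = p"
  by (rule U_inj) (simp_all add: preimage)

lemma preimage_bounded_clinear: "bounded_clinear preimage"
proof (rule bounded_clinearI[where K = 1])
  note P = bounded_clinear_proj[OF H]
  show "preimage (g + h) = preimage g + preimage h" for g h
    using closed_csubspaceD(4)[OF UNIV_times_H preimage(1) preimage(1)]
    by (rule preimage_eqI) (simp add: preimage(2) bounded_clinear_add[OF U] bounded_clinear_add[OF P])
  show "preimage (c *\<^sub>C h) = c *\<^sub>C preimage h" for c h
    using closed_csubspaceD(6)[OF UNIV_times_H preimage(1)]
    by (rule preimage_eqI)
      (simp only: preimage(2) bounded_clinear_scaleC[OF U] bounded_clinear_scaleC[OF P],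
        simp add: scaleC_prod_def)
  show "norm (preimage h) \<le> 1 * norm h" for h
    using U_iso[OF preimage(1), of h] norm_proj_le[OF H, of h] by (simp add: preimage(2) norm_Pair)
qed

text \<open>The second component of \<open>U\<^sup>-\<^sup>1(0, h)\<close> is \<open>T\<^sup>*h\<close>, because \<open>U\<^sup>-\<^sup>1\<close> is the adjoint of \<open>U\<close>.\<close>

lemma snd_preimage: "snd (preimage h) = cadjoint main_op h"
proof -
  have "inner (main_op g) h = inner g (snd (preimage h))" for g h
  proof -
    have s: "snd (preimage h) \<in> H" using preimage(1)[of h] by (simp add: mem_Times_iff)
    have "inner (main_op g) h = inner (main_op g) (proj H h)"
      using inner_proj_commute[OF H, of "main_op g" h] main_op_in[of g] H by simp
    also have "\<dots> = inner (U (0, proj H g)) (U (preimage h))"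
      by (simp add: preimage(2) U_split)
    also have "\<dots> = inner (0, proj H g) (preimage h)"
      using H by (intro inner_U preimage(1)) simp
    also have "\<dots> = inner g (snd (preimage h))"
      using s H inner_proj_commute[OF H, of g "snd (preimage h)"] by (simp add: inner_prod_def)
    finally show ?thesis .
  qed
  then have "cadjoint main_op = (\<lambda>h. snd (preimage h))"
    by (rule cadjoint_eqI[OF main_op_bounded_clinear])
  then show ?thesis by simp
qed

lemma preimage_split: "preimage h = (fst (preimage h), cadjoint main_op h)"
  by (simp flip: snd_preimage)

lemma norm_output_op: "norm (output_op h) = norm (defect_op H main_op h)"
proof -
  have "(norm (output_op h))\<^sup>2 = (norm (defect_op H main_op h))\<^sup>2"
    using output_main_norm[of h] by (simp add: main.defect_norm)
  then show ?thesis by simp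
qed

lemma norm_fst_preimage: "norm (fst (preimage h)) = norm (defect_op H (cadjoint main_op) h)"
proof -
  have "(norm (preimage h))\<^sup>2 = (norm (proj H h))\<^sup>2"
    using U_iso[OF preimage(1), of h] by (simp add: preimage(2) norm_Pair)
  then have "(norm (fst (preimage h)))\<^sup>2 = (norm (defect_op H (cadjoint main_op) h))\<^sup>2"
    unfolding adj.defect_norm by (subst (asm) preimage_split) (simp add: norm_Pair_square)
  then show ?thesis by simp
qed

text \<open>On a subspace on which \<open>T\<close> acts unitarily the component of \<open>U\<close> in \<open>'m\<close> vanishes, so \<open>U\<close> itself
  maps \<open>{0} \<times> K\<close> onto \<open>{0} \<times> K\<close>.\<close>

lemma main_op_completely_nonunitary:
  assumes "\<And>K. K \<subseteq> H \<Longrightarrow> U ` ({0} \<times> K) = {0} \<times> K \<Longrightarrow> K \<subseteq> {0}"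
  shows "completely_nonunitary H main_op"
  unfolding completely_nonunitary_def
proof (intro conjI allI impI main_op_contraction)
  fix K assume K: "K \<subseteq> H \<and> reduces K main_op \<and> main_op \<circ> proj K \<in> unitaries K K"
  then have Kc: "closed_csubspace K" and KH: "K \<subseteq> H" by (auto simp: reduces_def)
  have onto: "main_op ` K = K"
    using K Kc by (auto simp: unitaries_def image_comp[symmetric] image_iff)
  have iso: "norm (main_op g) = norm g" if "g \<in> K" for g
  proof -
    have "cinner (main_op g) (main_op g) = cinner g g"
      using K Kc that by (auto simp: unitaries_def)
    then show ?thesis by (simp add: cinner_self norm_eq_sqrt_inner)
  qed
  have U_K: "U (0, g) = (0, main_op g)" if "g \<in> K" for g
  proof -
    have "proj H g = g" using that KH H by auto
    then show ?thesis
      using output_main_norm[of g] iso[OF that] U_split[of g] by simp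
  qed
  have "U ` ({0} \<times> K) = {0} \<times> K"
  proof -
    have "U ` ({0} \<times> K) = Pair 0 ` main_op ` K"
      unfolding image_image using U_K by (force simp: image_iff)
    then show ?thesis by (auto simp: onto)
  qed
  then show "K = {0}"
    using assms KH closed_csubspaceD(3)[OF Kc] by blast
qed

text \<open>Let \<open>D\<close>, \<open>D'\<close> be the defect operators of \<open>T\<close> and \<open>T\<^sup>*\<close>, and let \<open>Q\<close>, \<open>R\<close> be the unitary operators
  with \<open>Q (C h) = D h\<close> and \<open>R (D' h) = E h\<close>. By purity, \<open>\<Theta>(0)\<close> preserves the norm of no nonzero
  vector; but a vector orthogonal to the range of \<open>C\<close> or of \<open>E\<close> would yield a pair \<open>n\<close>, \<open>m\<close> with
  \<open>U (n, 0) = (m, 0)\<close> and \<open>n = \<Theta>(0) m\<close>. So both ranges are dense, as \<open>Q\<close> and \<open>R\<close> require.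

  For \<open>U (\<Theta>(z) m, h) = (m, z h)\<close> the component in \<open>H\<close> of \<open>U\<^sup>-\<^sup>1 (m, z h)\<close> gives the state equation
  \<open>h - z T\<^sup>* h = D (Q m)\<close>, so \<open>h\<close> is the resolvent term in the characteristic function. Subtracting
  \<open>U\<^sup>-\<^sup>1 (0, z h)\<close> leaves \<open>U (\<Theta>(z) m - z E h, D (Q m)) = (m, 0)\<close>, and the same equation holds with
  \<open>- R T Q m\<close> as first entry, so the two first entries agree.\<close>

lemma char_fun_coincides:
  fixes \<Theta> :: "complex \<Rightarrow> 'm \<Rightarrow> 'n"
  assumes pure: "\<And>f. f \<noteq> 0 \<Longrightarrow> norm (\<Theta> 0 f) < norm f"
    and transfer: "\<And>z m. norm z < 1 \<Longrightarrow> \<exists>h\<in>H. U (\<Theta> z m, h) = (m, z *\<^sub>C h)"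
  shows "coincide (defect_space H main_op) (defect_space H (cadjoint main_op))
    (char_fun H main_op) UNIV UNIV \<Theta>"
proof -
  let ?T = main_op and ?D = "defect_op H main_op" and ?D' = "defect_op H (cadjoint main_op)"
  note T = main_op_bounded_clinear
  have pure_eq: "m = 0" if "norm (\<Theta> 0 m) = norm m" for m
    using pure[of m] that by force
  have transfer0: "\<exists>h\<in>H. U (\<Theta> 0 m, h) = (m, 0)" for m
    using transfer[of 0 m] by simp
  have dense_C: "closure (range output_op) = UNIV"
  proof (rule dense_range[OF output_op_bounded_clinear])
    fix m assume m: "inner (output_op h) m = 0" for h
    obtain h where h: "h \<in> H" "U (\<Theta> 0 m, h) = (m, 0)" using transfer0 by blast
    have "inner (U (0, proj H h)) (U (\<Theta> 0 m, h)) = inner (0, proj H h) (\<Theta> 0 m, h)"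
      using h(1) H by (intro inner_U) auto
    then have "inner (output_op h) m = inner (proj H h) h"
      unfolding U_split h(2) by simp
    then have "inner h h = 0"
      using m[of h] h H by simp
    then have "h = 0" by simp
    then have "norm (\<Theta> 0 m) = norm m"
      using U_iso[of "(\<Theta> 0 m, h)"] h by (simp add: norm_Pair)
    then show "m = 0" by (rule pure_eq)
  qed
  have fst_preimage: "bounded_clinear (\<lambda>h. fst (preimage h))"
    by (rule bounded_clinear_compose[OF bounded_clinear_fst preimage_bounded_clinear])
  have dense_E: "closure (range (\<lambda>h. fst (preimage h))) = UNIV"
  proof (rule dense_range[OF fst_preimage])
    fix n assume n: "inner (fst (preimage h)) n = 0" for h
    have 0: "0 \<in> H" by (rule closed_csubspaceD(3)[OF H])
    obtain m k where mk: "U (n, 0) = (m, k)" by (cases "U (n, 0)")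
    have k: "k \<in> H" using U_in[of "(n, 0)"] 0 mk by simp
    have "inner (U (preimage k)) (U (n, 0)) = inner (preimage k) (n, 0)"
      using 0 preimage(1) by (intro inner_U) auto
    then have "inner k k = 0"
      using n[of k] k H by (simp add: preimage(2) mk inner_prod_def)
    then have Un: "U (n, 0) = (m, 0)" by (simp add: mk)
    obtain h where h: "h \<in> H" "U (\<Theta> 0 m, h) = (m, 0)" using transfer0 by blast
    have "(\<Theta> 0 m, h) = (n, 0)"
      using h Un 0 by (intro U_inj) auto
    moreover have "norm m = norm n"
      using U_iso[of "(n, 0)"] 0 Un by (simp add: norm_Pair)
    ultimately have "m = 0" by (intro pure_eq) simp
    with Un have "U (n, 0) = U (0, 0)"
      using bounded_clinear_zero[OF U] by (simp add: zero_prod_def)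
    then show "n = 0" using U_inj[of "(n, 0)" "(0, 0)"] 0 by simp
  qed
  obtain Q where Q: "Q \<in> unitaries UNIV (defect_space H ?T)" and QC: "\<And>h. Q (output_op h) = ?D h"
    using unitary_of_equal_norms[OF output_op_bounded_clinear main.defect_bounded_clinear norm_output_op]
    unfolding dense_C defect_space_def[symmetric] by blast
  obtain R where R: "R \<in> unitaries (defect_space H (cadjoint ?T)) UNIV"
    and RD: "\<And>h. R (?D' h) = fst (preimage h)"
    using unitary_of_equal_norms[OF adj.defect_bounded_clinear fst_preimage norm_fst_preimage[symmetric]]
    unfolding dense_E defect_space_def[symmetric] by blast
  have Q_lin: "bounded_clinear Q" and Q_in: "Q m \<in> defect_space H ?T"
    and Q_inner: "inner (Q m) (Q m') = inner m m'" for m m'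
    using Q by (auto simp: unitaries_def bop_iff simp flip: Re_cinner)
  have R_lin: "bounded_clinear R"
    using R by (auto simp: unitaries_def bop_iff adj.defect_space_closed)
  \<comment> \<open>It suffices to check this on the dense range of \<open>C\<close>, where \<open>T D\<^sub>T = D\<^bsub>T\<^sup>*\<^esub> T\<close> reduces it to the
    definition of \<open>U\<close>.\<close>
  have key: "U (- R (?T (Q m)), ?D (Q m)) = (m, 0)" for m
  proof -
    have "closure (range output_op) \<subseteq> {m. U (- R (?T (Q m)), ?D (Q m)) = (m, 0)}"
    proof (intro closure_minimal closed_Collect_eq subsetI)
      show "continuous_on UNIV (\<lambda>m. U (- R (?T (Q m)), ?D (Q m)))"
        by (intro bounded_clinear_continuous bounded_clinear_compose[OF U] bounded_clinear_uminus_map bounded_clinear_Pair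
            bounded_clinear_compose[OF R_lin] bounded_clinear_compose[OF T] Q_lin
            bounded_clinear_compose[OF main.defect_bounded_clinear])
      show "continuous_on UNIV (\<lambda>m::'m. (m, 0::'x))"
        by (intro continuous_intros)
      fix m assume "m \<in> range output_op"
      then obtain g where m: "m = output_op g" by blast
      have "(- R (?T (Q m)), ?D (Q m)) = (0, proj H g) - preimage (?T g)"
        unfolding m QC main.defect_intertwine RD main.defect_square
        by (subst (2) preimage_split) simp
      then have "U (- R (?T (Q m)), ?D (Q m)) = (m, 0)"
        by (simp add: bounded_clinear_diff[OF U] preimage(2) U_split m H main_op_in)
      then show "m \<in> {m. U (- R (?T (Q m)), ?D (Q m)) = (m, 0)}" by simp
    qed
    then show ?thesis using dense_C by blast
  qed
  have "R \<circ> char_fun H ?T z \<circ> Q = \<Theta> z" if z: "norm z < 1" for z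
  proof
    fix m
    obtain h where h: "h \<in> H" and Uh: "U (\<Theta> z m, h) = (m, z *\<^sub>C h)" using transfer[OF z] by blast
    have zh: "z *\<^sub>C h \<in> H" using h by (rule closed_csubspaceD(6)[OF H])
    have state: "h - z *\<^sub>C cadjoint ?T h = ?D (Q m)"
    proof (rule inner_eqI)
      fix g
      have "inner (U (0, proj H g)) (U (\<Theta> z m, h)) = inner (0, proj H g) (\<Theta> z m, h)"
        using h H by (intro inner_U) auto
      then have "inner (output_op g) m + inner (?T g) (z *\<^sub>C h) = inner g h"
        using h H by (simp add: Uh U_split inner_proj_commute)
      moreover have "inner (output_op g) m = inner g (?D (Q m))"
        using Q_inner[of "output_op g" m] by (simp add: QC main.defect_self_adjoint)
      moreover have "inner (?T g) (z *\<^sub>C h) = inner g (z *\<^sub>C cadjoint ?T h)"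
        by (simp add: main.inner_A bounded_clinear_scaleC[OF main.adj_bounded_clinear])
      ultimately show "inner g (h - z *\<^sub>C cadjoint ?T h) = inner g (?D (Q m))"
        by (simp add: inner_simps)
    qed
    have inv: "op_inverse H (\<lambda>y. proj H y - z *\<^sub>C cadjoint ?T y) (?D (Q m)) = h"
      unfolding state[symmetric] by (rule op_inverse_id_minus(1)[OF H adj.A z h])
    have "(\<Theta> z m - fst (preimage (z *\<^sub>C h)), h - cadjoint ?T (z *\<^sub>C h)) = (- R (?T (Q m)), ?D (Q m))"
    proof (rule U_inj)
      have "(\<Theta> z m - fst (preimage (z *\<^sub>C h)), h - cadjoint ?T (z *\<^sub>C h)) = (\<Theta> z m, h) - preimage (z *\<^sub>C h)"
        by (subst (2) preimage_split) simp
      then show "U (\<Theta> z m - fst (preimage (z *\<^sub>C h)), h - cadjoint ?T (z *\<^sub>C h)) = U (- R (?T (Q m)), ?D (Q m))"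
        by (simp add: bounded_clinear_diff[OF U] preimage(2) Uh key H zh)
    qed (use h in \<open>auto intro: closed_csubspaceD(5)[OF H] main.adj_in main.defect_in\<close>)
    then have "\<Theta> z m = - R (?T (Q m)) + z *\<^sub>C fst (preimage h)"
      by (simp add: bounded_clinear_scaleC[OF preimage_bounded_clinear] algebra_simps)
    also have "\<dots> = R (- ?T (Q m) + z *\<^sub>C ?D' h)"
      by (simp add: bounded_clinear_add[OF R_lin] bounded_clinear_minus[OF R_lin]
          bounded_clinear_diff[OF R_lin] bounded_clinear_scaleC[OF R_lin] RD)
    also have "\<dots> = (R \<circ> char_fun H ?T z \<circ> Q) m"
      using Q_in[of m] by (simp add: char_fun_def inv main.defect_space_closed)
    finally show "(R \<circ> char_fun H ?T z \<circ> Q) m = \<Theta> z m" ..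
  qed
  with Q R show ?thesis unfolding coincide_def by blast
qed

end

section \<open>Orthogonal sums\<close>

definition unitary_between :: "'a::chilbert_space set \<Rightarrow> 'b::chilbert_space set \<Rightarrow> ('a \<Rightarrow> 'b) \<Rightarrow> bool" where
  "unitary_between S T f \<longleftrightarrow> bounded_clinear f \<and> (\<forall>x\<in>S. norm (f x) = norm x) \<and> f ` S = T"

lemma unitary_betweenI:
  assumes "bounded_clinear f" "\<And>x. x \<in> S \<Longrightarrow> norm (f x) = norm x"
    "\<And>x. x \<in> S \<Longrightarrow> f x \<in> T" "\<And>y. y \<in> T \<Longrightarrow> \<exists>x\<in>S. f x = y"
  shows "unitary_between S T f"
proof -
  have "f ` S = T"
  proof
    show "T \<subseteq> f ` S"
    proof
      fix y assume "y \<in> T"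
      then obtain x where "x \<in> S" "f x = y" using assms(4) by blast
      then show "y \<in> f ` S" by blast
    qed
  qed (use assms(3) in blast)
  then show ?thesis using assms(1,2) by (simp add: unitary_between_def)
qed

lemma unitary_betweenD:
  assumes "unitary_between S T f"
  shows "bounded_clinear f" "x \<in> S \<Longrightarrow> norm (f x) = norm x" "x \<in> S \<Longrightarrow> f x \<in> T"
    "y \<in> T \<Longrightarrow> \<exists>x\<in>S. f x = y"
proof -
  have im: "f ` S = T" using assms by (simp add: unitary_between_def)
  show "bounded_clinear f" "x \<in> S \<Longrightarrow> norm (f x) = norm x"
    using assms by (simp_all add: unitary_between_def)
  show "x \<in> S \<Longrightarrow> f x \<in> T" using im by blast
  show "y \<in> T \<Longrightarrow> \<exists>x\<in>S. f x = y" unfolding im[symmetric] by (auto simp: image_iff)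
qed

lemma unitary_between_comp:
  assumes "unitary_between S T f" "unitary_between T R g"
  shows "unitary_between S R (g \<circ> f)"
proof -
  note f = unitary_betweenD[OF assms(1)] and g = unitary_betweenD[OF assms(2)]
  show ?thesis
  proof (rule unitary_betweenI)
    show "bounded_clinear (g \<circ> f)"
      unfolding comp_def by (rule bounded_clinear_compose[OF g(1) f(1)])
    fix y assume "y \<in> R"
    then obtain w where w: "w \<in> T" "g w = y" using g(4) by blast
    then obtain x where x: "x \<in> S" "f x = w" using f(4) by blast
    then show "\<exists>x\<in>S. (g \<circ> f) x = y" using w by (intro bexI[of _ x]) auto
  qed (simp_all add: f(2,3) g(2,3))
qed

lemma unitary_between_map_prod_id:
  fixes f :: "'a::chilbert_space \<Rightarrow> 'b::chilbert_space"
  assumes "unitary_between S T f"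
  shows "unitary_between ((UNIV :: 'c::chilbert_space set) \<times> S) (UNIV \<times> T) (map_prod id f)"
proof -
  note f = unitary_betweenD[OF assms]
  show ?thesis
  proof (rule unitary_betweenI)
    have "map_prod id f = (\<lambda>p :: 'c \<times> 'a. (fst p, f (snd p)))"
      by (auto simp: fun_eq_iff)
    then show "bounded_clinear (map_prod id f :: 'c \<times> 'a \<Rightarrow> 'c \<times> 'b)"
      by (elim ssubst) (rule bounded_clinear_Pair[OF bounded_clinear_fst
          bounded_clinear_compose[OF f(1) bounded_clinear_snd]])
    fix y :: "'c \<times> 'b" assume "y \<in> UNIV \<times> T"
    then obtain x where "x \<in> S" "f x = snd y" using f(4)[of "snd y"] by auto
    then show "\<exists>x\<in>UNIV \<times> S. map_prod id f x = y"
      by (intro bexI[of _ "(fst y, x)"]) auto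
  qed (auto simp: f(2,3) norm_Pair)
qed

lemma ell2_eqI: "(\<And>n. ell2_nth x n = ell2_nth y n) \<Longrightarrow> x = y"
  using ell2_nth_inject[of x y] by (simp add: fun_eq_iff)

lemma ell2_nth_Abs: "summable (\<lambda>n. (norm (f n))\<^sup>2) \<Longrightarrow> ell2_nth (Abs_ell2 f) = f"
  by (simp add: Abs_ell2_inverse)

lemma ell2_nth_bounded_clinear: "bounded_clinear (\<lambda>h. ell2_nth h n)"
  by (rule bounded_clinearI[where K = 1])
    (simp_all add: plus_ell2.rep_eq scaleC_ell2.rep_eq norm_ell2_nth_le)

definition orthogonal_sum :: "(nat \<Rightarrow> 'a::chilbert_space set) \<Rightarrow> 'a ell2 set" where
  "orthogonal_sum P = {h. \<forall>n. ell2_nth h n \<in> P n}"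

lemma closed_csubspace_orthogonal_sum:
  assumes P: "\<And>n. closed_csubspace (P n)"
  shows "closed_csubspace (orthogonal_sum P)"
proof -
  have "closed (orthogonal_sum P)"
  proof -
    have "orthogonal_sum P = (\<Inter>n. (\<lambda>h. ell2_nth h n) -` P n)"
      by (auto simp: orthogonal_sum_def)
    moreover have "closed ((\<lambda>h. ell2_nth h n) -` P n)" for n
      by (rule closed_vimage[OF closed_csubspaceD(1)[OF P]
            bounded_clinear_continuous[OF ell2_nth_bounded_clinear]])
    ultimately show ?thesis by auto
  qed
  moreover have "r *\<^sub>R x \<in> P n" if "x \<in> P n" for r x n
    using closed_csubspaceD(2)[OF P] that by (rule subspace_scale)
  ultimately show ?thesis
    unfolding closed_csubspace_def subspace_def
    by (auto simp: orthogonal_sum_def zero_ell2.rep_eq plus_ell2.rep_eq scaleC_ell2.rep_eq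
        scaleR_ell2.rep_eq closed_csubspaceD(3,4,6)[OF P])
qed

lemma summable_norm_square_le:
  assumes "\<And>n. norm (f n) \<le> norm (ell2_nth h n)"
  shows "summable (\<lambda>n. (norm (f n))\<^sup>2)"
  by (rule summable_comparison_test'[OF summable_ell2_nth[of h], of 0])
    (simp add: assms power_mono)

lemma ell2_nth_map:
  assumes "\<And>n x. norm (A n x) \<le> norm x"
  shows "ell2_nth (ell2_map A h) n = A n (ell2_nth h n)"
  unfolding ell2_map_def by (subst ell2_nth_Abs) (auto intro: summable_norm_square_le assms)

lemma unitary_between_ell2_map:
  assumes A: "\<And>n. unitary_between (P n) (Q n) (A n)" and le: "\<And>n x. norm (A n x) \<le> norm x"
  shows "unitary_between (orthogonal_sum P) (orthogonal_sum Q) (ell2_map A)"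
proof (rule unitary_betweenI)
  note A' = unitary_betweenD[OF A] and nth = ell2_nth_map[of A, OF le]
  show "bounded_clinear (ell2_map A)"
  proof (rule bounded_clinearI[where K = 1])
    show "ell2_map A (x + y) = ell2_map A x + ell2_map A y" for x y
      by (rule ell2_eqI) (simp add: nth plus_ell2.rep_eq bounded_clinear_add[OF A'(1)])
    show "ell2_map A (c *\<^sub>C x) = c *\<^sub>C ell2_map A x" for c x
      by (rule ell2_eqI) (simp add: nth scaleC_ell2.rep_eq bounded_clinear_scaleC[OF A'(1)])
    have "(norm (ell2_map A x))\<^sup>2 \<le> (norm x)\<^sup>2" for x
      unfolding norm_ell2_square
      by (intro suminf_le summable_ell2_nth) (simp add: nth le power_mono)
    then show "norm (ell2_map A x) \<le> 1 * norm x" for x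
      using power2_le_imp_le[OF _ norm_ge_zero] by simp
  qed
  show "norm (ell2_map A x) = norm x" if "x \<in> orthogonal_sum P" for x
  proof -
    have "(norm (ell2_map A x))\<^sup>2 = (norm x)\<^sup>2"
      using that unfolding norm_ell2_square by (simp add: nth orthogonal_sum_def A'(2))
    then show ?thesis by simp
  qed
  show "ell2_map A x \<in> orthogonal_sum Q" if "x \<in> orthogonal_sum P" for x
    using that A'(3) by (auto simp: orthogonal_sum_def nth)
  fix y assume y: "y \<in> orthogonal_sum Q"
  then have "\<exists>x\<in>P n. A n x = ell2_nth y n" for n
    by (intro A'(4)) (simp add: orthogonal_sum_def)
  then obtain x where x: "\<And>n. x n \<in> P n" "\<And>n. A n (x n) = ell2_nth y n"
    by metis
  have "norm (x n) \<le> norm (ell2_nth y n)" for n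
    using A'(2)[OF x(1)[of n]] by (simp add: x(2))
  then have "ell2_nth (Abs_ell2 x) = x"
    by (intro ell2_nth_Abs summable_norm_square_le)
  then show "\<exists>x\<in>orthogonal_sum P. ell2_map A x = y"
    using x by (intro bexI[of _ "Abs_ell2 x"] ell2_eqI) (auto simp: nth orthogonal_sum_def)
qed

lemma norm_fst_le_norm: "norm (fst p) \<le> norm p" and norm_snd_le_norm: "norm (snd p) \<le> norm p"
  by (metis norm_fst_le prod.collapse, metis norm_snd_le prod.collapse)

lemma summable_components:
  shows "summable (\<lambda>n. (norm (fst (ell2_nth h n)))\<^sup>2)" "summable (\<lambda>n. (norm (snd (ell2_nth h n)))\<^sup>2)"
  by (auto intro!: summable_norm_square_le[where h = h] norm_fst_le_norm norm_snd_le_norm)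

lemma regroup_summable:
  "summable (\<lambda>n. (norm (case n of 0 \<Rightarrow> f | Suc m \<Rightarrow> snd (ell2_nth h m)))\<^sup>2)"
  using summable_components(2)[of h] by (subst summable_Suc_iff[symmetric]) simp

lemma ell2_nth_regroup:
  "ell2_nth (regroup (f, h)) n =
    (case n of 0 \<Rightarrow> f | Suc m \<Rightarrow> snd (ell2_nth h m), fst (ell2_nth h n))"
  unfolding regroup_def prod.case
  by (subst ell2_nth_Abs)
    (simp_all add: norm_Pair_square summable_add[OF regroup_summable summable_components(1)])

lemma norm_regroup: "norm (regroup p) = norm p"
proof -
  obtain f h where p: "p = (f, h)" by (cases p)
  have "(norm (regroup p))\<^sup>2 = (\<Sum>n. (norm (case n of 0 \<Rightarrow> f | Suc m \<Rightarrow> snd (ell2_nth h m)))\<^sup>2)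
      + (\<Sum>n. (norm (fst (ell2_nth h n)))\<^sup>2)"
    unfolding norm_ell2_square p ell2_nth_regroup norm_Pair_square
    by (rule suminf_add[symmetric, OF regroup_summable summable_components(1)])
  also have "\<dots> = (norm f)\<^sup>2 + ((\<Sum>n. (norm (fst (ell2_nth h n)))\<^sup>2) + (\<Sum>n. (norm (snd (ell2_nth h n)))\<^sup>2))"
    using suminf_split_head[OF regroup_summable[of f h]] by simp
  also have "\<dots> = (norm p)\<^sup>2"
    unfolding p norm_Pair_square norm_ell2_square[of h]
    by (simp add: suminf_add[OF summable_components] flip: norm_Pair_square)
  finally show ?thesis by simp
qed

lemma ungroup_summable: "summable (\<lambda>n. (norm (snd (ell2_nth k n), fst (ell2_nth k (Suc n))))\<^sup>2)"
  unfolding norm_Pair_square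
  using summable_components(1)[of k, THEN summable_Suc_iff[THEN iffD2]]
  by (rule summable_add[OF summable_components(2)])

lemma fst_ungroup: "fst (ungroup k) = fst (ell2_nth k 0)"
  and ell2_nth_snd_ungroup:
    "ell2_nth (snd (ungroup k)) n = (snd (ell2_nth k n), fst (ell2_nth k (Suc n)))"
  by (simp_all add: ungroup_def ell2_nth_Abs[OF ungroup_summable])

lemma regroup_ungroup: "regroup (ungroup k) = k"
proof (rule ell2_eqI)
  fix n
  have "ungroup k = (fst (ell2_nth k 0), snd (ungroup k))" by (simp add: prod_eq_iff fst_ungroup)
  then show "ell2_nth (regroup (ungroup k)) n = ell2_nth k n"
    by (metis (no_types, lifting) ell2_nth_regroup ell2_nth_snd_ungroup fst_conv snd_conv
        nat.case nat.exhaust prod.collapse)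
qed

lemma ungroup_regroup: "ungroup (regroup p) = p"
proof -
  obtain f h where p: "p = (f, h)" by (cases p)
  have "snd (ungroup (regroup p)) = h"
    by (rule ell2_eqI) (simp add: p ell2_nth_snd_ungroup ell2_nth_regroup)
  then show ?thesis by (simp add: prod_eq_iff fst_ungroup p ell2_nth_regroup)
qed

lemma regroup_bounded_clinear: "bounded_clinear regroup"
proof (rule bounded_clinearI[where K = 1])
  show "regroup (x + y) = regroup x + regroup y" for x y :: "'a \<times> ('b \<times> 'a) ell2"
    by (rule ell2_eqI, cases x, cases y)
      (simp add: ell2_nth_regroup plus_ell2.rep_eq split: nat.split)
  show "regroup (c *\<^sub>C x) = c *\<^sub>C regroup x" for c and x :: "'a \<times> ('b \<times> 'a) ell2"
    by (rule ell2_eqI, cases x)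
      (simp add: ell2_nth_regroup scaleC_ell2.rep_eq scaleC_prod_def split: nat.split)
qed (simp add: norm_regroup)

lemma ungroup_bounded_clinear: "bounded_clinear ungroup"
proof (rule bounded_clinearI[where K = 1])
  show "ungroup (x + y) = ungroup x + ungroup y" for x y :: "('a \<times> 'b) ell2"
    by (metis bounded_clinear_add[OF regroup_bounded_clinear] regroup_ungroup ungroup_regroup)
  show "ungroup (c *\<^sub>C x) = c *\<^sub>C ungroup x" for c and x :: "('a \<times> 'b) ell2"
    by (metis bounded_clinear_scaleC[OF regroup_bounded_clinear] regroup_ungroup ungroup_regroup)
  show "norm (ungroup x) \<le> 1 * norm x" for x :: "('a \<times> 'b) ell2"
    using norm_regroup[of "ungroup x"] by (simp add: regroup_ungroup)
qed

text \<open>Regrouping only moves the brackets, so it matches the orthogonal sums with the brackets moved.\<close>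

lemma regroup_in_iff:
  "regroup p \<in> orthogonal_sum (\<lambda>n. X n \<times> Y n) \<longleftrightarrow>
    p \<in> X 0 \<times> orthogonal_sum (\<lambda>n. Y n \<times> X (Suc n))"
proof -
  obtain f h where p: "p = (f, h)" by (cases p)
  have "(\<forall>n. (case n of 0 \<Rightarrow> f | Suc m \<Rightarrow> snd (ell2_nth h m)) \<in> X n) \<longleftrightarrow>
      f \<in> X 0 \<and> (\<forall>n. snd (ell2_nth h n) \<in> X (Suc n))"
    by (metis (no_types, lifting) nat.case nat.exhaust)
  then show ?thesis
    by (auto simp: p orthogonal_sum_def ell2_nth_regroup mem_Times_iff)
qed

lemma unitary_between_regroup:
  "unitary_between (X 0 \<times> orthogonal_sum (\<lambda>n. Y n \<times> X (Suc n)))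
    (orthogonal_sum (\<lambda>n. X n \<times> Y n)) regroup"
proof (rule unitary_betweenI[OF regroup_bounded_clinear norm_regroup])
  fix y assume "y \<in> orthogonal_sum (\<lambda>n. X n \<times> Y n)"
  then show "\<exists>x\<in>X 0 \<times> orthogonal_sum (\<lambda>n. Y n \<times> X (Suc n)). regroup x = y"
    by (intro bexI[of _ "ungroup y"]) (simp_all add: regroup_ungroup flip: regroup_in_iff)
qed (simp add: regroup_in_iff)

lemma unitary_between_ungroup:
  "unitary_between (orthogonal_sum (\<lambda>n. X n \<times> Y n))
    (X 0 \<times> orthogonal_sum (\<lambda>n. Y n \<times> X (Suc n))) ungroup"
proof (rule unitary_betweenI[OF ungroup_bounded_clinear])
  show "norm (ungroup k) = norm k" for k :: "('a \<times> 'b) ell2"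
    using norm_regroup[of "ungroup k"] by (simp add: regroup_ungroup)
  show "ungroup k \<in> X 0 \<times> orthogonal_sum (\<lambda>n. Y n \<times> X (Suc n))"
    if "k \<in> orthogonal_sum (\<lambda>n. X n \<times> Y n)" for k
    using that by (simp add: regroup_ungroup flip: regroup_in_iff)
  fix y assume "y \<in> X 0 \<times> orthogonal_sum (\<lambda>n. Y n \<times> X (Suc n))"
  then show "\<exists>k\<in>orthogonal_sum (\<lambda>n. X n \<times> Y n). ungroup k = y"
    by (intro bexI[of _ "regroup y"]) (simp_all add: ungroup_regroup regroup_in_iff)
qed

section \<open>Choice sequences and their CMV colligations\<close>

locale choice_sequence =
  fixes \<Gamma> :: "nat \<Rightarrow> 'a::chilbert_space \<Rightarrow> 'b::chilbert_space"
  assumes contr: "\<Gamma> n \<in> contractions (dom_space \<Gamma> n) (cod_space \<Gamma> n)"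
begin

lemma spaces_closed: "closed_csubspace (dom_space \<Gamma> n) \<and> closed_csubspace (cod_space \<Gamma> n)"
proof (induction n)
  case (Suc n)
  then interpret contraction "dom_space \<Gamma> n" "cod_space \<Gamma> n" "\<Gamma> n"
    using contr by unfold_locales auto
  show ?case
    using defect_space_closed contraction.defect_space_closed[OF cadjoint_contraction] by simp
qed simp

lemmas dom_closed = spaces_closed[THEN conjunct1] and cod_closed = spaces_closed[THEN conjunct2]

lemma contraction: "contraction (dom_space \<Gamma> n) (cod_space \<Gamma> n) (\<Gamma> n)"
  using spaces_closed contr by unfold_locales auto

lemma dom_cadjoint: "dom_space (\<lambda>n. cadjoint (\<Gamma> n)) n = cod_space \<Gamma> n"
  and cod_cadjoint: "cod_space (\<lambda>n. cadjoint (\<Gamma> n)) n = dom_space \<Gamma> n"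
proof (induction n)
  case (Suc n)
  { case 1 show ?case using Suc by simp }
  { case 2 show ?case using Suc by (simp add: contraction.cadjoint_invol[OF contraction]) }
qed simp_all

lemma cadjoint_choice_sequence: "choice_sequence (\<lambda>n. cadjoint (\<Gamma> n))"
  using contraction.A[OF contraction.cadjoint_contraction[OF contraction]]
  by unfold_locales (simp add: dom_cadjoint cod_cadjoint)

lemma J_rot_le: "norm (J_rot \<Gamma> n p) \<le> norm p"
  unfolding J_rot_def by (rule contraction.rotation_le[OF contraction])

lemma J_rot_zero_left:
  assumes "y \<in> cod_space \<Gamma> (Suc n)" "fst (J_rot \<Gamma> n (0, y)) = 0"
  shows "y = 0"
  using assms contraction.rotation_zero[OF contraction, of y n] by (simp add: J_rot_def)

lemma J_rot_zero: "J_rot \<Gamma> n 0 = 0"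
  unfolding J_rot_def by (rule bounded_clinear_zero[OF contraction.rotation_bounded_clinear[OF contraction]])

lemma J_rot_cadjoint:
  assumes "p \<in> dom_space \<Gamma> n \<times> cod_space \<Gamma> (Suc n)"
  shows "J_rot (\<lambda>n. cadjoint (\<Gamma> n)) n (J_rot \<Gamma> n p) = p"
  using contraction.rotation_inverse[OF contraction, of p n] assms
  by (simp add: J_rot_def dom_cadjoint cod_cadjoint)

lemma J_rot_unitary:
  "unitary_between (dom_space \<Gamma> n \<times> cod_space \<Gamma> (Suc n)) (cod_space \<Gamma> n \<times> dom_space \<Gamma> (Suc n)) (J_rot \<Gamma> n)"
proof -
  interpret contraction "dom_space \<Gamma> n" "cod_space \<Gamma> n" "\<Gamma> n" by (rule contraction)
  interpret adj: contraction "cod_space \<Gamma> n" "dom_space \<Gamma> n" "cadjoint (\<Gamma> n)"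
    by (rule cadjoint_contraction)
  show ?thesis
    unfolding J_rot_def dom_space.simps cod_space.simps
  proof (rule unitary_betweenI[OF rotation_bounded_clinear rotation_isometric rotation_in])
    fix q assume "q \<in> cod_space \<Gamma> n \<times> defect_space (dom_space \<Gamma> n) (\<Gamma> n)"
    then show "\<exists>p\<in>dom_space \<Gamma> n \<times> defect_space (cod_space \<Gamma> n) (cadjoint (\<Gamma> n)).
        rotation (dom_space \<Gamma> n) (cod_space \<Gamma> n) (\<Gamma> n) p = q"
      using adj.rotation_inverse[of q] adj.rotation_in[of q]
      by (intro bexI[of _ "rotation (cod_space \<Gamma> n) (dom_space \<Gamma> n) (cadjoint (\<Gamma> n)) q"])
        (simp_all add: cadjoint_invol)
  qed
qed

lemma H0_space_sum: "H0_space \<Gamma> =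
    orthogonal_sum (\<lambda>n. dom_space \<Gamma> (Suc (2 * n)) \<times> cod_space \<Gamma> (Suc (Suc (2 * n))))"
  by (simp add: H0_space_def orthogonal_sum_def)

lemma H0t_space_sum: "H0t_space \<Gamma> =
    orthogonal_sum (\<lambda>n. cod_space \<Gamma> (Suc (2 * n)) \<times> dom_space \<Gamma> (Suc (Suc (2 * n))))"
  by (simp add: H0t_space_def orthogonal_sum_def)

lemma H0_space_closed: "closed_csubspace (H0_space \<Gamma>)"
  unfolding H0_space_sum
  by (intro closed_csubspace_orthogonal_sum closed_csubspace_Times dom_closed cod_closed)

lemma H0t_space_closed: "closed_csubspace (H0t_space \<Gamma>)"
  unfolding H0t_space_sum
  by (intro closed_csubspace_orthogonal_sum closed_csubspace_Times dom_closed cod_closed)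

lemma V0_unitary: "unitary_between (H0_space \<Gamma>) (H0t_space \<Gamma>) (V0 \<Gamma>)"
  unfolding V0_def H0_space_sum H0t_space_sum Suc_eq_plus1[symmetric]
  by (intro unitary_between_ell2_map J_rot_unitary J_rot_le)

lemma L0_unitary: "unitary_between (UNIV \<times> H0t_space \<Gamma>) (UNIV \<times> H0_space \<Gamma>) (L0 \<Gamma>)"
proof -
  have regroup: "unitary_between (UNIV \<times> H0t_space \<Gamma>)
      (orthogonal_sum (\<lambda>n. dom_space \<Gamma> (2 * n) \<times> cod_space \<Gamma> (Suc (2 * n)))) regroup"
    using unitary_between_regroup[of "\<lambda>n. dom_space \<Gamma> (2 * n)" "\<lambda>n. cod_space \<Gamma> (Suc (2 * n))"]
    by (simp add: H0t_space_sum)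
  have rotate: "unitary_between (orthogonal_sum (\<lambda>n. dom_space \<Gamma> (2 * n) \<times> cod_space \<Gamma> (Suc (2 * n))))
      (orthogonal_sum (\<lambda>n. cod_space \<Gamma> (2 * n) \<times> dom_space \<Gamma> (Suc (2 * n)))) (ell2_map (\<lambda>n. J_rot \<Gamma> (2 * n)))"
    by (intro unitary_between_ell2_map J_rot_unitary J_rot_le)
  have ungroup: "unitary_between (orthogonal_sum (\<lambda>n. cod_space \<Gamma> (2 * n) \<times> dom_space \<Gamma> (Suc (2 * n))))
      (UNIV \<times> H0_space \<Gamma>) ungroup"
    using unitary_between_ungroup[of "\<lambda>n. cod_space \<Gamma> (2 * n)" "\<lambda>n. dom_space \<Gamma> (Suc (2 * n))"]
    by (simp add: H0_space_sum)
  show ?thesis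
    unfolding L0_def by (rule unitary_between_comp[OF regroup unitary_between_comp[OF rotate ungroup]])
qed

lemma U0_unitary: "unitary_between (UNIV \<times> H0_space \<Gamma>) (UNIV \<times> H0_space \<Gamma>) (U0 \<Gamma>)"
  unfolding U0_def
  by (rule unitary_between_comp[OF unitary_between_map_prod_id[OF V0_unitary] L0_unitary])

lemma U0t_unitary: "unitary_between (UNIV \<times> H0t_space \<Gamma>) (UNIV \<times> H0t_space \<Gamma>) (U0t \<Gamma>)"
  unfolding U0t_def
  by (rule unitary_between_comp[OF L0_unitary unitary_between_map_prod_id[OF V0_unitary]])

sublocale U0: unitary_colligation "H0_space \<Gamma>" "U0 \<Gamma>"
  using U0_unitary H0_space_closed by unfold_locales (auto simp: unitary_between_def)

sublocale U0t: unitary_colligation "H0t_space \<Gamma>" "U0t \<Gamma>"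
  using U0t_unitary H0t_space_closed by unfold_locales (auto simp: unitary_between_def)

lemma T0_main_op: "T0 \<Gamma> = U0.main_op" and T0t_main_op: "T0t \<Gamma> = U0t.main_op"
  by (simp_all add: fun_eq_iff T0_def T0t_def U0.main_op_def U0t.main_op_def)

lemma U0_eq:
  "U0 \<Gamma> (f, h) = ungroup (ell2_map (\<lambda>n. J_rot \<Gamma> (2 * n)) (regroup (f, V0 \<Gamma> h)))"
  by (simp add: U0_def L0_def)

lemma V0_nth: "ell2_nth (V0 \<Gamma> h) n = J_rot \<Gamma> (Suc (2 * n)) (ell2_nth h n)"
  by (simp add: V0_def ell2_nth_map[OF J_rot_le])

text \<open>Entry by entry, elements of \<open>K\<close> vanish: once all entries before the \<open>n\<close>-th are zero, each of
  the two rotations that touch the \<open>n\<close>-th entry receives \<open>0\<close> in its first slot and returns \<open>0\<close> in its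
  first slot, so the defect operator in its upper right corner annihilates the second slot; on the
  defect space that operator is injective.\<close>

lemma U0_no_unitary_part:
  assumes K: "K \<subseteq> H0_space \<Gamma>" and UK: "U0 \<Gamma> ` ({0} \<times> K) = {0} \<times> K"
  shows "K \<subseteq> {0}"
proof -
  have "\<forall>g\<in>K. \<forall>j<n. ell2_nth g j = 0" for n
  proof (induction n)
    case (Suc n)
    \<comment> \<open>A vector of \<open>K\<close> both has an image in \<open>K\<close> and is one; \<open>step\<close> uses the former for the entry of
      \<open>V0 \<Gamma> g\<close> and the latter for that of \<open>g\<close>.\<close>
    have V_low: "ell2_nth (V0 \<Gamma> g) j = 0" if "g \<in> K" "j < n" for g j
      using Suc that by (simp add: V0_nth J_rot_zero)
    have step: "fst (ell2_nth (V0 \<Gamma> g) n) = 0 \<and> fst (ell2_nth g' n) = 0"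
      if g: "g \<in> K" and g': "g' \<in> K" and eq: "U0 \<Gamma> (0, g) = (0, g')" for g g'
    proof -
      define k where "k = ell2_map (\<lambda>n. J_rot \<Gamma> (2 * n)) (regroup (0, V0 \<Gamma> g))"
      have k: "ungroup k = (0, g')" using eq by (simp add: U0_eq k_def)
      have k_nth: "ell2_nth k n = J_rot \<Gamma> (2 * n) (0, fst (ell2_nth (V0 \<Gamma> g) n))"
        using V_low[OF g] by (simp add: k_def ell2_nth_map[OF J_rot_le] ell2_nth_regroup split: nat.split)
      have "fst (ell2_nth k n) = 0"
      proof (cases n)
        case 0
        then show ?thesis using fst_ungroup[of k] by (simp add: k)
      next
        case (Suc m)
        then have "ell2_nth g' m = 0" using \<open>\<forall>g\<in>K. \<forall>j<n. ell2_nth g j = 0\<close> g' by simp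
        then show ?thesis using ell2_nth_snd_ungroup[of k m] by (simp add: k Suc prod_eq_iff)
      qed
      moreover have "fst (ell2_nth (V0 \<Gamma> g) n) \<in> cod_space \<Gamma> (Suc (2 * n))"
      proof -
        have "V0 \<Gamma> g \<in> H0t_space \<Gamma>"
          using g K by (intro unitary_betweenD(3)[OF V0_unitary]) blast
        then show ?thesis by (simp add: H0t_space_sum orthogonal_sum_def mem_Times_iff)
      qed
      ultimately have 0: "fst (ell2_nth (V0 \<Gamma> g) n) = 0"
        using J_rot_zero_left[of "fst (ell2_nth (V0 \<Gamma> g) n)" "2 * n"] by (simp add: k_nth)
      then have "ell2_nth k n = 0" by (simp add: k_nth J_rot_zero flip: zero_prod_def)
      then have "fst (ell2_nth g' n) = 0"
        using ell2_nth_snd_ungroup[of k n] by (simp add: k)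
      with 0 show ?thesis ..
    qed
    have "ell2_nth g n = 0" if g: "g \<in> K" for g
    proof -
      have "U0 \<Gamma> (0, g) \<in> {0} \<times> K" using g UK by blast
      then obtain g1 where g1: "g1 \<in> K" "U0 \<Gamma> (0, g) = (0, g1)" by blast
      have "(0, g) \<in> U0 \<Gamma> ` ({0} \<times> K)" using g UK by blast
      then obtain g2 where g2: "g2 \<in> K" "U0 \<Gamma> (0, g2) = (0, g)" by auto
      have 1: "fst (ell2_nth (V0 \<Gamma> g) n) = 0" using step[OF g g1] by blast
      have 2: "fst (ell2_nth g n) = 0" using step[OF g2(1) g g2(2)] by blast
      have "snd (ell2_nth g n) = 0"
      proof (rule J_rot_zero_left)
        show "snd (ell2_nth g n) \<in> cod_space \<Gamma> (Suc (Suc (2 * n)))"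
          using subsetD[OF K g] by (simp add: H0_space_sum orthogonal_sum_def mem_Times_iff)
        have "(0, snd (ell2_nth g n)) = ell2_nth g n" using 2 by (simp add: prod_eq_iff)
        then show "fst (J_rot \<Gamma> (Suc (2 * n)) (0, snd (ell2_nth g n))) = 0"
          using 1 by (simp add: V0_nth)
      qed
      with 2 show ?thesis by (simp add: prod_eq_iff)
    qed
    with Suc show ?case by (simp add: less_Suc_eq)
  qed simp
  then have "g = 0" if "g \<in> K" for g
    using that by (intro ell2_eqI) (auto simp: zero_ell2.rep_eq)
  then show ?thesis by blast
qed

text \<open>The colligations \<open>U0\<close> and \<open>U0t\<close> are \<open>L (I \<oplus> V)\<close> and \<open>(I \<oplus> V) L\<close>, so \<open>I \<oplus> V\<close> conjugates the
  first into the second.\<close>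

lemma U0t_conjugate: "U0 \<Gamma> (f, h) = (f', h') \<Longrightarrow> U0t \<Gamma> (f, V0 \<Gamma> h) = (f', V0 \<Gamma> h')"
  by (simp add: U0_def U0t_def)

lemma U0t_no_unitary_part:
  assumes K: "K \<subseteq> H0t_space \<Gamma>" and UK: "U0t \<Gamma> ` ({0} \<times> K) = {0} \<times> K"
  shows "K \<subseteq> {0}"
proof -
  note V = unitary_betweenD[OF V0_unitary]
  define K' where "K' = {h \<in> H0_space \<Gamma>. V0 \<Gamma> h \<in> K}"
  have pre: "\<exists>h\<in>K'. V0 \<Gamma> h = g" if "g \<in> K" for g
    using V(4)[of g] that K by (auto simp: K'_def)
  have "U0 \<Gamma> ` ({0} \<times> K') = {0} \<times> K'"
  proof (intro equalityI subsetI)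
    fix p assume "p \<in> U0 \<Gamma> ` ({0} \<times> K')"
    then obtain h where h: "h \<in> K'" and p: "p = U0 \<Gamma> (0, h)" by auto
    obtain f h' where fh': "p = (f, h')" by (cases p)
    have "h' \<in> H0_space \<Gamma>"
      using U0.U_in[of "(0, h)"] h by (simp add: K'_def flip: p) (simp add: fh')
    moreover have "U0t \<Gamma> (0, V0 \<Gamma> h) = (f, V0 \<Gamma> h')"
      by (rule U0t_conjugate) (simp flip: p fh')
    moreover have "U0t \<Gamma> (0, V0 \<Gamma> h) \<in> {0} \<times> K"
      using h UK by (auto simp: K'_def)
    ultimately show "p \<in> {0} \<times> K'" by (simp add: fh' K'_def)
  next
    fix p :: "'b \<times> ('a \<times> 'b) ell2" assume "p \<in> {0} \<times> K'"
    then obtain k where k: "k \<in> K'" and p: "p = (0, k)" by auto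
    have "(0, V0 \<Gamma> k) \<in> U0t \<Gamma> ` ({0} \<times> K)" using k UK by (simp add: K'_def)
    then obtain g where g: "g \<in> K" "U0t \<Gamma> (0, g) = (0, V0 \<Gamma> k)" by auto
    obtain h where h: "h \<in> K'" "V0 \<Gamma> h = g" using pre g(1) by blast
    obtain f h' where fh': "U0 \<Gamma> (0, h) = (f, h')" by (cases "U0 \<Gamma> (0, h)")
    then have f: "f = 0" "V0 \<Gamma> h' = V0 \<Gamma> k"
      using U0t_conjugate[OF fh'] g h by auto
    have "h' \<in> H0_space \<Gamma>" using U0.U_in[of "(0, h)"] h(1) by (simp add: K'_def fh')
    then have "norm (V0 \<Gamma> (h' - k)) = norm (h' - k)"
      using k by (intro V(2) closed_csubspaceD(5)[OF H0_space_closed]) (auto simp: K'_def)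
    then have "h' = k" by (simp add: bounded_clinear_diff[OF V(1)] f)
    then have "U0 \<Gamma> (0, h) = p" by (simp add: p fh' f)
    then show "p \<in> U0 \<Gamma> ` ({0} \<times> K')" using h(1) by force
  qed
  then have "K' \<subseteq> {0}" by (intro U0_no_unitary_part) (auto simp: K'_def)
  then show ?thesis using pre bounded_clinear_zero[OF V(1)] by force
qed

end

section \<open>The Schur algorithm as a trajectory of the colligation\<close>

lemma schur_parameters_choice_sequence:
  assumes "schur_parameters \<Theta> \<Gamma>"
  shows "choice_sequence \<Gamma>"
proof
  fix n
  obtain \<Theta>s where "\<Theta>s n \<in> schur_class (dom_space \<Gamma> n) (cod_space \<Gamma> n)" "\<Gamma> n = \<Theta>s n 0"
    using assms unfolding schur_parameters_def by blast
  then show "\<Gamma> n \<in> contractions (dom_space \<Gamma> n) (cod_space \<Gamma> n)"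
    by (simp add: schur_class_def)
qed

text \<open>The inverse in the recursion of the Schur algorithm computes \<open>u\<^bsub>n+1\<^esub>\<close> from \<open>u\<^sub>n\<close>, as the solution of
  \<open>u\<^bsub>n+1\<^esub> + z \<Gamma>\<^sub>n\<^sup>* \<Theta>\<^bsub>n+1\<^esub>(z) u\<^bsub>n+1\<^esub> = D\<^bsub>\<Gamma>\<^sub>n\<^esub> u\<^sub>n\<close>. This is the second row of the rotation of
  \<open>\<Gamma>\<^sub>n\<close>, and the recursion itself is the first.\<close>

lemma schur_trajectory:
  assumes "schur_parameters \<Theta> \<Gamma>" and z: "norm z < 1"
  obtains u v where "u 0 = m" "v 0 = \<Theta> z m"
    and "\<And>n. J_rot \<Gamma> n (u n, z *\<^sub>C v (Suc n)) = (v n, u (Suc n))"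
    and "\<And>n. u n \<in> dom_space \<Gamma> n" "\<And>n. v n \<in> cod_space \<Gamma> n"
    and "\<And>n. norm (v n) \<le> norm (u n)"
proof -
  interpret choice_sequence \<Gamma> using assms(1) by (rule schur_parameters_choice_sequence)
  let ?D = "dom_space \<Gamma>" and ?C = "cod_space \<Gamma>"
  obtain \<Theta>s where \<Theta>0: "\<Theta>s 0 = \<Theta>" and S: "\<And>n. \<Theta>s n \<in> schur_class (?D n) (?C n)"
    and rec: "\<And>n. \<Theta>s n z = (\<lambda>x. \<Gamma> n x +
          z *\<^sub>C defect_op (?C n) (cadjoint (\<Gamma> n)) (\<Theta>s (Suc n) z
            (op_inverse (?D (Suc n))
               (\<lambda>y. proj (?D (Suc n)) y + z *\<^sub>C cadjoint (\<Gamma> n) (\<Theta>s (Suc n) z y))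
               (defect_op (?D n) (\<Gamma> n) x))))"
    using assms unfolding schur_parameters_def by blast
  have con: "\<Theta>s n z \<in> contractions (?D n) (?C n)" for n
    using S[of n] z by (simp add: schur_class_def)
  define u where "u = rec_nat m (\<lambda>n x. op_inverse (?D (Suc n))
               (\<lambda>y. proj (?D (Suc n)) y + z *\<^sub>C cadjoint (\<Gamma> n) (\<Theta>s (Suc n) z y))
               (defect_op (?D n) (\<Gamma> n) x))"
  define v where "v n = \<Theta>s n z (u n)" for n
  have u0: "u 0 = m" by (simp add: u_def)
  have u_Suc: "u (Suc n) = op_inverse (?D (Suc n))
               (\<lambda>y. proj (?D (Suc n)) y + z *\<^sub>C cadjoint (\<Gamma> n) (\<Theta>s (Suc n) z y))
               (defect_op (?D n) (\<Gamma> n) (u n))" for n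
    by (simp add: u_def)
  have solve: "u (Suc n) \<in> ?D (Suc n)
      \<and> u (Suc n) + z *\<^sub>C cadjoint (\<Gamma> n) (v (Suc n)) = defect_op (?D n) (\<Gamma> n) (u n)" for n
  proof -
    interpret c: contraction "?D n" "?C n" "\<Gamma> n" by (rule contraction)
    interpret t: contraction "?D (Suc n)" "?C (Suc n)" "\<Theta>s (Suc n) z"
      using con dom_closed cod_closed by unfold_locales
    \<comment> \<open>The inverse exists because \<open>F\<close> is a contraction of the defect space and \<open>norm z < 1\<close>.\<close>
    define F where "F y = cadjoint (\<Gamma> n) (\<Theta>s (Suc n) z y)" for y
    have F_in: "F y \<in> ?D (Suc n)" for y
      using contraction.maps_defect_space[OF c.cadjoint_contraction, of "\<Theta>s (Suc n) z y"] t.A_in[of y]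
      by (simp add: F_def c.cadjoint_invol)
    have F_lin: "bounded_clinear F"
      unfolding F_def by (rule bounded_clinear_compose[OF c.adj_bounded_clinear t.A_bounded_clinear])
    have F_con: "F \<in> contractions (?D (Suc n)) (?D (Suc n))"
      unfolding contractions_def bop_iff[OF dom_closed]
    proof (intro CollectI conjI allI F_lin)
      show "range F \<subseteq> ?D (Suc n)" using F_in by blast
      show "F (proj (?D (Suc n)) x) = F x" for x unfolding F_def t.A_proj ..
      show "norm (F x) \<le> norm x" for x
        unfolding F_def by (rule order_trans[OF c.adj_le t.A_le])
    qed
    have neg: "- ((-z) *\<^sub>C x) = z *\<^sub>C x" for x :: 'a
      using scaleC_add_left[of "-z" z x] by (simp add: neg_eq_iff_add_eq_0)
    have eq: "(\<lambda>y. proj (?D (Suc n)) y + z *\<^sub>C cadjoint (\<Gamma> n) (\<Theta>s (Suc n) z y))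
        = (\<lambda>y. proj (?D (Suc n)) y - (-z) *\<^sub>C F y)"
      by (simp add: F_def fun_eq_iff diff_conv_add_uminus neg del: add_uminus_conv_diff)
    have "u (Suc n) \<in> ?D (Suc n) \<and> u (Suc n) - (-z) *\<^sub>C F (u (Suc n)) = defect_op (?D n) (\<Gamma> n) (u n)"
    proof (rule op_inverse_id_minus(2)[OF dom_closed F_con])
      show "u (Suc n) = op_inverse (?D (Suc n)) (\<lambda>y. proj (?D (Suc n)) y - (-z) *\<^sub>C F y)
          (defect_op (?D n) (\<Gamma> n) (u n))"
        unfolding u_Suc[of n] eq ..
    qed (use z c.defect_in_space in simp_all)
    then show ?thesis
      by (simp add: F_def v_def diff_conv_add_uminus neg del: add_uminus_conv_diff)
  qed
  have u_in: "u n \<in> ?D n" for n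
    using solve by (cases n) auto
  have v_in: "v n \<in> ?C n" and v_le: "norm (v n) \<le> norm (u n)" for n
    using contractionsD[OF con dom_closed] by (auto simp: v_def)
  have v_eq: "v n = \<Gamma> n (u n) + z *\<^sub>C defect_op (?C n) (cadjoint (\<Gamma> n)) (v (Suc n))" for n
    unfolding v_def u_Suc[of n] by (rule fun_cong[OF rec])
  have J: "J_rot \<Gamma> n (u n, z *\<^sub>C v (Suc n)) = (v n, u (Suc n))" for n
  proof -
    interpret c: contraction "?D n" "?C n" "\<Gamma> n" by (rule contraction)
    interpret a: contraction "?C n" "?D n" "cadjoint (\<Gamma> n)" by (rule c.cadjoint_contraction)
    have "z *\<^sub>C v (Suc n) \<in> defect_space (?C n) (cadjoint (\<Gamma> n))"
      using v_in[of "Suc n"] closed_csubspaceD(6)[OF a.defect_space_closed] by simp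
    then have "J_rot \<Gamma> n (u n, z *\<^sub>C v (Suc n)) =
       (\<Gamma> n (u n) + z *\<^sub>C defect_op (?C n) (cadjoint (\<Gamma> n)) (v (Suc n)),
        defect_op (?D n) (\<Gamma> n) (u n) - z *\<^sub>C cadjoint (\<Gamma> n) (v (Suc n)))"
      by (simp add: J_rot_def c.rotation_eq a.defect_space_closed
          bounded_clinear_scaleC[OF a.A_bounded_clinear] bounded_clinear_scaleC[OF a.defect_bounded_clinear])
    also have "\<dots> = (v n, u (Suc n))"
      using solve[of n] v_eq[of n] by (simp add: algebra_simps)
    finally show ?thesis .
  qed
  have "v 0 = \<Theta> z m" by (simp add: v_def u0 \<Theta>0)
  from that[OF u0 this J u_in v_in v_le] show ?thesis .
qed

text \<open>The trajectory does not decay by itself, but it is bounded: each rotation is isometric, so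
  \<open>\<parallel>u\<^sub>n\<parallel>\<^sup>2 - \<parallel>v\<^sub>n\<parallel>\<^sup>2\<close> never increases, and \<open>(1 - |z|\<^sup>2) \<parallel>u\<^bsub>n+1\<^esub>\<parallel>\<^sup>2\<close> is at most the previous difference.
  The weights \<open>z\<^sup>n\<close> then make the state square summable.\<close>

lemma U0_transfer:
  assumes schur: "schur_parameters \<Theta> \<Gamma>" and z: "norm z < 1"
  shows "\<exists>h\<in>H0_space (\<lambda>n. cadjoint (\<Gamma> n)). U0 (\<lambda>n. cadjoint (\<Gamma> n)) (\<Theta> z m, h) = (m, z *\<^sub>C h)"
proof -
  interpret choice_sequence \<Gamma> using schur by (rule schur_parameters_choice_sequence)
  let ?G = "\<lambda>n. cadjoint (\<Gamma> n)"
  interpret G: choice_sequence ?G by (rule cadjoint_choice_sequence)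
  obtain u v where u0: "u 0 = m" and v0: "v 0 = \<Theta> z m"
    and J: "\<And>n. J_rot \<Gamma> n (u n, z *\<^sub>C v (Suc n)) = (v n, u (Suc n))"
    and u_in: "\<And>n. u n \<in> dom_space \<Gamma> n" and v_in: "\<And>n. v n \<in> cod_space \<Gamma> n"
    and v_le: "\<And>n. norm (v n) \<le> norm (u n)"
    using schur_trajectory[OF schur z, of m] by blast
  have uv_in: "(u n, z *\<^sub>C v (Suc n)) \<in> dom_space \<Gamma> n \<times> cod_space \<Gamma> (Suc n)" for n
    using u_in v_in closed_csubspaceD(6)[OF cod_closed] by blast
  have J_inv: "J_rot ?G n (c *\<^sub>C v n, c *\<^sub>C u (Suc n)) = (c *\<^sub>C u n, (c * z) *\<^sub>C v (Suc n))" for n c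
  proof -
    have "J_rot ?G n (c *\<^sub>C (v n, u (Suc n))) = c *\<^sub>C (u n, z *\<^sub>C v (Suc n))"
      using J_rot_cadjoint[OF uv_in[of n]] unitary_betweenD(1)[OF G.J_rot_unitary]
      by (simp add: J bounded_clinear_scaleC)
    then show ?thesis by (simp add: scaleC_prod_def scaleC_scaleC)
  qed
  define s where "s = (norm z)\<^sup>2"
  have s: "0 \<le> s" "s < 1" using z by (auto simp: s_def power_less_one_iff abs_square_less_1)
  have energy: "(norm (v n))\<^sup>2 + (norm (u (Suc n)))\<^sup>2 = (norm (u n))\<^sup>2 + s * (norm (v (Suc n)))\<^sup>2" for n
  proof -
    have "norm (v n, u (Suc n)) = norm (u n, z *\<^sub>C v (Suc n))"
      using unitary_betweenD(2)[OF J_rot_unitary uv_in[of n]] by (simp add: J)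
    then have "(norm (v n, u (Suc n)))\<^sup>2 = (norm (u n, z *\<^sub>C v (Suc n)))\<^sup>2" by simp
    then show ?thesis by (simp add: norm_Pair_square norm_scaleC power_mult_distrib s_def)
  qed
  have sv: "s * (norm (v n))\<^sup>2 \<le> s * (norm (u n))\<^sup>2" "s * (norm (v n))\<^sup>2 \<le> (norm (v n))\<^sup>2" for n
    using s v_le by (auto intro!: mult_left_mono power_mono mult_left_le_one_le)
  have gap: "(norm (u n))\<^sup>2 - (norm (v n))\<^sup>2 \<le> (norm m)\<^sup>2" for n
  proof (induction n)
    case (Suc n)
    then show ?case using energy[of n] sv(2)[of "Suc n"] by linarith
  qed (simp add: u0)
  have u_bound: "(norm (u (Suc n)))\<^sup>2 \<le> (norm m)\<^sup>2 / (1 - s)" for n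
  proof -
    have "(norm (u (Suc n)))\<^sup>2 - s * (norm (u (Suc n)))\<^sup>2 \<le> (norm m)\<^sup>2"
      using energy[of n] sv(1)[of "Suc n"] gap[of n] by linarith
    then show ?thesis using s by (simp add: field_simps)
  qed
  define f where "f n = (z ^ n *\<^sub>C v (Suc (2 * n)), z ^ n *\<^sub>C u (Suc (Suc (2 * n))))" for n
  have "summable (\<lambda>n. (norm (f n))\<^sup>2)"
  proof (rule summable_comparison_test'[where N = 0])
    show "summable (\<lambda>n. (2 * ((norm m)\<^sup>2 / (1 - s))) * s ^ n)"
      using s by (intro summable_mult summable_geometric) simp
    fix n
    have "(norm (v (Suc (2 * n))))\<^sup>2 \<le> (norm m)\<^sup>2 / (1 - s)"
      using power_mono[OF v_le norm_ge_zero, of "Suc (2 * n)" 2] u_bound[of "2 * n"] by linarith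
    then have "(norm (v (Suc (2 * n))))\<^sup>2 + (norm (u (Suc (Suc (2 * n)))))\<^sup>2 \<le> 2 * ((norm m)\<^sup>2 / (1 - s))"
      using u_bound[of "Suc (2 * n)"] by linarith
    then have "s ^ n * ((norm (v (Suc (2 * n))))\<^sup>2 + (norm (u (Suc (Suc (2 * n)))))\<^sup>2)
        \<le> s ^ n * (2 * ((norm m)\<^sup>2 / (1 - s)))"
      using s by (intro mult_left_mono) auto
    moreover have "(norm (f n))\<^sup>2 = s ^ n * ((norm (v (Suc (2 * n))))\<^sup>2 + (norm (u (Suc (Suc (2 * n)))))\<^sup>2)"
      by (simp add: f_def norm_Pair_square norm_scaleC norm_power power_mult_distrib s_def distrib_left
          flip: power_mult) (simp add: mult.commute)
    ultimately have "(norm (f n))\<^sup>2 \<le> (2 * ((norm m)\<^sup>2 / (1 - s))) * s ^ n"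
      by (simp only: mult.commute[of _ "s ^ n"])
    then show "norm ((norm (f n))\<^sup>2) \<le> (2 * ((norm m)\<^sup>2 / (1 - s))) * s ^ n"
      by simp
  qed
  then have nth: "ell2_nth (Abs_ell2 f) = f" by (rule ell2_nth_Abs)
  define h where "h = Abs_ell2 f"
  have h_nth: "ell2_nth h n = (z ^ n *\<^sub>C v (Suc (2 * n)), z ^ n *\<^sub>C u (Suc (Suc (2 * n))))" for n
    by (simp only: h_def nth) (rule f_def)
  have h_in: "h \<in> H0_space ?G"
    unfolding G.H0_space_sum orthogonal_sum_def dom_cadjoint cod_cadjoint mem_Collect_eq h_nth
    by (intro allI SigmaI closed_csubspaceD(6)[OF cod_closed] closed_csubspaceD(6)[OF dom_closed]
        u_in v_in)
  have V_nth: "ell2_nth (V0 ?G h) n = (z ^ n *\<^sub>C u (Suc (2 * n)), z ^ Suc n *\<^sub>C v (Suc (Suc (2 * n))))" for n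
    by (simp add: G.V0_nth h_nth J_inv mult.commute)
  have R_nth: "ell2_nth (regroup (\<Theta> z m, V0 ?G h)) n = (z ^ n *\<^sub>C v (2 * n), z ^ n *\<^sub>C u (Suc (2 * n)))" for n
    by (cases n) (simp_all add: ell2_nth_regroup V_nth v0)
  define k where "k = ell2_map (\<lambda>n. J_rot ?G (2 * n)) (regroup (\<Theta> z m, V0 ?G h))"
  have k_nth: "ell2_nth k n = (z ^ n *\<^sub>C u (2 * n), z ^ Suc n *\<^sub>C v (Suc (2 * n)))" for n
    by (simp add: k_def ell2_nth_map[OF G.J_rot_le] R_nth J_inv mult.commute)
  have "snd (ungroup k) = z *\<^sub>C h"
    by (rule ell2_eqI)
      (simp add: ell2_nth_snd_ungroup k_nth scaleC_ell2.rep_eq h_nth scaleC_prod_def scaleC_scaleC)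
  moreover have "fst (ungroup k) = m" by (simp add: fst_ungroup k_nth u0)
  ultimately have "U0 ?G (\<Theta> z m, h) = (m, z *\<^sub>C h)"
    by (simp add: G.U0_eq prod_eq_iff flip: k_def)
  with h_in show ?thesis by blast
qed

theorem theorem8p2:
  fixes \<Theta> :: "complex \<Rightarrow> 'm::chilbert_space \<Rightarrow> 'n::chilbert_space"
    and \<Gamma> :: "nat \<Rightarrow> 'm \<Rightarrow> 'n"
  assumes "separable_space (euclidean :: 'm topology)"
    and "separable_space (euclidean :: 'n topology)"
    and "\<Theta> \<in> schur_class UNIV UNIV"
    and "\<forall>f. f \<noteq> 0 \<longrightarrow> norm (\<Theta> 0 f) < norm f"
    and "schur_parameters \<Theta> \<Gamma>"
  shows "let \<Gamma>' = (\<lambda>n. cadjoint (\<Gamma> n));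
             H = H0_space \<Gamma>'; T = T0 \<Gamma>';
             Ht = H0t_space \<Gamma>'; Tt = T0t \<Gamma>'
         in completely_nonunitary H T \<and>
            coincide (defect_space H T) (defect_space H (cadjoint T)) (char_fun H T) UNIV UNIV \<Theta> \<and>
            completely_nonunitary Ht Tt \<and>
            coincide (defect_space Ht Tt) (defect_space Ht (cadjoint Tt)) (char_fun Ht Tt) UNIV UNIV \<Theta>"
proof -
  let ?G = "\<lambda>n. cadjoint (\<Gamma> n)"
  interpret choice_sequence \<Gamma> using assms(5) by (rule schur_parameters_choice_sequence)
  interpret G: choice_sequence ?G by (rule cadjoint_choice_sequence)
  note pure = assms(4)[rule_format]
  have transfer_t: "\<exists>h\<in>H0t_space ?G. U0t ?G (\<Theta> z m, h) = (m, z *\<^sub>C h)" if z: "norm z < 1" for z m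
  proof -
    obtain h where h: "h \<in> H0_space ?G" "U0 ?G (\<Theta> z m, h) = (m, z *\<^sub>C h)"
      using U0_transfer[OF assms(5) z] by blast
    note V = unitary_betweenD[OF G.V0_unitary]
    have "U0t ?G (\<Theta> z m, V0 ?G h) = (m, z *\<^sub>C V0 ?G h)"
      using G.U0t_conjugate[OF h(2)] by (simp add: bounded_clinear_scaleC[OF V(1)])
    then show ?thesis using V(3)[OF h(1)] by blast
  qed
  show ?thesis
    unfolding Let_def G.T0_main_op G.T0t_main_op
    using G.U0.main_op_completely_nonunitary[OF G.U0_no_unitary_part]
      G.U0t.main_op_completely_nonunitary[OF G.U0t_no_unitary_part]
      G.U0.char_fun_coincides[OF pure U0_transfer[OF assms(5)]]
      G.U0t.char_fun_coincides[OF pure transfer_t]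
    by blast
qed

end
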